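(* Let $X$ be a closed hyperbolic Riemann surface and $n\ge2$. For all integers $k,p$ with $1\le p\le n$, $2\le k\le n$, and any simple closed geodesics $\alpha,\beta$ of $X$, the following holds at the Fuchsian point of $\mathcal H(\Sigma,n)$ determined by $X$: $$d\log\lambda^{(p)}_\alpha\bigl(\psi^0(i\cdot\Theta^{(k)}_\beta)\bigr)=-\,d\log\lambda^{(p)}_\beta\bigl(\psi^0(i\cdot\Theta^{(k)}_\alpha)\bigr),$$ where $\lambda^{(p)}_\gamma(\delta)$ is the $p$-th largest eigenvalue of $\delta(\gamma)$ and $\Theta^{(k)}_\gamma$ is the relative Poincaré series of order $k$ of $\gamma$.
   Context: Setting. $X=\Gamma\backslash\mathbb H^2$ is a closed Riemann surface of genus $\ge2$ with its conformal hyperbolic metric of curvature $-1$ and area form $d\sigma$; $\Sigma$ is the underlying oriented surface, $K$ the canonical bundle. Locally $d\sigma=i\,h\,dz\wedge d\bar z$, and the hermitian metric on $K^k$ is $\langle dz^k,dz^k\rangle=h^{-k}$. $\mathcal H(\Sigma,n)$ (the Hitchin component) is the set of conjugacy classes of representations $\pi_1(\Sigma)\to\mathsf{PSL}(n,\mathbb R)$ (lifted to $\mathsf{SL}(n,\mathbb R)$) that can be continuously deformed to a Fuchsian one; the Fuchsian representation attached to $X$ is $\delta=\iota_n\circ\delta_X$, with $\delta_X$ the monodromy of the hyperbolic metric and $\iota_n$ the irreducible representation of $\mathsf{PSL}(2,\mathbb R)$ in $\mathsf{PSL}(n,\mathbb R)$. For a Hitchin representation $\delta$ and $\gamma\neq1$,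 $\delta(\gamma)$ has $n$ distinct positive eigenvalues. Relative Poincaré series. For a closed geodesic associated to $\gamma\in\Gamma$ with repelling and attracting fixed points $u,U\in\partial\mathbb H^2$, let $\theta_{u,U}(z)=\frac{(U-u)\,dz}{(z-u)(z-U)}$ and $\Theta^{(k)}_\gamma=\sum_{\eta\in\Gamma/\langle\gamma\rangle}\eta^*\theta_{u,U}^k\in H^0(X,K^k)$. Standard deformation. Let $a,x,y$ be generators of $\mathfrak{sl}(2)$ with $[a,x]=x$, $[a,y]=-y$, $[x,y]=-a$, and $\kappa_n:\mathfrak{sl}(2)\to\mathfrak{sl}(n,\mathbb C)$ the irreducible embedding given in a unitary basis $\hat w_1,\dots,\hat w_n$ by $X_n=\kappa_n(x)$, $Y_n=\kappa_n(y)$, $-X_n\hat w_p=c_p\hat w_{p+1}$, $Y_n\hat w_p=c_{p-1}\hat w_{p-1}$, $c_p=(p(n-p)/2)^{1/2}$; so $Y_n=\rho(X_n)$ for $\rho(M)=-M^*$. Put $E^0_k=(-\sqrt2X_n)^k$. With $\mathfrak g_m$ the $m$-eigenspace of $\mathrm{ad}\,\kappa_n(a)$ on $\mathfrak{sl}(n,\mathbb C)$, let $\mathcal G=\bigoplus_m\mathfrak g_m\otimes K^m$, with the Cartan involutions $\rho$ induced by the hermitian metric on $K$, the Chern connection $\nabla$, and $\Phi_0=Y_n\otimes1\in\mathfrak g_{-1}\otimes K^{-1}\otimes K$. Then $D=\nabla+\Phi_0-\rho(\Phi_0)$ is flat with monodromy $\delta$. For $q\in H^0(X,K^k)$ set $\phi^0(q)=q\otimes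 E^0_{k-1}$ and $\psi^0(q)=\phi^0(q)-\rho(\phi^0(q))$; this is a $D$-closed real $1$-form whose class is a tangent vector in $\mathsf T_\delta\mathcal H(\Sigma,n)$. *)

theory Defs
  imports
    "HOL-Analysis.Analysis"
    "HOL-Algebra.Generated_Groups"
    "HOL-Computational_Algebra.Polynomial"
begin

type_synonym 'n rmatrix = "real^'n^'n"
type_synonym 'n cmatrix = "complex^'n^'n"

section \<open>Closed hyperbolic surfaces\<close>

definition upper_half :: "complex set" where
  "upper_half = {z. Im z > 0}"

definition SL :: "(real^'m^'m) monoid" where
  "SL = \<lparr>carrier = {A. det A = 1}, mult = (**), one = mat 1\<rparr>"

definition mob :: "real^2^2 \<Rightarrow> complex \<Rightarrow> complex" where
  "mob g = moebius (of_real (g$1$1)) (of_real (g$1$2)) (of_real (g$2$1)) (of_real (g$2$2))"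

text \<open>The factor \<open>c z + d\<close>; the derivative of \<open>mob g\<close> at \<open>z\<close> is its inverse square.\<close>

definition autf :: "real^2^2 \<Rightarrow> complex \<Rightarrow> complex" where
  "autf g z = of_real (g$2$1) * z + of_real (g$2$2)"

text \<open>A closed hyperbolic surface is \<open>\<Gamma>\<backslash>\<H>\<^sup>2\<close> for a subgroup of \<open>PSL(2,\<real>)\<close> acting freely, properly
  discontinuously and cocompactly. Here \<open>\<Gamma>\<close> is the full preimage of that subgroup in \<open>SL(2,\<real>)\<close>, so
  that \<open>-1 \<in> \<Gamma>\<close> and \<open>\<pi>\<^sub>1 = \<Gamma>/\<plusminus>1\<close>.\<close>

definition closed_hyperbolic_surface :: "(real^2^2) set \<Rightarrow> bool" where
  "closed_hyperbolic_surface \<Gamma> \<longleftrightarrow>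
     subgroup \<Gamma> SL \<and> - mat 1 \<in> \<Gamma> \<and>
     (\<forall>g\<in>\<Gamma>. \<forall>z\<in>upper_half. mob g z = z \<longrightarrow> g = mat 1 \<or> g = - mat 1) \<and>
     (\<forall>K. compact K \<and> K \<subseteq> upper_half \<longrightarrow> finite {g\<in>\<Gamma>. mob g ` K \<inter> K \<noteq> {}}) \<and>
     (\<exists>K. compact K \<and> K \<subseteq> upper_half \<and> (\<Union>g\<in>\<Gamma>. mob g ` K) = upper_half)"

abbreviation grp :: "(real^2^2) set \<Rightarrow> (real^2^2) monoid" where
  "grp \<Gamma> \<equiv> SL\<lparr>carrier := \<Gamma>\<rparr>"


section \<open>Closed geodesics and relative Poincare series\<close>

text \<open>Fixed points on the boundary circle in homogeneous coordinates: the vector \<open>w\<close> stands for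
  \<open>w\<^sub>1/w\<^sub>2 \<in> \<real> \<union> {\<infinity>}\<close>. For a hyperbolic matrix these are its eigenvectors.\<close>

definition attracting :: "real^2^2 \<Rightarrow> real^2" where
  "attracting g = (SOME w. w \<noteq> 0 \<and> (\<exists>\<mu>. \<bar>\<mu>\<bar> > 1 \<and> g *v w = \<mu> *s w))"

definition repelling :: "real^2^2 \<Rightarrow> real^2" where
  "repelling g = (SOME w. w \<noteq> 0 \<and> (\<exists>\<mu>. \<bar>\<mu>\<bar> < 1 \<and> g *v w = \<mu> *s w))"

text \<open>\<open>hlin w z\<close> is \<open>w\<^sub>2 (z - w\<^sub>1/w\<^sub>2)\<close>, but is also meaningful for \<open>w\<^sub>2 = 0\<close>.\<close>

definition hlin :: "real^2 \<Rightarrow> complex \<Rightarrow> complex" where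
  "hlin w z = of_real (w$2) * z - of_real (w$1)"

text \<open>The geodesic from the repelling point \<open>u\<close> to the attracting point \<open>U\<close>: the map
  \<open>(z - u)/(z - U)\<close>, up to a real factor, carries it to the imaginary axis.\<close>

definition geod_axis :: "real^2^2 \<Rightarrow> complex set" where
  "geod_axis g = {z \<in> upper_half. Re (hlin (repelling g) z / hlin (attracting g) z) = 0}"

text \<open>Closed geodesics are given by hyperbolic elements of \<open>\<Gamma>\<close>. The geodesic is simple (and traversed
  once) iff the map from the axis modulo \<open>\<gamma>\<close> to the surface is injective.\<close>

definition stab :: "(real^2^2) set \<Rightarrow> real^2^2 \<Rightarrow> (real^2^2) set" where
  "stab \<Gamma> \<gamma> = generate (grp \<Gamma>) {- mat 1, \<gamma>}"

definition simple_closed_geodesic :: "(real^2^2) set \<Rightarrow> real^2^2 \<Rightarrow> bool" where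
  "simple_closed_geodesic \<Gamma> \<gamma> \<longleftrightarrow>
     \<gamma> \<in> \<Gamma> \<and> \<bar>trace \<gamma>\<bar> > 2 \<and>
     (\<forall>\<eta>\<in>\<Gamma>. \<forall>z\<in>geod_axis \<gamma>. mob \<eta> z \<in> geod_axis \<gamma> \<longrightarrow> \<eta> \<in> stab \<Gamma> \<gamma>)"

text \<open>The coefficient of \<open>dz\<close> in \<open>\<theta>\<^bsub>u,U\<^esub> = (U - u) dz / ((z - u)(z - U))\<close>. The expression is homogeneous
  of degree \<open>0\<close> in each of the two vectors.\<close>

definition theta :: "real^2^2 \<Rightarrow> complex \<Rightarrow> complex" where
  "theta \<gamma> z =
     (let u = repelling \<gamma>; U = attracting \<gamma> in
       of_real (U$1 * u$2 - u$1 * U$2) / (hlin u z * hlin U z))"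

text \<open>Sections of \<open>K\<^sup>k\<close> are given by their coefficient of \<open>dz\<^sup>k\<close> on the upper half plane.\<close>

definition pullback :: "nat \<Rightarrow> real^2^2 \<Rightarrow> (complex \<Rightarrow> complex) \<Rightarrow> complex \<Rightarrow> complex" where
  "pullback k \<eta> f z = f (mob \<eta> z) * (1 / (autf \<eta> z)\<^sup>2) ^ k"

text \<open>As \<open>(\<gamma>\<eta>)\<^sup>*\<theta> = \<eta>\<^sup>*\<gamma>\<^sup>*\<theta> = \<eta>\<^sup>*\<theta>\<close>, the summand depends only on the coset \<open>\<langle>\<plusminus>\<gamma>\<rangle>\<eta>\<close>, and those are the
  cosets that index the sum.\<close>

definition Theta :: "(real^2^2) set \<Rightarrow> nat \<Rightarrow> real^2^2 \<Rightarrow> complex \<Rightarrow> complex" where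
  "Theta \<Gamma> k \<gamma> z =
     (\<Sum>\<^sub>\<infinity>C \<in> rcosets\<^bsub>grp \<Gamma>\<^esub> (stab \<Gamma> \<gamma>).
        pullback k (SOME \<eta>. \<eta> \<in> C) (\<lambda>w. theta \<gamma> w ^ k) z)"


section \<open>The irreducible embedding\<close>

text \<open>\<open>n\<close> is \<open>CARD('n)\<close>; \<open>pos\<close> numbers the index type as \<open>1, \<dots>, n\<close>.\<close>

definition pos :: "'n::{finite,linorder} \<Rightarrow> nat" where
  "pos i = card {j. j \<le> i}"

text \<open>\<open>ccoef TYPE('n) p\<close> is \<open>c\<^sub>p\<close>; columns of \<open>Xn\<close> and \<open>Yn\<close> are the images of the basis vectors.\<close>

definition ccoef :: "'n::{finite,linorder} itself \<Rightarrow> nat \<Rightarrow> real" where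
  "ccoef T p = sqrt (real p * (real CARD('n) - real p) / 2)"

definition Xn :: "'n::{finite,linorder} cmatrix" where
  "Xn = (\<chi> i j. if pos i = pos j + 1 then - of_real (ccoef TYPE('n) (pos j)) else 0)"

definition Yn :: "'n::{finite,linorder} cmatrix" where
  "Yn = (\<chi> i j. if pos j = pos i + 1 then of_real (ccoef TYPE('n) (pos i)) else 0)"

text \<open>The image of \<open>a = -[x,y]\<close>. It is diagonal with entries \<open>p - (n+1)/2\<close>, so the \<open>(i,j)\<close> entry of a
  matrix lies in the eigenspace of \<open>ad\<close> for the eigenvalue \<open>m = pos i - pos j\<close>.\<close>

definition An :: "'n::{finite,linorder} cmatrix" where
  "An = Yn ** Xn - Xn ** Yn"

definition cscale :: "complex \<Rightarrow> 'n::{finite,linorder} cmatrix \<Rightarrow> 'n cmatrix" where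
  "cscale c = map_matrix ((*) c)"

text \<open>The power on the type of matrices is entrywise, hence the iteration.\<close>

definition E0 :: "nat \<Rightarrow> 'n::{finite,linorder} cmatrix" where
  "E0 k = (((**) (cscale (- of_real (sqrt 2)) Xn)) ^^ k) (mat 1)"

text \<open>The representation \<open>\<iota>\<^sub>n\<close> on binary forms of degree \<open>n - 1\<close>: the \<open>j\<close>-th basis vector is
  \<open>X\<^bsup>j-1\<^esup> Y\<^bsup>n-j\<^esup>\<close>, sent to \<open>(aX + cY)\<^bsup>j-1\<^esup> (bX + dY)\<^bsup>n-j\<^esup>\<close>, here dehomogenised by \<open>Y = 1\<close>.\<close>

definition iota :: "real^2^2 \<Rightarrow> 'n::{finite,linorder} rmatrix" where
  "iota g = (\<chi> i j. coeff ([:g$2$1, g$1$1:] ^ (pos j - 1) * [:g$2$2, g$1$2:] ^ (CARD('n) - pos j))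
                          (pos i - 1))"


section \<open>The flat connection and the forms \<open>\<psi>\<^sup>0(q)\<close>\<close>

text \<open>On the upper half plane the bundle \<open>\<G>\<close> is trivialised by the frames \<open>dz\<^sup>m\<close>: a section is a
  matrix-valued function whose \<open>(i,j)\<close> entry is a coefficient of \<open>dz\<^sup>m\<close> with \<open>m = pos i - pos j\<close>.
  A 1-form with values in \<open>\<G>\<close> is a function of the base point and the tangent vector \<open>v\<close>,
  with \<open>dz\<close> evaluating to \<open>v\<close>.

  The area form \<open>dx dy / y\<^sup>2\<close> equals \<open>\<i> h dz \<and> cnj dz\<close> for the following \<open>h\<close>.\<close>

definition hh :: "complex \<Rightarrow> real" where
  "hh z = 1 / (2 * (Im z)\<^sup>2)"

text \<open>The Cartan involution \<open>M \<mapsto> -M\<^sup>*\<close>; as \<open>dz\<^sup>m\<close> has square norm \<open>h\<^bsup>-m\<^esup>\<close>, it sends \<open>M \<otimes> dz\<^sup>m\<close> to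
  \<open>-M\<^sup>* h\<^bsup>-m\<^esup> \<otimes> dz\<^bsup>-m\<^esup>\<close>. The \<open>(i,j)\<close> entry comes from the \<open>(j,i)\<close> entry, of weight \<open>pos j - pos i\<close>.\<close>

definition rho :: "complex \<Rightarrow> 'n::{finite,linorder} cmatrix \<Rightarrow> 'n cmatrix" where
  "rho z M = (\<chi> i j. - (of_real (hh z powi (int (pos i) - int (pos j))) * cnj (M$j$i)))"

definition Phi0 :: "complex \<Rightarrow> complex \<Rightarrow> 'n::{finite,linorder} cmatrix" where
  "Phi0 z v = cscale v Yn"

text \<open>The connection form of \<open>D = \<nabla> + \<Phi>\<^sub>0 - \<rho>(\<Phi>\<^sub>0)\<close>, acting on \<open>\<G>\<close> by commutators. In the frame \<open>dz\<^sup>m\<close> the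
  Chern connection is \<open>d + \<partial> log(h\<^bsup>-m\<^esup>) = d - m \<partial> log h\<close>, and \<open>\<partial> log h = (\<i> / Im z) dz\<close>.\<close>

definition connD :: "complex \<Rightarrow> complex \<Rightarrow> 'n::{finite,linorder} cmatrix" where
  "connD z v = cscale (- (\<i> / of_real (Im z)) * v) An + Phi0 z v - rho z (Phi0 z v)"

definition phi0 :: "nat \<Rightarrow> (complex \<Rightarrow> complex) \<Rightarrow> complex \<Rightarrow> complex \<Rightarrow> 'n::{finite,linorder} cmatrix" where
  "phi0 k q z v = cscale (q z * v) (E0 (k - 1))"

definition psi0 :: "nat \<Rightarrow> (complex \<Rightarrow> complex) \<Rightarrow> complex \<Rightarrow> complex \<Rightarrow> 'n::{finite,linorder} cmatrix" where
  "psi0 k q z v = phi0 k q z v - rho z (phi0 k q z v)"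

text \<open>The action on coefficients: the pullback by \<open>g\<close> of the section \<open>M\<close> of \<open>\<G>\<close> is
  \<open>J(g,z) M(gz) J(g,z)\<^sup>-\<^sup>1\<close>, i.e. entry \<open>(i,j)\<close> is multiplied by the \<open>m\<close>-th power of
  \<open>(cz+d)\<^sup>-\<^sup>2\<close>. \<open>J\<close> itself is the pullback on \<open>\<Oplus>\<^sub>p K\<^bsup>p-(n+1)/2\<^esup>\<close>, whose traceless endomorphisms form \<open>\<G>\<close>.\<close>

definition Jfac :: "real^2^2 \<Rightarrow> complex \<Rightarrow> 'n::{finite,linorder} cmatrix" where
  "Jfac g z = (\<chi> i j. if i = j then autf g z powi (int CARD('n) + 1 - 2 * int (pos i)) else 0)"

abbreviation cmat :: "'n::{finite,linorder} rmatrix \<Rightarrow> 'n cmatrix" where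
  "cmat \<equiv> map_matrix of_real"

text \<open>A flat frame: the columns of \<open>F\<close> are \<open>D\<close>-parallel, and the monodromy of \<open>D\<close> in this frame is
  the Fuchsian representation \<open>iota\<close> of \<open>\<Gamma>\<close>.\<close>

definition flat_frame :: "(real^2^2) set \<Rightarrow> (complex \<Rightarrow> 'n::{finite,linorder} cmatrix) \<Rightarrow> bool" where
  "flat_frame \<Gamma> F \<longleftrightarrow>
     (\<forall>z\<in>upper_half. invertible (F z) \<and>
        (F has_derivative (\<lambda>v. - (connD z v ** F z))) (at z) \<and>
        (\<forall>g\<in>\<Gamma>. Jfac g z ** F (mob g z) ** cmat (iota g) = F z))"


section \<open>The Hitchin component and its tangent vectors\<close>

text \<open>Representations of \<open>\<pi>\<^sub>1\<close> in \<open>PSL(n,\<real>)\<close> that lift are described by homomorphisms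
  \<open>\<Gamma> \<rightarrow> SL(n,\<real>)\<close>; an element of \<open>\<pi>\<^sub>1\<close> is then represented by a matrix that is determined up to sign.
  A discrete faithful representation \<open>\<pi>\<^sub>1 \<rightarrow> PSL(2,\<real>)\<close> is an injective \<open>j\<close> with discrete image
  and \<open>j(-1) = -1\<close>. A point of the Hitchin component is the conjugacy class of a representation
  in the following set.\<close>

definition fuchsian :: "(real^2^2) set \<Rightarrow> (real^2^2 \<Rightarrow> real^2^2) \<Rightarrow> bool" where
  "fuchsian \<Gamma> j \<longleftrightarrow> j \<in> hom (grp \<Gamma>) SL \<and> j (- mat 1) = - mat 1 \<and> inj_on j \<Gamma> \<and> discrete (j ` \<Gamma>)"

definition hitchin :: "(real^2^2) set \<Rightarrow> (real^2^2 \<Rightarrow> 'n::{finite,linorder} rmatrix) set" where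
  "hitchin \<Gamma> =
     {\<delta> \<in> hom (grp \<Gamma>) SL.
        \<exists>j c. fuchsian \<Gamma> j \<and>
          (\<forall>s\<in>{0..1::real}. c s \<in> hom (grp \<Gamma>) SL) \<and>
          (\<forall>g\<in>\<Gamma>. continuous_on {0..1} (\<lambda>s. c s g) \<and> c 0 g = \<delta> g \<and> c 1 g = iota (j g))}"

text \<open>\<open>lambda_eig p A\<close> is the \<open>p\<close>-th largest eigenvalue. The absolute value selects, among \<open>A\<close> and
  \<open>-A\<close>, the representative with positive spectrum when all eigenvalues are real and of equal sign.\<close>

definition lambda_eig :: "nat \<Rightarrow> 'n::{finite,linorder} rmatrix \<Rightarrow> real" where
  "lambda_eig p A = rev (sorted_list_of_set {\<bar>\<mu>\<bar> |\<mu>. \<exists>v. v \<noteq> 0 \<and> A *v v = \<mu> *s v}) ! (p - 1)"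

text \<open>The tangent space of the Hitchin component at \<open>iota\<close> is \<open>H\<^sup>1(\<Gamma>, sl(n,\<real>)\<^bsub>Ad iota\<^esub>)\<close>. The class of
  a closed 1-form \<open>\<psi>\<close> on the surface with values in the flat bundle corresponds to its period
  cocycles \<open>u\<close>: if \<open>W\<close> is a primitive of \<open>\<psi>\<close> in a flat frame then
  \<open>u(g) = W(gz) - Ad(iota g) W(z)\<close> does not depend on \<open>z\<close>. Changing \<open>W\<close> by a constant changes \<open>u\<close> by a
  coboundary.\<close>

definition periods :: "(real^2^2) set \<Rightarrow> (complex \<Rightarrow> complex \<Rightarrow> 'n::{finite,linorder} cmatrix)
    \<Rightarrow> (real^2^2 \<Rightarrow> 'n rmatrix) set" where
  "periods \<Gamma> \<psi> =
     {u. \<exists>F W. flat_frame \<Gamma> F \<and>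
        (\<forall>z\<in>upper_half.
           (W has_derivative (\<lambda>v. matrix_inv (F z) ** \<psi> z v ** F z)) (at z) \<and>
           (\<forall>g\<in>\<Gamma>. cmat (u g) = W (mob g z) - cmat (iota g) ** W z ** matrix_inv (cmat (iota g))))}"

definition tangent_curve ::
  "(real^2^2) set \<Rightarrow> (real^2^2 \<Rightarrow> 'n::{finite,linorder} rmatrix) \<Rightarrow> (real \<Rightarrow> real^2^2 \<Rightarrow> 'n rmatrix) \<Rightarrow> bool" where
  "tangent_curve \<Gamma> u c \<longleftrightarrow>
     (\<forall>\<^sub>F t in nhds 0. c t \<in> hitchin \<Gamma>) \<and>
     (\<forall>g\<in>\<Gamma>. c 0 g = iota g \<and> ((\<lambda>t. c t g) has_vector_derivative (u g ** iota g)) (at 0))"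

text \<open>\<open>d log \<lambda>\<^sup>(\<^sup>p\<^sup>)\<^sub>\<gamma>\<close> takes the value \<open>d\<close> at the tangent vector \<open>[\<psi>]\<close> at the Fuchsian point:
  \<open>d\<close> is the derivative of \<open>log \<lambda>\<^sup>(\<^sup>p\<^sup>)(\<delta>\<^sub>t(\<gamma>))\<close> along every curve \<open>\<delta>\<^sub>t\<close> in the Hitchin component with
  velocity \<open>[\<psi>]\<close>. It is also given by the chain rule for the evaluation at \<open>\<gamma>\<close>, which sends \<open>u\<close> to
  the tangent vector \<open>u(\<gamma>) iota(\<gamma>)\<close> at the matrix \<open>iota(\<gamma>)\<close>; this determines \<open>d\<close> without reference to the
  existence of curves.\<close>

definition has_dlog_lambda :: "(real^2^2) set \<Rightarrow> nat \<Rightarrow> real^2^2 \<Rightarrow>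
    (complex \<Rightarrow> complex \<Rightarrow> 'n::{finite,linorder} cmatrix) \<Rightarrow> real \<Rightarrow> bool" where
  "has_dlog_lambda \<Gamma> p \<gamma> \<psi> d \<longleftrightarrow>
     periods \<Gamma> \<psi> \<noteq> {} \<and>
     (\<forall>u\<in>periods \<Gamma> \<psi>.
        (\<exists>L. ((\<lambda>A. ln (lambda_eig p A)) has_derivative L) (at (iota \<gamma>)) \<and> L (u \<gamma> ** iota \<gamma>) = d) \<and>
        (\<forall>c. tangent_curve \<Gamma> u c \<longrightarrow>
           ((\<lambda>t. ln (lambda_eig p (c t \<gamma>))) has_real_derivative d) (at 0)))"

end

theory Submission
  imports Defs "HOL-Complex_Analysis.Conformal_Mappings"
begin

text \<open>In a flat frame the conjugate of \<open>\<psi>\<^sup>0(q)\<close> is \<open>q \<Omega> dz\<close> plus its complex conjugate, with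
  \<open>\<Omega>\<close> holomorphic. The derivative of \<open>log \<lambda>\<^sup>(\<^sup>p\<^sup>)\<^sub>\<alpha>\<close> at \<open>iota \<alpha>\<close> is a diagonal entry of the period along
  \<open>\<alpha>\<close> in the eigenbasis of \<open>iota \<alpha>\<close>, hence a real constant that depends on \<open>p\<close>, \<open>k\<close> and \<open>n\<close> only times
  the imaginary part of the integral of \<open>\<Theta>\<^sub>\<beta> z'\<^sup>k\<close> along the axis \<open>z\<close> of \<open>\<alpha>\<close>. Unfolding that integral over
  the double cosets \<open>\<langle>\<beta>\<rangle>\<eta>\<langle>\<alpha>\<rangle>\<close> gives a sum of integrals over \<open>\<real>\<close> of the \<open>k\<close>-th powers of elementary kernels
  that depend only on the relative position of the axes of \<open>\<beta>\<close> and of \<open>\<eta>\<alpha>\<eta>\<^sup>-\<^sup>1\<close>. Interchanging \<open>\<alpha>\<close> and \<open>\<beta>\<close>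
  inverts the matrix \<open>(a b; c d)\<close> of relative position. If \<open>b c < 0\<close>, this reflects the parameter and
  conjugates the kernel; if \<open>b c > 0\<close>, the imaginary part of each integral vanishes.\<close>

section \<open>The kernel of two geodesics\<close>

text \<open>Conjugation by a diagonal matrix does not change diagonal entries. So the diagonal entry
  of a period is the increment of a primitive along one period of the axis, and the choice of the
  flat frame is harmless: two frames differ by a constant that commutes with
  \<open>iota \<alpha>\<close>, hence is diagonal in its eigenbasis. The constant in front of the
  integral is computed on the imaginary axis and carried to any axis by equivariance under all of
  SL(2,\<real>), so it is the same for \<alpha> and \<beta>. The connection and its frame in rank n
  are symmetric powers of 2 x 2 matrices up to a diagonal scaling, which leaves explicit identities
  of 2 x 2 matrices. The delicate points concern convergence. For k = 2 the summands must be
  square-summable over the cosets, which is obtained by counting areas. Two axes may share ends. A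
  single common end would keep the kernel at modulus 1 in the limit, against summability. If both
  ends are common, the kernel is \<plusminus>1 and has no imaginary part; such double cosets
  contribute nothing, although powers of \<alpha> may then fail to separate the cosets in
  them.\<close>

declare of_real_exp [simp del]

text \<open>Let \<open>g = (a b; c d)\<close> be of determinant 1. On the imaginary axis \<open>z(t) = \<i> e\<^sup>t\<close> this is \<open>\<theta>\<^bsub>u,U\<^esub>(z) z'\<close> for the
  geodesic from \<open>u = g 0\<close> to \<open>U = g \<infinity>\<close>.\<close>

definition kern :: "real \<Rightarrow> real \<Rightarrow> real \<Rightarrow> real \<Rightarrow> real \<Rightarrow> complex" where
  "kern a b c d t = \<i> * of_real (exp t) / ((of_real c * \<i> * of_real (exp t) - of_real a) * (of_real d * \<i> * of_real (exp t) - of_real b))"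

section \<open>Symmetries of the kernel\<close>

lemma linear_ne_0:
  assumes "a \<noteq> 0 \<or> c \<noteq> 0" "s > 0"
  shows "of_real c * \<i> * of_real s - of_real a \<noteq> 0"
  using assms by (auto simp: complex_eq_iff)

lemma kern_denom_ne_0:
  assumes "a * d - b * c = 1"
  shows "(of_real c * \<i> * of_real (exp t) - of_real a) * (of_real d * \<i> * of_real (exp t) - of_real b) \<noteq> 0"
proof -
  have "a \<noteq> 0 \<or> c \<noteq> 0" "b \<noteq> 0 \<or> d \<noteq> 0" using assms by auto
  from linear_ne_0[OF this(1)] linear_ne_0[OF this(2)] show ?thesis by simp
qed

lemma kern_ne_0:
  assumes "a * d - b * c = 1"
  shows "kern a b c d t \<noteq> 0"
  unfolding kern_def using kern_denom_ne_0[OF assms, of t] by simp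

lemma continuous_kern:
  assumes "a * d - b * c = 1"
  shows "continuous_on A (kern a b c d)"
  unfolding kern_def using kern_denom_ne_0[OF assms] by (intro continuous_intros) auto

text \<open>Advancing \<open>t\<close> by \<open>2 * ln m\<close> is the dilation of the imaginary
  axis by \<open>m\<^sup>2\<close>, that is the action of diag(m, 1/m); the inverse of this matrix
  multiplies the matrix of relative position from the left.\<close>

lemma kern_shift:
  assumes "m > 0"
  shows "kern a b c d (t + 2 * ln m) = kern (a / m) (b / m) (c * m) (d * m) t"
proof -
  define s where "s = complex_of_real (exp t)"
  define M where "M = complex_of_real m"
  have M: "M \<noteq> 0" using assms by (simp add: M_def)
  have e: "of_real (exp (t + 2 * ln m)) = s * M\<^sup>2"
    using assms by (simp add: s_def M_def exp_add exp_double flip: of_real_power of_real_mult)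
  have "(complex_of_real c * \<i> * (s * M\<^sup>2) - of_real a) = M * (of_real c * M * \<i> * s - of_real a / M)"
    "(complex_of_real d * \<i> * (s * M\<^sup>2) - of_real b) = M * (of_real d * M * \<i> * s - of_real b / M)"
    using M by (simp_all add: field_simps power2_eq_square)
  then show ?thesis
    unfolding kern_def e using M by (simp add: s_def[symmetric] M_def[symmetric] power2_eq_square)
qed

text \<open>The three reflections below share this substitution: \<open>t \<mapsto> ln l - t\<close>
  replaces \<open>s\<close> by \<open>l / s\<close>. On the imaginary axis this is z \<mapsto> -l/z
  as well as z \<mapsto> l/cnj z; the second form explains the reflections that conjugate the
  kernel.\<close>

lemma kern_reflect_aux:
  fixes a b c d l t :: real
  assumes "l > 0"
  defines "s \<equiv> of_real (exp t)"
  shows "kern a b c d (ln l - t) =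
     \<i> * s / ((of_real c * \<i> * of_real l - of_real a * s) * (of_real d * \<i> * of_real l - of_real b * s) / of_real l)"
proof -
  have s: "s \<noteq> 0" by (simp add: s_def)
  have e: "of_real (exp (ln l - t)) = of_real l / s"
    using assms by (simp add: s_def exp_diff flip: of_real_divide)
  have "(complex_of_real c * \<i> * (of_real l / s) - of_real a) = (of_real c * \<i> * of_real l - of_real a * s) / s"
    "(complex_of_real d * \<i> * (of_real l / s) - of_real b) = (of_real d * \<i> * of_real l - of_real b * s) / s"
    using s by (simp_all add: field_simps)
  then show ?thesis unfolding kern_def e using s assms by (simp add: field_simps)
qed

lemma cnj_kern:
  "cnj (kern a b c d t) = - (\<i> * of_real (exp t) / ((c * \<i> * of_real (exp t) + a) * (d * \<i> * of_real (exp t) + b)))"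
proof -
  have "cnj ((c * \<i> * of_real (exp t) - a) * (d * \<i> * of_real (exp t) - b)) = (c * \<i> * of_real (exp t) + a) * (d * \<i> * of_real (exp t) + b)"
    by (simp add: algebra_simps)
  then show ?thesis unfolding kern_def by simp
qed

text \<open>The geodesic of the matrix runs from b/d to a/c, that of its inverse from -b/a to -d/c.
  With l = -b/c > 0 the antiholomorphic map z \<mapsto> l/cnj z sends b/d to -d/c and a/c to -b/a.
  The sign from exchanging the ends cancels the one from reversing \<open>t\<close>, and a
  conjugation remains.\<close>

lemma kern_inverse_reflect_neg:
  assumes "b * c < 0" "a * d - b * c = 1"
  shows "kern d (-b) (-c) a (ln (- b / c) - t) = cnj (kern a b c d t)"
proof -
  define l where "l = - b / c"
  have l: "l > 0" "c \<noteq> 0" using assms by (auto simp: l_def zero_less_divide_iff mult_less_0_iff divide_neg_pos divide_pos_neg)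
  define s where "s = complex_of_real (exp t)"
  have b: "of_real b = - (complex_of_real c * of_real l)" using l by (simp add: l_def)
  have "((of_real (-c) * \<i> * of_real l - of_real d * s) * (of_real a * \<i> * of_real l - of_real (-b) * s) / of_real l)
      = - ((c * \<i> * s + a) * (d * \<i> * s + b))"
    using l unfolding of_real_minus b by (simp add: field_simps)
  then show ?thesis
    unfolding l_def[symmetric] kern_reflect_aux[OF l(1)] s_def[symmetric] cnj_kern by (simp add: s_def)
qed

text \<open>Now l = b/c > 0, and the holomorphic half turn z \<mapsto> -l/z has the same effect on
  the ends, so no conjugation appears.\<close>

lemma kern_inverse_reflect_pos:
  assumes "b * c > 0" "a * d - b * c = 1"
  shows "kern d (-b) (-c) a (ln (b / c) - t) = kern a b c d t"
proof -
  define l where "l = b / c"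
  have l: "l > 0" "c \<noteq> 0" using assms by (auto simp: l_def zero_less_divide_iff zero_less_mult_iff)
  define s where "s = complex_of_real (exp t)"
  have b: "of_real b = (complex_of_real c * of_real l)" using l by (simp add: l_def)
  have "((of_real (-c) * \<i> * of_real l - of_real d * s) * (of_real a * \<i> * of_real l - of_real (-b) * s) / of_real l)
      = (c * \<i> * s - a) * (d * \<i> * s - b)"
    using l unfolding of_real_minus b by (simp add: field_simps)
  then show ?thesis
    unfolding l_def[symmetric] kern_reflect_aux[OF l(1)] s_def[symmetric] by (simp add: kern_def s_def)
qed

text \<open>Here l is the product of the ends b/d and a/c. It is positive because a d = 1 + b c > 0,
  and the reflection z \<mapsto> l/cnj z exchanges the two ends of one and the same
  geodesic.\<close>

lemma kern_reflect:
  assumes "b * c > 0" "a * d - b * c = 1"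
  shows "kern a b c d (ln (a * b / (c * d)) - t) = cnj (kern a b c d t)"
proof -
  define l where "l = a * b / (c * d)"
  have "a * d > 0" using assms by auto
  with assms have nz: "a \<noteq> 0" "b \<noteq> 0" "c \<noteq> 0" "d \<noteq> 0" by auto
  have "(a * b) * (c * d) = (a * d) * (b * c)" by simp
  also have "\<dots> > 0" using \<open>a * d > 0\<close> assms(1) by simp
  finally have l: "l > 0" unfolding l_def by (simp add: zero_less_divide_iff zero_less_mult_iff)
  define s where "s = complex_of_real (exp t)"
  have b: "of_real b = (complex_of_real c * of_real d * of_real l / of_real a)" using nz by (simp add: l_def)
  have "((of_real c * \<i> * of_real l - of_real a * s) * (of_real d * \<i> * of_real l - of_real b * s) / of_real l)
      = - ((c * \<i> * s + a) * (d * \<i> * s + b))"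
    using l nz unfolding of_real_minus b by (simp add: field_simps)
  then show ?thesis
    unfolding l_def[symmetric] kern_reflect_aux[OF l(1)] s_def[symmetric] cnj_kern by (simp add: s_def)
qed

text \<open>The geodesic is the imaginary axis itself with one of its two orientations, and the
  kernel is the constant -1 or 1.\<close>

lemma kern_degenerate:
  assumes "b = 0 \<and> c = 0 \<or> a = 0 \<and> d = 0" "a * d - b * c = 1"
  shows "Im (kern a b c d t ^ k) = 0"
proof -
  have "kern a b c d t = -1 \<or> kern a b c d t = 1"
    using assms
  proof (elim disjE conjE)
    assume *: "b = 0" "c = 0"
    then have "complex_of_real a * of_real d = 1" using assms(2) by (metis diff_zero mult_zero_left of_real_1 of_real_mult)
    moreover from this have "a \<noteq> 0" "d \<noteq> 0" by auto
    ultimately show ?thesis using * by (auto simp: kern_def field_simps)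
  next
    assume *: "a = 0" "d = 0"
    then have "complex_of_real b * of_real c = -1" using assms(2)
      by (metis diff_0 minus_equation_iff mult_zero_left of_real_1 of_real_minus of_real_mult)
    moreover from this have "b \<noteq> 0" "c \<noteq> 0" by auto
    ultimately show ?thesis using * by (auto simp: kern_def field_simps)
  qed
  then have "kern a b c d t \<in> \<real>" by auto
  then show ?thesis using complex_is_Real_iff by auto
qed

section \<open>The kernel near the ends of the axis\<close>

lemma norm_kern_bot:
  assumes "a \<noteq> 0" "b \<noteq> 0"
  shows "((\<lambda>t. norm (kern a b c d t)) \<longlongrightarrow> 0) at_bot"
proof (rule Lim_null_comparison)
  have le: "\<bar>a\<bar> \<le> norm (complex_of_real c * \<i> * of_real (exp t) - of_real a)" for a c t :: real
    using abs_Re_le_cmod[of "complex_of_real c * \<i> * of_real (exp t) - a"] by simp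
  show "\<forall>\<^sub>F t in at_bot. norm (norm (kern a b c d t)) \<le> exp t / \<bar>a * b\<bar>"
  proof (rule always_eventually, rule allI)
    fix t
    have "exp t / (norm (complex_of_real c * \<i> * of_real (exp t) - of_real a) * norm (complex_of_real d * \<i> * of_real (exp t) - of_real b)) \<le> exp t / (\<bar>a\<bar> * \<bar>b\<bar>)"
      using assms by (intro divide_left_mono mult_mono le mult_pos_pos less_le_trans[OF _ le]) auto
    then show "norm (norm (kern a b c d t)) \<le> exp t / \<bar>a * b\<bar>"
      by (simp add: kern_def norm_mult norm_divide abs_mult)
  qed
  show "((\<lambda>t. exp t / \<bar>a * b\<bar>) \<longlongrightarrow> 0) at_bot"
    using tendsto_divide[OF exp_at_bot tendsto_const, of "\<bar>a*b\<bar>"] assms by simp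
qed

text \<open>The half turn z \<mapsto> -1/z exchanges the ends of the axis, so the limits at
  \<open>at_top\<close> follow from those at \<open>at_bot\<close>.\<close>

lemma kern_neg: "kern a b c d (-t) = - kern c d (-a) (-b) t"
proof -
  define s where "s = complex_of_real (exp t)"
  have s: "s \<noteq> 0" by (simp add: s_def)
  have e: "of_real (exp (-t)) = 1 / s" by (simp add: s_def exp_minus field_simps)
  have 1: "(complex_of_real c * \<i> * (1 / s) - of_real a) = \<i> / s * (of_real (-a) * - \<i> * s + of_real c)"
    "(complex_of_real d * \<i> * (1 / s) - of_real b) = \<i> / s * (of_real (-b) * - \<i> * s + of_real d)"
    using s by (auto simp add: field_simps)
  have "kern a b c d (-t) = \<i> * s / (- ((of_real (-a) * \<i> * s - of_real c) * (of_real (-b) * \<i> * s - of_real d)))"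
    unfolding kern_def e 1 using s by (simp add: field_simps)
  then show ?thesis by (simp add: kern_def s_def)
qed

text \<open>A zero in the first row means that the geodesic has the end 0 in common with the
  imaginary axis. The two are asymptotic there, and the kernel does not decay.\<close>

lemma norm_kern_bot_1:
  assumes "a = 0 \<or> b = 0" "a * d - b * c = 1"
  shows "((\<lambda>t. norm (kern a b c d t)) \<longlongrightarrow> 1) at_bot"
proof -
  have key: "((\<lambda>t. norm (kern 0 b c d t)) \<longlongrightarrow> 1) at_bot" if "b * c = -1" for b c d :: real
  proof -
    have nz: "b \<noteq> 0" "c \<noteq> 0" using that by auto
    have "kern 0 b c d = (\<lambda>t. 1 / (of_real c * (of_real d * \<i> * of_real (exp t) - of_real b)))"
      unfolding kern_def by (rule ext) simp
    moreover have "((\<lambda>t. 1 / (of_real c * (of_real d * \<i> * of_real (exp t) - of_real b)))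
        \<longlongrightarrow> 1 / (of_real c * (of_real d * \<i> * complex_of_real 0 - of_real b))) at_bot"
      using nz by (intro tendsto_intros exp_at_bot) auto
    moreover have "complex_of_real b * of_real c = -1" by (metis that of_real_1 of_real_minus of_real_mult)
    ultimately have "(kern 0 b c d \<longlongrightarrow> 1) at_bot" by (simp add: mult.commute)
    from tendsto_norm[OF this] show ?thesis by simp
  qed
  from assms(1) show ?thesis
  proof
    assume "a = 0" then show ?thesis using key assms by auto
  next
    assume "b = 0"
    moreover have "kern a b c d = (\<lambda>t. kern b a d c t)" by (auto simp: kern_def mult.commute)
    moreover have "((\<lambda>t. norm (kern 0 (-a) d (-c) t)) \<longlongrightarrow> 1) at_bot" using key[of "-a" d "-c"] assms \<open>b = 0\<close> by auto
    moreover have "norm (kern 0 (-a) d (-c) t) = norm (kern 0 a d c t)" for t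
    proof -
      have "complex_of_real (-c) * \<i> * of_real (exp t) - of_real (-a) = - (of_real c * \<i> * of_real (exp t) - of_real a)"
        by simp
      then have "kern 0 (-a) d (-c) t = - kern 0 a d c t"
        unfolding kern_def by (simp only: mult_minus_right minus_divide_right)
      then show ?thesis by simp
    qed
    ultimately show ?thesis by auto
  qed
qed

lemma norm_kern_top:
  assumes "c \<noteq> 0" "d \<noteq> 0"
  shows "((\<lambda>t. norm (kern a b c d t)) \<longlongrightarrow> 0) at_top"
  unfolding filterlim_at_top_mirror kern_neg norm_minus_cancel
  using norm_kern_bot[OF assms] by simp

lemma norm_kern_top_1:
  assumes "c = 0 \<or> d = 0" "a * d - b * c = 1"
  shows "((\<lambda>t. norm (kern a b c d t)) \<longlongrightarrow> 1) at_top"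
  unfolding filterlim_at_top_mirror kern_neg norm_minus_cancel
  using norm_kern_bot_1[OF assms(1), of "-b" "-a"] assms(2) by (simp add: algebra_simps)

section \<open>Improper integrals from sums over periods\<close>

lemma antiderivative_tendsto_at_top:
  fixes f F :: "real \<Rightarrow> real"
  assumes der: "\<And>t. (f has_real_derivative F t) (at t)"
    and F: "(F \<longlongrightarrow> 0) at_top" and l: "l > 0"
    and lim: "(\<lambda>n::nat. f (of_nat n * l)) \<longlonglongrightarrow> L"
  shows "(f \<longlongrightarrow> L) at_top"
proof (rule tendstoI)
  fix e :: real assume e: "e > 0"
  \<comment> \<open>With this bound on \<open>F\<close> the function \<open>f\<close> varies by at
    most \<open>e / 2\<close> over a length \<open>l\<close>, so \<open>f t\<close> can be compared
    with \<open>f\<close> at the last multiple of \<open>l\<close> before \<open>t\<close>.\<close>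
  from tendstoD[OF F, of "e / (2 * l)"] e l obtain T where T: "\<And>t. t \<ge> T \<Longrightarrow> \<bar>F t\<bar> < e / (2 * l)"
    by (auto simp: eventually_at_top_linorder)
  from tendstoD[OF lim, of "e / 2"] e obtain N where N: "\<And>n. n \<ge> N \<Longrightarrow> \<bar>f (of_nat n * l) - L\<bar> < e / 2"
    by (auto simp: eventually_sequentially dist_real_def)
  show "\<forall>\<^sub>F t in at_top. dist (f t) L < e"
    unfolding eventually_at_top_linorder
  proof (intro exI allI impI)
    fix t assume t: "t \<ge> max 0 (max (T + l) ((real N + 1) * l))"
    define n where "n = nat \<lfloor>t / l\<rfloor>"
    have tl: "t / l \<ge> real N + 1" using t l by (simp add: field_simps)
    then have n: "real n \<le> t / l" "t / l < real n + 1" unfolding n_def by linarith+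
    have nN: "n \<ge> N" using n tl by linarith
    have n': "real n * l \<le> t" "t < real n * l + l" using n l by (simp_all add: field_simps)
    have "norm (f t - f (real n * l)) \<le> e / (2 * l) * norm (t - real n * l)"
    proof (rule field_differentiable_bound[of "{real n * l..t}"])
      fix z assume "z \<in> {real n * l..t}"
      then show "(f has_field_derivative F z) (at z within {real n * l..t})" "norm (F z) \<le> e / (2 * l)"
        using der T[of z] n' t by (auto intro: has_field_derivative_at_within less_imp_le)
    qed (use n' in auto)
    also have "\<dots> \<le> e / (2 * l) * l" using n' e l by (intro mult_left_mono) auto
    also have "\<dots> = e / 2" using l by simp
    finally show "dist (f t) L < e" using N[OF nN] unfolding dist_real_def real_norm_def by linarith
  qed
qed

lemma telescoping_summable_limit:
  fixes f :: "real \<Rightarrow> real"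
  assumes s: "((\<lambda>n::nat. f (of_nat (Suc n) * l) - f (of_nat n * l)) has_sum X) UNIV"
  shows "(\<lambda>n::nat. f (of_nat n * l)) \<longlonglongrightarrow> X + f 0"
proof -
  have "(\<lambda>n. (\<Sum>i<n. f (of_nat (Suc i) * l) - f (of_nat i * l))) \<longlonglongrightarrow> X"
    using has_sum_imp_sums[OF s] by (simp add: sums_def)
  then have "(\<lambda>n::nat. f (of_nat n * l) - f 0) \<longlonglongrightarrow> X"
    unfolding sum_lessThan_telescope[of "\<lambda>i. f (of_nat i * l)"] by simp
  from tendsto_add[OF this tendsto_const[of "f 0"]] show ?thesis by simp
qed

lemma telescoping_has_sum_int:
  fixes f F :: "real \<Rightarrow> real"
  assumes der: "\<And>t. (f has_real_derivative F t) (at t)"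
    and F: "(F \<longlongrightarrow> 0) at_top" "(F \<longlongrightarrow> 0) at_bot" and l: "l > 0"
    and s: "((\<lambda>m::int. f (of_int (m + 1) * l) - f (of_int m * l)) has_sum X) UNIV"
  obtains P Q where "(f \<longlongrightarrow> P) at_top" "(f \<longlongrightarrow> Q) at_bot" "X = P - Q"
proof -
  let ?g = "\<lambda>m::int. f (of_int (m + 1) * l) - f (of_int m * l)"
  \<comment> \<open>Summability over the integers is unconditional, so the two halves can be treated
    separately. With the negative integers written as \<open>- int n - 1\<close>, the second half
    has the terms f(-n l) - f(-(n+1) l), and both halves telescope from \<open>f 0\<close>.\<close>
  let ?A = "range int" and ?B = "range (\<lambda>n::nat. - int n - 1)"
  have U: "?A \<union> ?B = UNIV"
  proof (intro equalityI subset_UNIV subsetI)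
    fix m :: int
    have "m = int (nat m) \<or> m = - int (nat (- m - 1)) - 1" by linarith
    then show "m \<in> ?A \<union> ?B" by blast
  qed
  have D: "?A \<inter> ?B = {}" by auto
  have "?g summable_on ?A" "?g summable_on ?B"
    using s summable_on_subset_banach has_sum_imp_summable by blast+
  then obtain X1 X2 where X1: "(?g has_sum X1) ?A" and X2: "(?g has_sum X2) ?B"
    using summable_on_def by blast
  have "(?g has_sum (X1 + X2)) UNIV" using has_sum_Un_disjoint[OF X1 X2 D] unfolding U .
  then have X: "X = X1 + X2" using s has_sum_unique by blast
  have inj: "inj int" "inj (\<lambda>n::nat. - int n - 1)" by (auto intro: injI)
  have e1: "?g \<circ> int = (\<lambda>n::nat. f (of_nat (Suc n) * l) - f (of_nat n * l))"
    by (auto simp: algebra_simps)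
  have em: "of_int (- int n - 1 + 1) * l = - (of_nat n * l)" "of_int (- int n - 1) * l = - (of_nat (Suc n) * l)" for n
    by (simp_all add: algebra_simps)
  have e2: "?g \<circ> (\<lambda>n::nat. - int n - 1) =
      (\<lambda>n::nat. f (- (of_nat n * l)) - f (- (of_nat (Suc n) * l)))"
    unfolding o_def em ..
  have "((\<lambda>n::nat. f (of_nat (Suc n) * l) - f (of_nat n * l)) has_sum X1) UNIV"
    using X1 unfolding has_sum_reindex[OF inj(1)] e1 .
  from telescoping_summable_limit[OF this]
  have P: "(f \<longlongrightarrow> X1 + f 0) at_top"
    by (rule antiderivative_tendsto_at_top[OF der F(1) l])
  have "((\<lambda>n::nat. f (- (of_nat n * l)) - f (- (of_nat (Suc n) * l))) has_sum X2) UNIV"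
    using X2 unfolding has_sum_reindex[OF inj(2)] e2 .
  from has_sum_cmult_right[OF this, of "-1"]
  have "((\<lambda>n::nat. f (- (of_nat (Suc n) * l)) - f (- (of_nat n * l))) has_sum - X2) UNIV" by simp
  from telescoping_summable_limit[where f = "\<lambda>t. f (- t)", OF this]
  have lim: "(\<lambda>n::nat. f (- (of_nat n * l))) \<longlonglongrightarrow> - X2 + f (-0)" .
  have Fm: "((\<lambda>t. - F (- t)) \<longlongrightarrow> 0) at_top"
    using tendsto_minus[OF F(2)] unfolding filterlim_at_bot_mirror by simp
  have derm: "((\<lambda>t. f (- t)) has_real_derivative - F (- t)) (at t)" for t
    using DERIV_chain2[OF der, of uminus "-1" t UNIV] by (simp add: derivative_intros)
  have "((\<lambda>t. f (- t)) \<longlongrightarrow> - X2 + f (-0)) at_top"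
    by (rule antiderivative_tendsto_at_top[OF derm Fm l lim])
  then have Q: "(f \<longlongrightarrow> - X2 + f 0) at_bot"
    unfolding filterlim_at_bot_mirror by simp
  show ?thesis by (rule that[OF P Q]) (simp add: X)
qed

lemma reflect_tendsto:
  fixes f :: "real \<Rightarrow> real"
  shows "(f \<longlongrightarrow> L) at_bot \<Longrightarrow> ((\<lambda>t. f (c - t)) \<longlongrightarrow> L) at_top"
    "(f \<longlongrightarrow> L) at_top \<Longrightarrow> ((\<lambda>t. f (c - t)) \<longlongrightarrow> L) at_bot"
proof -
  have 1: "filterlim (\<lambda>t. c - t) at_bot at_top"
    unfolding filterlim_at_bot eventually_at_top_linorder
    by (rule allI, rule_tac x = "c - Z" in exI) auto
  have 2: "filterlim (\<lambda>t. c - t) at_top at_bot"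
    unfolding filterlim_at_top eventually_at_bot_linorder
    by (rule allI, rule_tac x = "c - Z" in exI) auto
  show "(f \<longlongrightarrow> L) at_bot \<Longrightarrow> ((\<lambda>t. f (c - t)) \<longlongrightarrow> L) at_top"
    using filterlim_compose[OF _ 1, of f "nhds L"] .
  show "(f \<longlongrightarrow> L) at_top \<Longrightarrow> ((\<lambda>t. f (c - t)) \<longlongrightarrow> L) at_bot"
    using filterlim_compose[OF _ 2, of f "nhds L"] .
qed

lemma antiderivative_real:
  fixes F :: "real \<Rightarrow> real"
  assumes "continuous_on UNIV F"
  obtains f where "\<And>t. (f has_real_derivative F t) (at t)"
proof -
  have "\<exists>f. \<forall>x. -\<infinity> < ereal x \<longrightarrow> ereal x < \<infinity> \<longrightarrow> (f has_vector_derivative F x) (at x)"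
    by (rule einterval_antiderivative) (use assms in \<open>auto simp: continuous_on_eq_continuous_at\<close>)
  then show ?thesis using that by (auto simp: has_real_derivative_iff_has_vector_derivative)
qed

lemma Im_kern_power_tendsto:
  assumes "a \<noteq> 0" "b \<noteq> 0" "c \<noteq> 0" "d \<noteq> 0" "k > 0"
  shows "((\<lambda>t. Im (kern a b c d t ^ k)) \<longlongrightarrow> 0) at_top" "((\<lambda>t. Im (kern a b c d t ^ k)) \<longlongrightarrow> 0) at_bot"
proof -
  have *: "((\<lambda>t. Im (kern a b c d t ^ k)) \<longlongrightarrow> 0) F" if "((\<lambda>t. norm (kern a b c d t)) \<longlongrightarrow> 0) F" for F
  proof (rule Lim_null_comparison)
    show "\<forall>\<^sub>F t in F. norm (Im (kern a b c d t ^ k)) \<le> norm (kern a b c d t) ^ k"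
      by (rule always_eventually) (metis abs_Im_le_cmod norm_power real_norm_def)
    show "((\<lambda>t. norm (kern a b c d t) ^ k) \<longlongrightarrow> 0) F"
      using tendsto_power[OF that, of k] \<open>k > 0\<close> by (simp add: power_0_left)
  qed
  show "((\<lambda>t. Im (kern a b c d t ^ k)) \<longlongrightarrow> 0) at_top" "((\<lambda>t. Im (kern a b c d t ^ k)) \<longlongrightarrow> 0) at_bot"
    by (rule *[OF norm_kern_top[OF assms(3,4)]], rule *[OF norm_kern_bot[OF assms(1,2)]])
qed

lemma integral_shift_antiderivative:
  fixes f F :: "real \<Rightarrow> real"
  assumes "\<And>t. (f has_real_derivative F t) (at t)" "l \<ge> 0"
  shows "integral {0..l} (\<lambda>t. F (t + of_int m * l)) = f (of_int (m + 1) * l) - f (of_int m * l)"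
proof -
  have "((\<lambda>t. F (t + of_int m * l)) has_integral (f (l + of_int m * l) - f (0 + of_int m * l))) {0..l}"
  proof (rule fundamental_theorem_of_calculus[OF assms(2)])
    fix x assume "x \<in> {0..l}"
    have "((\<lambda>t. f (t + of_int m * l)) has_real_derivative F (x + of_int m * l)) (at x within {0..l})"
      by (rule has_field_derivative_at_within[OF DERIV_shift[THEN iffD1, OF assms(1)]])
    then show "((\<lambda>t. f (t + of_int m * l)) has_vector_derivative F (x + of_int m * l)) (at x within {0..l})"
      by (simp add: has_real_derivative_iff_has_vector_derivative)
  qed
  then show ?thesis by (simp add: integral_unique algebra_simps)
qed

text \<open>The second kernel is that of the inverse matrix. The sums over \<open>m\<close> telescope to integrals over \<open>\<real>\<close>, and only
  their values along multiples of the period are used, so no integrability over \<open>\<real>\<close> is needed.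
  For \<open>b c < 0\<close> the reflection of \<open>t\<close> conjugates the kernel. For \<open>b c > 0\<close> it relates the two kernels
  without conjugation, while another reflection conjugates each of them, so both integrals vanish.\<close>

theorem kern_total_antisym:
  assumes det: "a * d - b * c = 1" and nz: "a \<noteq> 0" "b \<noteq> 0" "c \<noteq> 0" "d \<noteq> 0" "k > 0"
    and l: "l > 0" "l' > 0"
    and X: "((\<lambda>m::int. integral {0..l} (\<lambda>t. Im (kern a b c d (t + of_int m * l) ^ k))) has_sum X) UNIV"
    and X': "((\<lambda>m::int. integral {0..l'} (\<lambda>t. Im (kern d (-b) (-c) a (t + of_int m * l') ^ k))) has_sum X') UNIV"
  shows "X' = - X"
proof -
  define F where "F = (\<lambda>t. Im (kern a b c d t ^ k))"
  define F' where "F' = (\<lambda>t. Im (kern d (-b) (-c) a t ^ k))"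
  have det': "d * a - (-b) * (-c) = 1" using det by (simp add: algebra_simps)
  have "continuous_on UNIV F" unfolding F_def by (intro continuous_intros continuous_kern det)
  then obtain f where f: "\<And>t. (f has_real_derivative F t) (at t)" using antiderivative_real by blast
  have F0: "(F \<longlongrightarrow> 0) at_top" "(F \<longlongrightarrow> 0) at_bot"
    unfolding F_def by (rule Im_kern_power_tendsto[OF nz])+
  have F0': "(F' \<longlongrightarrow> 0) at_top" "(F' \<longlongrightarrow> 0) at_bot"
    unfolding F'_def by (rule Im_kern_power_tendsto; use nz in simp)+
  have "((\<lambda>m::int. f (of_int (m + 1) * l) - f (of_int m * l)) has_sum X) UNIV"
    using X unfolding integral_shift_antiderivative[OF f less_imp_le[OF l(1)], symmetric] F_def .
  then obtain P Q where PQ: "(f \<longlongrightarrow> P) at_top" "(f \<longlongrightarrow> Q) at_bot" "X = P - Q"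
    using telescoping_has_sum_int[OF f F0 l(1)] by metis
  have X'_eq: "X' = P' - Q'"
    if f': "\<And>t. (f' has_real_derivative F' t) (at t)" and "(f' \<longlongrightarrow> P') at_top" "(f' \<longlongrightarrow> Q') at_bot" for f' P' Q'
  proof -
    have s: "((\<lambda>m::int. f' (of_int (m + 1) * l') - f' (of_int m * l')) has_sum X') UNIV"
      using X' unfolding integral_shift_antiderivative[OF f' less_imp_le[OF l(2)], symmetric] F'_def .
    obtain P1 Q1 where PQ1: "(f' \<longlongrightarrow> P1) at_top" "(f' \<longlongrightarrow> Q1) at_bot" "X' = P1 - Q1"
      using telescoping_has_sum_int[OF f' F0' l(2) s] by metis
    have "P1 = P'" using tendsto_unique[OF trivial_limit_at_top_linorder PQ1(1) that(2)] .
    moreover have "Q1 = Q'" using tendsto_unique[OF trivial_limit_at_bot_linorder PQ1(2) that(3)] .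
    ultimately show ?thesis using PQ1(3) by simp
  qed
  have cnj: "Im (cnj z ^ k) = - Im (z ^ k)" for z :: complex
    by (metis cnj.simps(2) complex_cnj_power)
  have reflect: "((\<lambda>t. g (r - t)) has_real_derivative - G (r - t)) (at t)"
    if "\<And>t. (g has_real_derivative G t) (at t)" for g G r t
  proof -
    have "((\<lambda>t. r - t) has_real_derivative -1) (at t)" by (auto intro!: derivative_eq_intros)
    from DERIV_chain2[OF that this] show ?thesis by simp
  qed
  consider "b * c < 0" | "b * c > 0" using nz by (meson linorder_neqE_linordered_idom mult_eq_0_iff)
  then show ?thesis
  proof cases
    case 1
    define r where "r = ln (- b / c)"
    have "F' t = - F (r - t)" for t
      using kern_inverse_reflect_neg[OF 1 det, of "r - t"] by (simp add: F'_def F_def r_def cnj)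
    \<comment> \<open>As \<open>F' t = - F (r - t)\<close>, the function \<open>f (r - t)\<close> is
      a primitive of \<open>F'\<close>, and its limits are those of \<open>f\<close>
      exchanged.\<close>
    then have "X' = Q - P"
      using reflect[OF f, of r] by (intro X'_eq[where f' = "\<lambda>t. f (r - t)"] reflect_tendsto PQ) auto
    then show ?thesis using PQ by simp
  next
    case 2
    define r where "r = ln (b / c)"
    have "F' t = F (r - t)" for t
      using kern_inverse_reflect_pos[OF 2 det, of "r - t"] by (simp add: F'_def F_def r_def)
    then have X': "X' = - Q - (- P)"
      using DERIV_minus[OF reflect[OF f, of r]]
      by (intro X'_eq[where f' = "\<lambda>t. - f (r - t)"] tendsto_minus reflect_tendsto PQ) auto
    define q where "q = ln (a * b / (c * d))"
    have Fq: "F t = - F (q - t)" for t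
      using kern_reflect[OF 2 det, of "q - t"] by (simp add: F_def q_def cnj)
    \<comment> \<open>\<open>F\<close> is odd under the reflection, so \<open>h\<close> is constant.
      Its limits at the two ends are \<open>Q - P\<close> and \<open>P - Q\<close>, which forces
      \<open>P = Q\<close>.\<close>
    define h where "h t = f (q - t) - f t" for t
    have "(h has_real_derivative 0) (at t)" for t
      unfolding h_def using DERIV_diff[OF reflect[OF f, of q t] f[of t]] Fq[of t] by simp
    then have "h x = h y" for x y using DERIV_isconst_all[of h x y] by blast
    then obtain C where "\<And>t. h t = C" by blast
    then have hC: "h = (\<lambda>_. C)" by auto
    have "(h \<longlongrightarrow> Q - P) at_top" "(h \<longlongrightarrow> P - Q) at_bot"
      unfolding h_def by (intro tendsto_diff reflect_tendsto PQ)+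
    then have "C = Q - P" "C = P - Q"
      unfolding hC by (simp_all add: tendsto_const_iff)
    then show ?thesis using X' PQ by simp
  qed
qed

section \<open>The derivative of the eigenvalues\<close>

definition diagm :: "('n \<Rightarrow> 'a::zero) \<Rightarrow> 'a^'n^'n" where
  "diagm d = (\<chi> i j. if i = j then d i else 0)"

lemma diagm_mult: "(diagm d ** A) $ i $ j = d i * A $ i $ j"
  for d :: "'n::finite \<Rightarrow> 'a::semiring_1"
proof -
  have "(diagm d ** A) $ i $ j = (\<Sum>k\<in>UNIV. if i = k then d i * A $ k $ j else 0)"
    unfolding matrix_matrix_mult_def diagm_def by (simp add: if_distrib[of "\<lambda>x. x * _"] cong: if_cong)
  then show ?thesis by simp
qed

lemma mult_diagm: "(A ** diagm d) $ i $ j = A $ i $ j * d j"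
  for d :: "'n::finite \<Rightarrow> 'a::semiring_1"
proof -
  have "(A ** diagm d) $ i $ j = (\<Sum>k\<in>UNIV. if k = j then A $ i $ k * d k else 0)"
    unfolding matrix_matrix_mult_def diagm_def by (simp add: if_distrib[of "\<lambda>x. _ * x"] cong: if_cong)
  then show ?thesis by simp
qed

lemma diagm_vector: "(diagm d *v v) $ i = d i * v $ i"
  for d :: "'n::finite \<Rightarrow> 'a::semiring_1"
proof -
  have "(diagm d *v v) $ i = (\<Sum>k\<in>UNIV. if i = k then d i * v $ k else 0)"
    unfolding matrix_vector_mult_def diagm_def by (simp add: if_distrib[of "\<lambda>x. x * _"] cong: if_cong)
  then show ?thesis by simp
qed

lemma matrix_add_rdistrib: "(A + B) ** C = A ** C + B ** C"
  for A B :: "'a::semiring_1^'n::finite^'m"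
  by (simp add: matrix_matrix_mult_def vec_eq_iff sum.distrib distrib_right)

lemma matrix_diff_ldistrib: "A ** (B - C) = A ** B - A ** C"
  for B C :: "'a::ring_1^'n^'m::finite"
  by (simp add: matrix_matrix_mult_def vec_eq_iff sum_subtractf right_diff_distrib)

lemma matrix_diff_rdistrib: "(A - B) ** C = A ** C - B ** C"
  for A B :: "'a::ring_1^'n::finite^'m"
  by (simp add: matrix_matrix_mult_def vec_eq_iff sum_subtractf left_diff_distrib)

lemma abs_entry_le_norm: "\<bar>A $ i $ j\<bar> \<le> norm (A :: real^'m::finite^'n::finite)"
  using component_le_norm_cart[of "A $ i" j] Finite_Cartesian_Product.norm_nth_le[of A i] by simp

text \<open>The eigenvector equation with \<open>v\<^sub>j = 1\<close> is a fixed point equation for the other entries, to which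
  Brouwer's theorem applies.\<close>

lemma perturbed_eigenvector:
  fixes E :: "real^'n::finite^'n" and d :: "'n \<Rightarrow> real"
  defines "N \<equiv> real CARD('n)"
  assumes gap: "\<And>i. i \<noteq> j \<Longrightarrow> \<bar>d j - d i\<bar> \<ge> \<delta>" and \<delta>: "\<delta> > 0"
    and small: "N * norm E \<le> \<delta> / 2"
  shows "\<exists>v \<mu>. v $ j = 1 \<and> (\<forall>i. i \<noteq> j \<longrightarrow> \<bar>v $ i\<bar> \<le> 2 * N * norm E / \<delta>) \<and>
           (diagm d + E) *v v = \<mu> *s v \<and> \<bar>\<mu> - d j - E $ j $ j\<bar> \<le> 2 * N\<^sup>2 * (norm E)\<^sup>2 / \<delta>"
proof -
  \<comment> \<open>The quotient of \<open>N * norm E\<close>, which bounds the entries of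
    \<open>E *v v\<close>, by half the gap. The assumption \<open>small\<close> makes it at most 1,
    and this in turn is what bounds the entries of \<open>E *v v\<close> on
    \<open>Q\<close>.\<close>
  define r where "r = 2 * N * norm E / \<delta>"
  have N: "N \<ge> 0" by (simp add: N_def)
  have r: "0 \<le> r" "r \<le> 1" using small \<delta> N by (auto simp: r_def field_simps)
  define Q where "Q = (cbox (\<chi> i. if i = j then 1 else - r) (\<chi> i. if i = j then 1 else r) :: (real^'n) set)"
  have Q: "v \<in> Q \<longleftrightarrow> v $ j = 1 \<and> (\<forall>i. i \<noteq> j \<longrightarrow> \<bar>v $ i\<bar> \<le> r)" for v
  proof
    assume "v \<in> Q"
    then have *: "(if i = j then 1 else - r) \<le> v $ i \<and> v $ i \<le> (if i = j then 1 else r)" for i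
      unfolding Q_def mem_box_cart by simp
    show "v $ j = 1 \<and> (\<forall>i. i \<noteq> j \<longrightarrow> \<bar>v $ i\<bar> \<le> r)"
    proof (intro conjI allI impI)
      show "v $ j = 1" using *[of j] by simp
      show "\<bar>v $ i\<bar> \<le> r" if "i \<noteq> j" for i using *[of i] that by (simp add: abs_le_iff)
    qed
  next
    assume *: "v $ j = 1 \<and> (\<forall>i. i \<noteq> j \<longrightarrow> \<bar>v $ i\<bar> \<le> r)"
    show "v \<in> Q" unfolding Q_def mem_box_cart
    proof
      fix i
      from * have "i \<noteq> j \<Longrightarrow> - r \<le> v $ i \<and> v $ i \<le> r" by (auto simp: abs_le_iff minus_le_iff)
      with * show "(\<chi> i. if i = j then 1 else - r) $ i \<le> v $ i \<and> v $ i \<le> (\<chi> i. if i = j then 1 else r) $ i"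
        by (cases "i = j") simp_all
    qed
  qed
  have bound: "\<bar>(E *v v) $ i\<bar> \<le> N * norm E" if "v \<in> Q" for v i
  proof -
    have "\<bar>(E *v v) $ i\<bar> \<le> (\<Sum>k\<in>UNIV. \<bar>E $ i $ k * v $ k\<bar>)"
      unfolding matrix_vector_mult_def by simp
    also have "\<dots> \<le> (\<Sum>k\<in>(UNIV::'n set). norm E * 1)"
    proof (rule sum_mono)
      fix k
      have "\<bar>v $ k\<bar> \<le> 1" using that r unfolding Q by (cases "k = j") (auto intro: order_trans)
      then show "\<bar>E $ i $ k * v $ k\<bar> \<le> norm E * 1"
        unfolding abs_mult by (intro mult_mono abs_entry_le_norm) auto
    qed
    finally show ?thesis by (simp add: N_def)
  qed
  have den: "\<bar>d j + (E *v v) $ j - d i\<bar> \<ge> \<delta> / 2" if "v \<in> Q" "i \<noteq> j" for v i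
    using bound[OF that(1), of j] gap[OF that(2)] small by linarith
  define T where "T v = (\<chi> i. if i = j then 1 else (E *v v) $ i / (d j + (E *v v) $ j - d i))" for v
  have "continuous_on Q T"
    unfolding T_def
  proof (intro continuous_intros)
    fix i
    have c: "continuous_on Q (\<lambda>v. (E *v v) $ k)" for k
      by (intro continuous_on_component linear_continuous_on) (simp add: matrix_vector_mul_bounded_linear)
    show "continuous_on Q (\<lambda>v. if i = j then 1 else (E *v v) $ i / (d j + (E *v v) $ j - d i))"
    proof (cases "i = j")
      case False
      then have "\<forall>v\<in>Q. d j + (E *v v) $ j - d i \<noteq> 0" using den \<delta> by fastforce
      then show ?thesis using False by (auto intro!: continuous_intros c)
    qed simp
  qed
  moreover have "T \<in> Q \<rightarrow> Q"
  proof (rule funcsetI)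
    fix v assume v: "v \<in> Q"
    have "\<bar>(E *v v) $ i / (d j + (E *v v) $ j - d i)\<bar> \<le> r" if "i \<noteq> j" for i
    proof -
      have "\<bar>(E *v v) $ i\<bar> / \<bar>d j + (E *v v) $ j - d i\<bar> \<le> (N * norm E) / (\<delta> / 2)"
        using bound[OF v] den[OF v that] \<delta> N by (intro frac_le) auto
      then show ?thesis by (simp add: r_def abs_divide field_simps)
    qed
    then show "T v \<in> Q" unfolding Q by (simp add: T_def)
  qed
  moreover have "compact Q" "convex Q" by (simp_all add: Q_def)
  moreover have "Q \<noteq> {}"
  proof -
    have "(\<chi> i. if i = j then 1 else 0) \<in> Q" unfolding Q using r by simp
    then show ?thesis by blast
  qed
  ultimately obtain v where v: "v \<in> Q" "T v = v" using brouwer by metis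
  define \<mu> where "\<mu> = d j + (E *v v) $ j"
  have "((diagm d + E) *v v) $ i = \<mu> * v $ i" for i
  proof (cases "i = j")
    case True
    then show ?thesis using v(1) unfolding Q by (simp add: matrix_vector_mult_add_rdistrib diagm_vector \<mu>_def)
  next
    case False
    have "T v $ i = (E *v v) $ i / (\<mu> - d i)" using False by (simp add: T_def \<mu>_def)
    then have "v $ i = (E *v v) $ i / (\<mu> - d i)" using v(2) by simp
    moreover have "\<mu> - d i \<noteq> 0" using den[OF v(1) False] \<delta> by (auto simp: \<mu>_def)
    ultimately have "v $ i * (\<mu> - d i) = (E *v v) $ i" by (simp add: field_simps)
    then show ?thesis by (simp add: matrix_vector_mult_add_rdistrib diagm_vector algebra_simps)
  qed
  then have "(diagm d + E) *v v = \<mu> *s v" by (simp add: vec_eq_iff)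
  moreover have "\<bar>\<mu> - d j - E $ j $ j\<bar> \<le> 2 * N\<^sup>2 * (norm E)\<^sup>2 / \<delta>"
  proof -
    \<comment> \<open>Since \<open>v $ j = 1\<close>, the first order term \<open>E $ j $ j\<close>
      splits off. In the remaining products the entry of \<open>v\<close> is itself at most
      \<open>r\<close>, hence the quadratic error.\<close>
    have "(E *v v) $ j = E $ j $ j * v $ j + (\<Sum>k\<in>UNIV - {j}. E $ j $ k * v $ k)"
      unfolding matrix_vector_mult_def by (simp add: sum.remove)
    then have "\<mu> - d j - E $ j $ j = (\<Sum>k\<in>UNIV - {j}. E $ j $ k * v $ k)"
      using v(1) by (simp add: \<mu>_def Q)
    also have "\<bar>\<dots>\<bar> \<le> (\<Sum>k\<in>UNIV - {j}. \<bar>E $ j $ k * v $ k\<bar>)" by (rule sum_abs)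
    also have "\<dots> \<le> (\<Sum>k\<in>UNIV - {j}. norm E * r)"
      using v(1) by (intro sum_mono) (auto simp: abs_mult Q intro!: mult_mono abs_entry_le_norm)
    also have "\<dots> \<le> N * (norm E * r)"
      using r unfolding N_def sum_constant by (intro mult_right_mono) (auto intro: card_mono)
    also have "\<dots> = 2 * N\<^sup>2 * (norm E)\<^sup>2 / \<delta>" by (simp add: r_def power2_eq_square)
    finally show ?thesis .
  qed
  ultimately show ?thesis using v(1) unfolding Q r_def by blast
qed

text \<open>Diagonal dominance makes \<open>V\<close> injective. Its columns thus form an
  eigenbasis, and no eigenvalue is missed.\<close>

lemma eigenvalues_of_near_diagonal:
  fixes A V :: "real^'n::finite^'n"
  assumes eig: "\<And>j. A *v column j V = \<mu> j *s column j V"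
    and diag: "\<And>j. V $ j $ j = 1" and off: "\<And>i j. i \<noteq> j \<Longrightarrow> \<bar>V $ i $ j\<bar> \<le> r"
    and r: "real CARD('n) * r < 1" "r \<ge> 0"
  shows "(\<exists>v. v \<noteq> 0 \<and> A *v v = x *s v) \<longleftrightarrow> (\<exists>j. x = \<mu> j)"
proof -
  have AV: "A *v (V *v y) = V *v (\<chi> j. \<mu> j * y $ j)" for y
  proof -
    have "A *v (V *v y) = (\<Sum>j\<in>UNIV. y $ j *s (A *v column j V))"
      unfolding matrix_mult_sum[of V y] by (simp add: linear_sum[OF matrix_vector_mul_linear] vector_scalar_commute o_def)
    also have "\<dots> = (\<Sum>j\<in>UNIV. (\<mu> j * y $ j) *s column j V)" unfolding eig by (simp add: vector_smult_assoc mult.commute)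
    also have "\<dots> = V *v (\<chi> j. \<mu> j * y $ j)" unfolding matrix_mult_sum[of V "\<chi> j. \<mu> j * y $ j"] by simp
    finally show ?thesis .
  qed
  have inj: "y = 0" if y: "V *v y = 0" for y
  proof -
    obtain i where i: "\<And>k. \<bar>y $ k\<bar> \<le> \<bar>y $ i\<bar>"
    proof -
      have "Max (range (\<lambda>k. \<bar>y $ k\<bar>)) \<in> range (\<lambda>k. \<bar>y $ k\<bar>)" by (intro Max_in) auto
      then obtain i where i: "Max (range (\<lambda>k. \<bar>y $ k\<bar>)) = \<bar>y $ i\<bar>" by blast
      have "\<bar>y $ k\<bar> \<le> \<bar>y $ i\<bar>" for k unfolding i[symmetric] by (intro Max_ge) auto
      then show ?thesis using that by blast
    qed
    have "0 = (V *v y) $ i" using y by simp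
    also have "\<dots> = V $ i $ i * y $ i + (\<Sum>k\<in>UNIV - {i}. V $ i $ k * y $ k)"
      unfolding matrix_vector_mult_def by (simp add: sum.remove)
    finally have "y $ i = - (\<Sum>k\<in>UNIV - {i}. V $ i $ k * y $ k)" by (simp add: diag)
    then have "\<bar>y $ i\<bar> = \<bar>\<Sum>k\<in>UNIV - {i}. V $ i $ k * y $ k\<bar>" by simp
    also have "\<dots> \<le> (\<Sum>k\<in>UNIV - {i}. \<bar>V $ i $ k * y $ k\<bar>)" by (rule sum_abs)
    also have "\<dots> \<le> (\<Sum>k\<in>UNIV - {i}. r * \<bar>y $ i\<bar>)"
      using off i r by (intro sum_mono) (auto simp: abs_mult intro!: mult_mono)
    also have "\<dots> \<le> real CARD('n) * (r * \<bar>y $ i\<bar>)"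
      using r unfolding sum_constant by (intro mult_right_mono) (auto intro: card_mono)
    finally have "\<bar>y $ i\<bar> * (1 - real CARD('n) * r) \<le> 0" by (simp add: algebra_simps)
    then have "\<bar>y $ i\<bar> \<le> 0" using r by (simp add: mult_le_0_iff)
    then have "\<bar>y $ k\<bar> \<le> 0" for k using i[of k] by linarith
    then show "y = 0" by (simp add: vec_eq_iff)
  qed
  have "inj ((*v) V)"
  proof (rule injI)
    fix x y assume "V *v x = V *v y"
    then have "V *v (x - y) = 0" by (simp add: matrix_vector_mult_diff_distrib)
    from inj[OF this] show "x = y" by simp
  qed
  then have surj: "surj ((*v) V)"
    using linear_injective_imp_surjective matrix_vector_mul_linear by blast
  show ?thesis
  proof
    assume "\<exists>v. v \<noteq> 0 \<and> A *v v = x *s v"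
    then obtain v where v: "v \<noteq> 0" "A *v v = x *s v" by blast
    obtain y where y: "v = V *v y" using surj by (metis surjD)
    have "y \<noteq> 0" using v(1) y by auto
    then obtain j where j: "y $ j \<noteq> 0" by (metis vec_eq_iff zero_index)
    have "V *v ((\<chi> j. \<mu> j * y $ j) - x *s y) = 0"
      using v(2) AV[of y] unfolding y by (simp add: matrix_vector_mult_diff_distrib vector_scalar_commute)
    from inj[OF this] have "((\<chi> j. \<mu> j * y $ j) - x *s y) $ j = 0" by (metis zero_index)
    then have "\<mu> j * y $ j - x * y $ j = 0" by simp
    then have "x = \<mu> j" using j by (simp flip: left_diff_distrib)
    then show "\<exists>j. x = \<mu> j" ..
  next
    assume "\<exists>j. x = \<mu> j"
    then obtain j where j: "x = \<mu> j" ..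
    have "column j V $ j = 1" using diag by (simp add: column_def)
    then have "column j V \<noteq> 0" by (metis zero_index zero_neq_one)
    then show "\<exists>v. v \<noteq> 0 \<and> A *v v = x *s v" using eig j by blast
  qed
qed

section \<open>The p-th largest eigenvalue and its derivative\<close>

lemma sorted_list_of_set_nth_eqI:
  fixes S :: "'a::linorder set"
  assumes "finite S" "x \<in> S" "card {y \<in> S. y < x} = m"
  shows "sorted_list_of_set S ! m = x"
proof -
  define xs where "xs = sorted_list_of_set S"
  have xs: "sorted_wrt (<) xs" "set xs = S" "distinct xs" using assms by (simp_all add: xs_def)
  obtain i where i: "i < length xs" "xs ! i = x" using assms(2) xs by (metis in_set_conv_nth)
  have "{y \<in> S. y < x} = (!) xs ` {..<i}"
  proof (intro equalityI subsetI)
    fix y assume y: "y \<in> {y \<in> S. y < x}"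
    then obtain l where l: "l < length xs" "xs ! l = y" using xs by (metis (no_types, lifting) in_set_conv_nth mem_Collect_eq)
    then have "l < i" using y i sorted_wrt_nth_less[OF xs(1), of i l]
      by (metis (no_types, lifting) linorder_neqE_nat mem_Collect_eq order_less_asym order_less_irrefl)
    then show "y \<in> (!) xs ` {..<i}" using l by blast
  next
    fix y assume "y \<in> (!) xs ` {..<i}"
    then obtain l where "l < i" "y = xs ! l" by blast
    then show "y \<in> {y \<in> S. y < x}"
      using sorted_wrt_nth_less[OF xs(1), of l i] i xs(2) by (auto intro: nth_mem)
  qed
  moreover have "inj_on ((!) xs) {..<i}" using xs(3) i by (auto simp: inj_on_def nth_eq_iff_index_eq)
  ultimately have "card {y \<in> S. y < x} = i" by (simp add: card_image)
  then show ?thesis using i assms(3) by (simp add: xs_def)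
qed

lemma pos_eq_card_less: "pos i = card {j. j < i} + 1" for i :: "'n::{finite,linorder}"
proof -
  have "{j. j \<le> i} = insert i {j. j < i}" by auto
  then show ?thesis unfolding pos_def by simp
qed

text \<open>\<open>lambda_eig\<close> sorts a set, in which coinciding moduli would merge. Strictly
  increasing moduli give it \<open>CARD('n)\<close> elements, and \<open>j\<close> then has the
  place \<open>CARD('n) - p\<close>, counted from 0, in increasing order.\<close>

lemma lambda_eig_eq:
  fixes A :: "real^'n::{finite,linorder}^'n::{finite,linorder}" and \<mu> :: "'n \<Rightarrow> real"
  assumes eig: "\<And>x. (\<exists>v. v \<noteq> 0 \<and> A *v v = x *s v) \<longleftrightarrow> (\<exists>j. x = \<mu> j)"
    and ord: "\<And>i j. i < j \<Longrightarrow> \<bar>\<mu> i\<bar> < \<bar>\<mu> j\<bar>"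
    and p: "pos j + p = CARD('n) + 1" "1 \<le> p"
  shows "lambda_eig p A = \<bar>\<mu> j\<bar>"
proof -
  define S where "S = range (\<lambda>i. \<bar>\<mu> i\<bar>)"
  have S: "{\<bar>x\<bar> | x. \<exists>v. v \<noteq> 0 \<and> A *v v = x *s v} = S" unfolding eig S_def by blast
  have inj: "inj (\<lambda>i. \<bar>\<mu> i\<bar>)"
    by (rule injI) (metis ord linorder_neqE order_less_irrefl)
  have fin: "finite S" by (simp add: S_def)
  have cS: "card S = CARD('n)" unfolding S_def by (simp add: card_image inj)
  have less: "\<bar>\<mu> i\<bar> < \<bar>\<mu> i'\<bar> \<longleftrightarrow> i < i'" for i i'
    by (metis ord linorder_neqE order_less_asym order_less_irrefl)
  have "{y \<in> S. y < \<bar>\<mu> j\<bar>} = (\<lambda>i. \<bar>\<mu> i\<bar>) ` {i. i < j}" unfolding S_def using less by auto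
  then have "card {y \<in> S. y < \<bar>\<mu> j\<bar>} = card {i. i < j}"
    by (simp add: card_image inj_on_subset[OF inj])
  also have "\<dots> = CARD('n) - p" using p pos_eq_card_less[of j] by simp
  finally have "sorted_list_of_set S ! (CARD('n) - p) = \<bar>\<mu> j\<bar>"
    by (intro sorted_list_of_set_nth_eqI fin) (auto simp: S_def)
  moreover have "rev (sorted_list_of_set S) ! (p - 1) = sorted_list_of_set S ! (CARD('n) - p)"
    using p pos_eq_card_less[of j] by (subst rev_nth) (auto simp: cS)
  ultimately show ?thesis unfolding lambda_eig_def S by simp
qed

text \<open>First order perturbation theory with a quadratic remainder, from which differentiability
  is immediate. The factor \<open>sgn (d j)\<close> is due to the absolute value in
  \<open>lambda_eig\<close>.\<close>

lemma lambda_eig_near_diagonal: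
  fixes d :: "'n::{finite,linorder} \<Rightarrow> real"
  assumes nz: "\<And>i. d i \<noteq> 0" and ord: "\<And>i j. i < j \<Longrightarrow> \<bar>d i\<bar> < \<bar>d j\<bar>"
    and p: "pos j + p = CARD('n) + 1" "1 \<le> p"
  obtains \<epsilon> K where "\<epsilon> > 0"
    "\<And>E. norm E \<le> \<epsilon> \<Longrightarrow> \<bar>lambda_eig p (diagm d + E) - \<bar>d j\<bar> - sgn (d j) * E $ j $ j\<bar> \<le> K * (norm E)\<^sup>2"
proof -
  define N where "N = real CARD('n)"
  have N: "N \<ge> 1" by (simp add: N_def Suc_le_eq)
  \<comment> \<open>The minimum of all moduli and of all differences of moduli: perturbations below
    half of it keep the signs and the order of the eigenvalues.\<close>
  define S where "S = (\<lambda>i. \<bar>d i\<bar>) ` UNIV \<union> (\<lambda>(i, j). \<bar>d j\<bar> - \<bar>d i\<bar>) ` {(i, j). i < j}"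
  have S: "finite S" "S \<noteq> {}" "\<And>x. x \<in> S \<Longrightarrow> x > 0" using nz ord by (auto simp: S_def)
  define \<eta> where "\<eta> = Min S"
  have \<eta>: "\<eta> > 0" using S by (simp add: \<eta>_def)
  have \<eta>1: "\<eta> \<le> \<bar>d i\<bar>" for i unfolding \<eta>_def using S by (intro Min_le) (auto simp: S_def)
  have \<eta>2: "\<eta> \<le> \<bar>d j\<bar> - \<bar>d i\<bar>" if "i < j" for i j unfolding \<eta>_def using S that by (intro Min_le) (auto simp: S_def)
  have gap: "\<bar>d j - d i\<bar> \<ge> \<eta>" if "i \<noteq> j" for i j
  proof (cases "i < j")
    case True
    show ?thesis using \<eta>2[OF True] by linarith
  next
    case False
    with that have "j < i" by simp
    show ?thesis using \<eta>2[OF \<open>j < i\<close>] by linarith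
  qed
  \<comment> \<open>The factor \<open>8 * N\<^sup>2\<close> serves three conditions: the smallness
    in \<open>perturbed_eigenvector\<close>, the diagonal dominance of the matrix of eigenvectors,
    and a displacement of each eigenvalue by less than \<open>\<eta> / 2\<close>.\<close>
  define \<epsilon> where "\<epsilon> = \<eta> / (8 * N\<^sup>2)"
  define K where "K = 2 * N\<^sup>2 / \<eta>"
  have NN: "N \<le> N\<^sup>2" "1 \<le> N\<^sup>2" using N by (simp_all add: self_le_power one_le_power)
  have main: "\<bar>lambda_eig p (diagm d + E) - \<bar>d j\<bar> - sgn (d j) * E $ j $ j\<bar> \<le> K * (norm E)\<^sup>2"
    if E: "norm E \<le> \<epsilon>" for E
  proof -
    define e where "e = norm E"
    have e: "0 \<le> e" "8 * N\<^sup>2 * e \<le> \<eta>" using E N by (simp_all add: e_def \<epsilon>_def pos_le_divide_eq mult.commute)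
    have "N * e \<le> N\<^sup>2 * e" "e \<le> N\<^sup>2 * e" using NN e(1) by (simp_all add: mult_right_mono mult_le_cancel_right1)
    then have small: "N * e \<le> \<eta> / 2" "8 * e \<le> \<eta>" using e \<eta> by linarith+
    have "\<exists>v \<mu>. v $ i = 1 \<and> (\<forall>l. l \<noteq> i \<longrightarrow> \<bar>v $ l\<bar> \<le> 2 * N * e / \<eta>) \<and>
        (diagm d + E) *v v = \<mu> *s v \<and> \<bar>\<mu> - d i - E $ i $ i\<bar> \<le> 2 * N\<^sup>2 * e\<^sup>2 / \<eta>" for i
      unfolding N_def e_def by (rule perturbed_eigenvector) (use gap \<eta> small in \<open>auto simp: N_def e_def\<close>)
    then have "\<forall>i. \<exists>w. fst w $ i = 1 \<and> (\<forall>l. l \<noteq> i \<longrightarrow> \<bar>fst w $ l\<bar> \<le> 2 * N * e / \<eta>) \<and>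
        (diagm d + E) *v fst w = snd w *s fst w \<and> \<bar>snd w - d i - E $ i $ i\<bar> \<le> K * e\<^sup>2"
      by (simp add: K_def)
    from choice[OF this] obtain w where w: "\<And>i. fst (w i) $ i = 1 \<and> (\<forall>l. l \<noteq> i \<longrightarrow> \<bar>fst (w i) $ l\<bar> \<le> 2 * N * e / \<eta>) \<and>
        (diagm d + E) *v fst (w i) = snd (w i) *s fst (w i) \<and> \<bar>snd (w i) - d i - E $ i $ i\<bar> \<le> K * e\<^sup>2"
      by blast
    define v where "v i = fst (w i)" for i
    define \<mu> where "\<mu> i = snd (w i)" for i
    have v: "\<And>i. v i $ i = 1" "\<And>i l. l \<noteq> i \<Longrightarrow> \<bar>v i $ l\<bar> \<le> 2 * N * e / \<eta>"
      "\<And>i. (diagm d + E) *v v i = \<mu> i *s v i" "\<And>i. \<bar>\<mu> i - d i - E $ i $ i\<bar> \<le> K * e\<^sup>2"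
      using w by (simp_all add: v_def \<mu>_def)
    define V where "V = (\<chi> l i. v i $ l)"
    have col: "column i V = v i" for i by (simp add: V_def column_def vec_eq_iff)
    have "N * (2 * N * e / \<eta>) = 2 * (N\<^sup>2 * e) / \<eta>" by (simp add: power2_eq_square)
    also have "\<dots> < 1" using e \<eta> by (simp add: field_simps)
    finally have r: "N * (2 * N * e / \<eta>) < 1" .
    have eig: "(\<exists>v. v \<noteq> 0 \<and> (diagm d + E) *v v = x *s v) \<longleftrightarrow> (\<exists>i. x = \<mu> i)" for x
      by (rule eigenvalues_of_near_diagonal[where V = V and r = "2 * N * e / \<eta>"])
        (use v r e \<eta> N in \<open>auto simp: col N_def\<close>, simp_all add: V_def v)
    have Ke: "K * e\<^sup>2 \<le> e / 4"
    proof -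
      have "K * e\<^sup>2 = (2 * N\<^sup>2 * e / \<eta>) * e" by (simp add: K_def power2_eq_square)
      also have "\<dots> \<le> (1/4) * e" using e \<eta> by (intro mult_right_mono) (simp_all add: field_simps)
      finally show ?thesis by simp
    qed
    have near: "\<bar>\<mu> i - d i\<bar> < \<eta> / 2" for i
      using v(4)[of i] abs_entry_le_norm[of E i i] Ke small \<eta> e unfolding e_def[symmetric] by linarith
    have "lambda_eig p (diagm d + E) = \<bar>\<mu> j\<bar>"
    proof (rule lambda_eig_eq[OF eig _ p])
      fix i l :: 'n assume "i < l"
      then show "\<bar>\<mu> i\<bar> < \<bar>\<mu> l\<bar>" using \<eta>2[of i l] near[of i] near[of l] by linarith
    qed
    also have "\<bar>\<mu> j\<bar> = sgn (d j) * \<mu> j"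
    proof (cases "d j > 0")
      case True
      then have "\<mu> j > 0" using near[of j] \<eta>1[of j] \<eta> by linarith
      then show ?thesis using True by simp
    next
      case False
      then have "\<mu> j < 0" "d j < 0" using near[of j] \<eta>1[of j] \<eta> nz[of j] by linarith+
      then show ?thesis by simp
    qed
    finally have l: "lambda_eig p (diagm d + E) = sgn (d j) * \<mu> j" .
    have "lambda_eig p (diagm d + E) - \<bar>d j\<bar> - sgn (d j) * E $ j $ j = sgn (d j) * (\<mu> j - d j - E $ j $ j)"
      unfolding l by (simp add: algebra_simps abs_sgn)
    then have "\<bar>lambda_eig p (diagm d + E) - \<bar>d j\<bar> - sgn (d j) * E $ j $ j\<bar> = \<bar>\<mu> j - d j - E $ j $ j\<bar>"
      using nz[of j] by (simp add: abs_mult abs_sgn_eq)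
    then show ?thesis using v(4)[of j] by (simp add: e_def)
  qed
  have "\<epsilon> > 0" using \<eta> N by (simp add: \<epsilon>_def)
  then show ?thesis using main that by blast
qed

lemma has_derivative_quadratic_error:
  fixes f :: "'a::real_normed_vector \<Rightarrow> 'b::real_normed_vector"
  assumes L: "bounded_linear L" and "\<epsilon> > 0"
    and bd: "\<And>E. norm E \<le> \<epsilon> \<Longrightarrow> norm (f (x + E) - f x - L E) \<le> K * (norm E)\<^sup>2"
  shows "(f has_derivative L) (at x)"
  unfolding has_derivative_at
proof (intro conjI L)
  show "((\<lambda>h. norm (f (x + h) - f x - L h) / norm h) \<longlongrightarrow> 0) (at 0)"
  proof (rule Lim_null_comparison)
    have "\<forall>\<^sub>F h in at 0. norm (h :: 'a) < \<epsilon> \<and> h \<noteq> 0"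
      using \<open>\<epsilon> > 0\<close> unfolding eventually_at by (intro exI[of _ \<epsilon>]) auto
    then show "\<forall>\<^sub>F h in at 0. norm (norm (f (x + h) - f x - L h) / norm h) \<le> K * norm h"
    proof eventually_elim
      case (elim h)
      then show ?case using bd[of h] by (simp add: field_simps power2_eq_square)
    qed
    have "((\<lambda>h::'a. K * norm h) \<longlongrightarrow> K * norm (0::'a)) (at 0)" by (intro tendsto_intros)
    then show "((\<lambda>h::'a. K * norm h) \<longlongrightarrow> 0) (at 0)" by simp
  qed
qed

lemma lambda_eig_similar:
  fixes A N N' :: "real^'n::{finite,linorder}^'n::{finite,linorder}"
  assumes "N ** N' = mat 1" "N' ** N = mat 1"
  shows "lambda_eig p (N' ** A ** N) = lambda_eig p A"
proof -
  have "(\<exists>v. v \<noteq> 0 \<and> (N' ** A ** N) *v v = x *s v) \<longleftrightarrow> (\<exists>v. v \<noteq> 0 \<and> A *v v = x *s v)" for x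
  proof safe
    fix v assume v: "v \<noteq> 0" "(N' ** A ** N) *v v = x *s v"
    have "A *v (N *v v) = (N ** N') *v (A *v (N *v v))" by (simp add: assms)
    also have "\<dots> = N *v ((N' ** A ** N) *v v)" by (simp add: matrix_vector_mul_assoc matrix_mul_assoc)
    also have "\<dots> = x *s (N *v v)" unfolding v(2) by (simp add: vector_scalar_commute)
    finally have "A *v (N *v v) = x *s (N *v v)" .
    moreover have "N *v v \<noteq> 0"
    proof
      assume "N *v v = 0"
      then have "(N' ** N) *v v = 0" by (simp flip: matrix_vector_mul_assoc)
      then show False using v(1) assms by simp
    qed
    ultimately show "\<exists>v. v \<noteq> 0 \<and> A *v v = x *s v" by blast
  next
    fix v assume v: "v \<noteq> 0" "A *v v = x *s v"
    have "(N' ** A ** N) *v (N' *v v) = N' *v (A *v ((N ** N') *v v))"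
      by (simp add: matrix_vector_mul_assoc matrix_mul_assoc)
    also have "\<dots> = x *s (N' *v v)" using v(2) by (simp add: assms vector_scalar_commute)
    finally have "(N' ** A ** N) *v (N' *v v) = x *s (N' *v v)" .
    moreover have "N' *v v \<noteq> 0"
    proof
      assume "N' *v v = 0"
      then have "(N ** N') *v v = 0" by (simp flip: matrix_vector_mul_assoc)
      then show False using v(1) assms by simp
    qed
    ultimately show "\<exists>v. v \<noteq> 0 \<and> (N' ** A ** N) *v v = x *s v" by blast
  qed
  then show ?thesis unfolding lambda_eig_def by simp
qed

text \<open>Similarity reduces this to a diagonal matrix. In the logarithmic derivative
  \<open>sgn (d j)\<close> is divided by the modulus of \<open>d j\<close>, so the sign of the
  chosen lift drops out and \<open>d j\<close> itself remains.\<close>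

theorem has_derivative_ln_lambda_eig:
  fixes A N N' :: "real^'n::{finite,linorder}^'n::{finite,linorder}" and d :: "'n \<Rightarrow> real"
  assumes inv: "N ** N' = mat 1" "N' ** N = mat 1" and A: "A = N ** diagm d ** N'"
    and nz: "\<And>i. d i \<noteq> 0" and ord: "\<And>i j. i < j \<Longrightarrow> \<bar>d i\<bar> < \<bar>d j\<bar>"
    and p: "pos j + p = CARD('n) + 1" "1 \<le> p"
  shows "((\<lambda>A. ln (lambda_eig p A)) has_derivative (\<lambda>E. (N' ** E ** N) $ j $ j / d j)) (at A)"
proof -
  obtain \<epsilon> K where \<epsilon>: "\<epsilon> > 0"
    and K: "\<And>E. norm E \<le> \<epsilon> \<Longrightarrow> \<bar>lambda_eig p (diagm d + E) - \<bar>d j\<bar> - sgn (d j) * E $ j $ j\<bar> \<le> K * (norm E)\<^sup>2"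
    using lambda_eig_near_diagonal[of d, OF nz ord p] by blast
  have l0: "lambda_eig p (diagm d) = \<bar>d j\<bar>" using K[of 0] \<epsilon> by simp
  have "linear (\<lambda>E :: real^'n::{finite,linorder}^'n::{finite,linorder}. sgn (d j) * E $ j $ j)"
    by (rule linearI) (simp_all add: distrib_left)
  then have "bounded_linear (\<lambda>E :: real^'n::{finite,linorder}^'n::{finite,linorder}. sgn (d j) * E $ j $ j)"
    by (simp add: linear_conv_bounded_linear)
  then have D: "(lambda_eig p has_derivative (\<lambda>E. sgn (d j) * E $ j $ j)) (at (diagm d))"
    using \<epsilon> by (rule has_derivative_quadratic_error) (use K l0 in auto)
  have "linear (\<lambda>E. N' ** E ** N)"
    by (rule linearI) (simp_all add: matrix_add_ldistrib matrix_add_rdistrib matrix_scalar_ac flip: scalar_matrix_assoc)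
  then have lin: "bounded_linear (\<lambda>E. N' ** E ** N)" by (simp add: linear_conv_bounded_linear)
  have "N' ** A ** N = (N' ** N) ** diagm d ** (N' ** N)" unfolding A by (simp add: matrix_mul_assoc)
  then have A': "N' ** A ** N = diagm d" by (simp add: inv)
  have "((\<lambda>A. lambda_eig p (N' ** A ** N)) has_derivative (\<lambda>E. sgn (d j) * (N' ** E ** N) $ j $ j)) (at A)"
    using has_derivative_compose[OF bounded_linear_imp_has_derivative[OF lin] D[folded A']] by simp
  then have D': "(lambda_eig p has_derivative (\<lambda>E. sgn (d j) * (N' ** E ** N) $ j $ j)) (at A)"
    by (simp add: lambda_eig_similar[OF inv])
  have l: "lambda_eig p A = \<bar>d j\<bar>" using l0 lambda_eig_similar[OF inv, of p A] A' by simp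
  have "((\<lambda>A. ln (lambda_eig p A)) has_derivative (\<lambda>E. sgn (d j) * (N' ** E ** N) $ j $ j * (1 / lambda_eig p A))) (at A)"
    using has_derivative_ln[OF _ D'] l nz[of j] by (simp add: divide_inverse mult.commute)
  moreover have "sgn (d j) * x * (1 / lambda_eig p A) = x / d j" for x
    unfolding l using nz[of j] by (simp add: sgn_if)
  ultimately show ?thesis by simp
qed

type_synonym ('a, 'n) sqmat = "'a^'n^'n"

section \<open>Symmetric powers\<close>

definition mat2 :: "'a \<Rightarrow> 'a \<Rightarrow> 'a \<Rightarrow> 'a \<Rightarrow> 'a::zero^2^2" where
  "mat2 a b c d = vector [vector [a, b], vector [c, d]]"

lemma mat2_nth [simp]:
  "mat2 a b c d $ 1 $ 1 = a" "mat2 a b c d $ 1 $ 2 = b" "mat2 a b c d $ 2 $ 1 = c" "mat2 a b c d $ 2 $ 2 = d"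
  by (simp_all add: mat2_def)

lemma mat2_eta: "mat2 (g$1$1) (g$1$2) (g$2$1) (g$2$2) = g"
  by (simp add: vec_eq_iff forall_2)

lemma mat2_cases: obtains a b c d where "g = mat2 a b c d"
  using mat2_eta by metis

lemma mat2_eq_iff: "mat2 a b c d = mat2 a' b' c' d' \<longleftrightarrow> a = a' \<and> b = b' \<and> c = c' \<and> d = d'"
  by (metis mat2_nth)

lemma mat2_mult:
  "mat2 a b c d ** mat2 a' b' c' d' =
     mat2 (a * a' + b * c') (a * b' + b * d') (c * a' + d * c') (c * b' + d * (d' :: 'a::semiring_1))"
  by (simp add: vec_eq_iff forall_2 matrix_matrix_mult_def sum_2)

lemma mat2_one: "mat 1 = mat2 1 0 0 (1 :: 'a::semiring_1)"
  by (simp add: vec_eq_iff forall_2 mat_def)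

lemma pos_less_iff: "pos i < pos j \<longleftrightarrow> i < j" for i j :: "'n::{finite,linorder}"
proof -
  have *: "pos i < pos j" if "i < j" for i j :: 'n
    unfolding pos_def using that by (intro psubset_card_mono) (auto dest: leD)
  show ?thesis by (metis * linorder_neqE order_less_asym order_less_irrefl)
qed

lemma pos_eq_iff [simp]: "pos i = pos j \<longleftrightarrow> i = j" for i j :: "'n::{finite,linorder}"
  by (metis pos_less_iff linorder_neqE order_less_irrefl)

lemma pos_ge_1: "1 \<le> pos i" for i :: "'n::{finite,linorder}"
  by (simp add: pos_eq_card_less)

lemma pos_le_card:
  fixes i :: "'n::{finite,linorder}"
  shows "pos i \<le> CARD('n)"
  unfolding pos_def by (rule card_mono) auto

lemma bij_betw_pos: "bij_betw pos (UNIV :: 'n::{finite,linorder} set) {1..CARD('n)}"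
proof -
  let ?U = "UNIV :: 'n set"
  have inj: "inj_on pos ?U" by (rule injI) simp
  have "pos ` ?U = {1..CARD('n)}"
    by (rule card_subset_eq) (use pos_ge_1 pos_le_card in \<open>auto simp: card_image[OF inj]\<close>)
  with inj show ?thesis by (simp add: bij_betw_def)
qed

lemma pos_surj:
  assumes "1 \<le> m" "m \<le> CARD('n)"
  shows "\<exists>i :: 'n::{finite,linorder}. pos i = m"
  using assms bij_betw_imp_surj_on[OF bij_betw_pos[where ?'n = 'n]] by (metis atLeastAtMost_iff imageE)

lemma sum_pos_shift: "(\<Sum>i\<in>(UNIV :: 'n::{finite,linorder} set). f (pos i - 1)) = (\<Sum>l<CARD('n). f l)"
proof -
  have "(\<Sum>i\<in>(UNIV :: 'n set). f (pos i - 1)) = (\<Sum>l\<in>{1..CARD('n)}. f (l - 1))"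
    using sum.reindex_bij_betw[OF bij_betw_pos, of "\<lambda>l. f (l - 1)"] .
  also have "\<dots> = (\<Sum>l<CARD('n). f l)"
    by (rule sum.reindex_bij_witness[of _ Suc "\<lambda>l. l - 1"]) auto
  finally show ?thesis .
qed

text \<open>The same substitution as in \<^const>\<open>iota\<close>, over any field.\<close>

definition sympow :: "'a::field^2^2 \<Rightarrow> ('a, 'n::{finite,linorder}) sqmat" where
  "sympow g = (\<chi> i j. coeff ([:g$2$1, g$1$1:] ^ (pos j - 1) * [:g$2$2, g$1$2:] ^ (CARD('n) - pos j))
                          (pos i - 1))"

lemma iota_eq_sympow: "iota g = sympow g"
  by (simp add: iota_def sympow_def)

section \<open>Multiplicativity of the symmetric power\<close>

lemma poly_eq_cofinite:
  fixes p q :: "'a::field_char_0 poly"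
  assumes "finite S" "\<And>x. x \<notin> S \<Longrightarrow> poly p x = poly q x"
  shows "p = q"
proof (rule ccontr)
  assume "p \<noteq> q"
  then have "finite {x. poly (p - q) x = 0}" by (intro poly_roots_finite) simp
  moreover have "- S \<subseteq> {x. poly (p - q) x = 0}" using assms(2) by auto
  ultimately have "finite (- S)" by (rule rev_finite_subset)
  then show False using assms(1) infinite_UNIV_char_0 by (metis finite_Un Compl_partition)
qed

lemma degree_sympow_poly:
  "degree ([:c, a:] ^ (m - 1) * [:d, b:] ^ (n - m)) < n" if "1 \<le> m" "m \<le> n"
proof -
  have "degree ([:c, a:] ^ (m - 1) * [:d, b:] ^ (n - m)) \<le> (m - 1) + (n - m)"
    by (intro order_trans[OF degree_mult_le] add_mono order_trans[OF degree_power_le]) (auto simp: mult_le_cancel2)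
  then show ?thesis using that by linarith
qed

text \<open>Column \<open>j\<close> holds the coefficients of the j-th basis form after the
  substitution, so pairing it with the monomials evaluates that form. The homogeneous version is
  needed because \<open>sympow_mult\<close> evaluates at points whose second coordinate may
  vanish.\<close>

lemma sympow_eval:
  fixes g :: "'a::field_char_0^2^2" and j :: "'n::{finite,linorder}"
  shows "(\<Sum>i\<in>UNIV. x ^ (pos i - 1) * y ^ (CARD('n) - pos i) * sympow g $ i $ j) =
     (g$1$1 * x + g$2$1 * y) ^ (pos j - 1) * (g$1$2 * x + g$2$2 * y) ^ (CARD('n) - pos j)"
proof -
  let ?n = "CARD('n)"
  define P where "P = [:g$2$1, g$1$1:] ^ (pos j - 1) * [:g$2$2, g$1$2:] ^ (?n - pos j)"
  have deg: "degree P < ?n" unfolding P_def by (rule degree_sympow_poly[OF pos_ge_1 pos_le_card])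
  have sym: "sympow g $ i $ j = coeff P (pos i - 1)" for i by (simp add: sympow_def P_def)
  have nz: "(\<Sum>i\<in>UNIV. x ^ (pos i - 1) * y ^ (?n - pos i) * sympow g $ i $ j) =
     (g$1$1 * x + g$2$1 * y) ^ (pos j - 1) * (g$1$2 * x + g$2$2 * y) ^ (?n - pos j)" if "y \<noteq> 0" for y
  proof -
    have "(\<Sum>i\<in>(UNIV::'n set). x ^ (pos i - 1) * y ^ (?n - pos i) * sympow g $ i $ j)
        = (\<Sum>i\<in>(UNIV::'n set). y ^ (?n - 1) * (coeff P (pos i - 1) * (x / y) ^ (pos i - 1)))"
    proof (rule sum.cong[OF refl])
      fix i :: 'n
      have "?n - 1 = (?n - pos i) + (pos i - 1)" using pos_ge_1[of i] pos_le_card[of i] by linarith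
      then have "y ^ (?n - 1) = y ^ (?n - pos i) * y ^ (pos i - 1)" by (metis power_add)
      then show "x ^ (pos i - 1) * y ^ (?n - pos i) * sympow g $ i $ j = y ^ (?n - 1) * (coeff P (pos i - 1) * (x / y) ^ (pos i - 1))"
        using that by (simp add: sym power_divide)
    qed
    also have "\<dots> = y ^ (?n - 1) * (\<Sum>l<?n. coeff P l * (x / y) ^ l)"
      unfolding sum_distrib_left[symmetric] sum_pos_shift[where ?'n = 'n and f = "\<lambda>l. coeff P l * (x / y) ^ l"] ..
    also have "(\<Sum>l<?n. coeff P l * (x / y) ^ l) = poly P (x / y)"
      unfolding poly_altdef by (rule sum.mono_neutral_right) (use deg in \<open>auto simp: coeff_eq_0\<close>)
    also have "y ^ (?n - 1) * poly P (x / y) =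
        (y * (g$2$1 + x / y * g$1$1)) ^ (pos j - 1) * (y * (g$2$2 + x / y * g$1$2)) ^ (?n - pos j)"
    proof -
      have "?n - 1 = (pos j - 1) + (?n - pos j)" using pos_ge_1[of j] pos_le_card[of j] by linarith
      then have "y ^ (?n - 1) = y ^ (pos j - 1) * y ^ (?n - pos j)" by (metis power_add)
      then show ?thesis by (simp add: P_def poly_power power_mult_distrib)
    qed
    also have "\<dots> = (g$1$1 * x + g$2$1 * y) ^ (pos j - 1) * (g$1$2 * x + g$2$2 * y) ^ (?n - pos j)"
    proof -
      have "y * (g$2$1 + x / y * g$1$1) = g$1$1 * x + g$2$1 * y" "y * (g$2$2 + x / y * g$1$2) = g$1$2 * x + g$2$2 * y"
        using that by (simp_all add: field_simps)
      then show ?thesis by simp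
    qed
    finally show ?thesis .
  qed
  \<comment> \<open>The computation above divides by \<open>y\<close>. Both sides are polynomials in
    \<open>y\<close>, so agreement away from 0 extends to \<open>y = 0\<close>.\<close>
  define L where "L = (\<Sum>i\<in>(UNIV::'n set). monom (x ^ (pos i - 1) * sympow g $ i $ j) (?n - pos i))"
  define R where "R = [:g$1$1 * x, g$2$1:] ^ (pos j - 1) * [:g$1$2 * x, g$2$2:] ^ (?n - pos j)"
  have Lp: "poly L y = (\<Sum>i\<in>UNIV. x ^ (pos i - 1) * y ^ (?n - pos i) * sympow g $ i $ j)" for y
    by (simp add: L_def poly_sum poly_monom mult_ac)
  have Rp: "poly R y = (g$1$1 * x + g$2$1 * y) ^ (pos j - 1) * (g$1$2 * x + g$2$2 * y) ^ (?n - pos j)" for y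
    by (simp add: R_def poly_power mult.commute)
  have "L = R" by (rule poly_eq_cofinite[of "{0}"]) (use nz Lp Rp in auto)
  then show ?thesis using Lp[of y] Rp[of y] by simp
qed

lemma matrix_eqI_power_sums:
  fixes A B :: "('a::field_char_0, 'n::{finite,linorder}) sqmat"
  assumes "\<And>x j. (\<Sum>i\<in>UNIV. x ^ (pos i - 1) * A $ i $ j) = (\<Sum>i\<in>UNIV. x ^ (pos i - 1) * B $ i $ j)"
  shows "A = B"
proof -
  have "A $ i $ j = B $ i $ j" for i j
  proof -
    define P where "P C = (\<Sum>i\<in>(UNIV::'n set). monom (C $ i $ j) (pos i - 1))" for C :: "('a, 'n) sqmat"
    have "P A = P B"
      by (rule poly_eq_cofinite[of "{}"]) (use assms in \<open>simp_all add: P_def poly_sum poly_monom mult.commute\<close>)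
    moreover have "coeff (P C) (pos i - 1) = C $ i $ j" for C
    proof -
      have "pos l - 1 = pos i - 1 \<longleftrightarrow> l = i" for l :: 'n
        using pos_ge_1[of l] pos_ge_1[of i] pos_eq_iff[of l i] by (metis le_add_diff_inverse2)
      then show ?thesis by (simp add: P_def coeff_sum)
    qed
    ultimately show ?thesis by metis
  qed
  then show ?thesis by (simp add: vec_eq_iff)
qed

text \<open>Pairing the product with the monomials at (x, 1) first moves this point to the row (x,
  1) g and then evaluates the substitution by \<open>h\<close> there. Knowing this for all x
  determines the matrix.\<close>

lemma sympow_mult: "sympow (g ** h) = sympow g ** (sympow h :: ('a::field_char_0, 'n::{finite,linorder}) sqmat)"
proof (rule matrix_eqI_power_sums)
  fix x and j :: 'n
  let ?X = "g$1$1 * x + g$2$1" and ?Y = "g$1$2 * x + g$2$2"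
  have "(\<Sum>i\<in>UNIV. x ^ (pos i - 1) * (sympow g ** (sympow h :: ('a, 'n) sqmat)) $ i $ j)
      = (\<Sum>k\<in>UNIV. (\<Sum>i\<in>UNIV. x ^ (pos i - 1) * sympow g $ i $ k) * (sympow h :: ('a, 'n) sqmat) $ k $ j)"
    unfolding matrix_matrix_mult_def by (simp add: sum_distrib_left sum_distrib_right mult.assoc) (rule sum.swap)
  also have "\<dots> = (\<Sum>k\<in>UNIV. ?X ^ (pos k - 1) * ?Y ^ (CARD('n) - pos k) * (sympow h :: ('a, 'n) sqmat) $ k $ j)"
    using sympow_eval[where ?'n = 'n, of x 1 g] by simp
  also have "\<dots> = (h$1$1 * ?X + h$2$1 * ?Y) ^ (pos j - 1) * (h$1$2 * ?X + h$2$2 * ?Y) ^ (CARD('n) - pos j)"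
    by (rule sympow_eval)
  also have "\<dots> = (\<Sum>i\<in>UNIV. x ^ (pos i - 1) * (sympow (g ** h) :: ('a, 'n) sqmat) $ i $ j)"
    using sympow_eval[of x 1 "g ** h" j] by (simp add: matrix_matrix_mult_def sum_2 algebra_simps)
  finally show "(\<Sum>i\<in>UNIV. x ^ (pos i - 1) * (sympow (g ** h) :: ('a, 'n) sqmat) $ i $ j) =
      (\<Sum>i\<in>UNIV. x ^ (pos i - 1) * (sympow g ** (sympow h :: ('a, 'n) sqmat)) $ i $ j)" ..
qed

lemma pos_pred_eq_iff: "pos i - Suc 0 = pos j - Suc 0 \<longleftrightarrow> i = j" for i j :: "'n::{finite,linorder}"
  using pos_ge_1[of j] pos_ge_1[of i] pos_eq_iff[of i j] by (metis One_nat_def le_add_diff_inverse2)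

lemma sympow_diag:
  "(sympow (mat2 s 0 0 t) :: ('a::field, 'n::{finite,linorder}) sqmat) =
     diagm (\<lambda>i. s ^ (pos i - 1) * t ^ (CARD('n) - pos i))"
proof -
  have e: "[:0, s:] = monom s 1" "[:t:] = monom t 0" by (simp_all add: monom_altdef)
  show ?thesis
    by (simp add: sympow_def diagm_def vec_eq_iff e monom_power mult_monom pos_pred_eq_iff)
qed

lemma sympow_one: "sympow (mat 1) = mat 1"
  unfolding mat2_one[where ?'a = "'a::field"] sympow_diag by (simp add: diagm_def mat_def vec_eq_iff)

lemma sympow_antidiag:
  "(sympow (mat2 0 b c 0) :: ('a::field, 'n::{finite,linorder}) sqmat) $ i $ j =
     (if pos i + pos j = CARD('n) + 1 then c ^ (pos j - 1) * b ^ (CARD('n) - pos j) else 0)"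
proof -
  have e: "[:0, b:] = monom b 1" "[:c:] = monom c 0" by (simp_all add: monom_altdef)
  have "CARD('n) - pos j = pos i - 1 \<longleftrightarrow> pos i + pos j = CARD('n) + 1"
    using pos_ge_1[of i] pos_le_card[of i] pos_ge_1[of j] pos_le_card[of j] by linarith
  then show ?thesis by (simp add: sympow_def e monom_power mult_monom)
qed

text \<open>The entries are built from those of \<open>g\<close> by sums and products alone, so a
  homomorphism passes through. It is applied to \<open>of_real\<close> and to complex
  conjugation.\<close>

lemma sympow_hom:
  fixes h :: "'a::field \<Rightarrow> 'b::field"
  assumes add: "\<And>x y. h (x + y) = h x + h y" and mult: "\<And>x y. h (x * y) = h x * h y"
    and h: "h 0 = 0" "h 1 = 1"
  shows "map_matrix h (sympow g) = sympow (map_matrix h g)"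
proof -
  define R where "R p q \<longleftrightarrow> (\<forall>l. coeff q l = h (coeff p l))" for p q
  have sum: "h (sum f A) = (\<Sum>x\<in>A. h (f x))" for f and A :: "nat set"
    by (induction A rule: infinite_finite_induct) (simp_all add: add h)
  have Rm: "R (p * p') (q * q')" if "R p q" "R p' q'" for p p' q q'
    using that by (simp add: R_def coeff_mult sum mult)
  have R1: "R 1 1" by (auto simp: R_def h one_pCons coeff_pCons split: nat.split)
  have Rp: "R (p ^ m) (q ^ m)" if "R p q" for p q m
    by (induction m) (simp_all add: R1 Rm that)
  have Rc: "R [:c, a:] [:h c, h a:]" for a c by (auto simp: R_def coeff_pCons h split: nat.split)
  show ?thesis
    using Rm[OF Rp[OF Rc] Rp[OF Rc]] by (simp add: sympow_def vec_eq_iff map_matrix_def R_def)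
qed

lemma map_matrix_mult_hom:
  fixes h :: "'a::semiring_1 \<Rightarrow> 'b::semiring_1"
  assumes add: "\<And>x y. h (x + y) = h x + h y" and mult: "\<And>x y. h (x * y) = h x * h y" and "h 0 = 0"
  shows "map_matrix h (A ** B) = map_matrix h A ** map_matrix h (B :: 'a^'l^'m::finite)"
proof -
  have sum: "h (sum f A) = (\<Sum>x\<in>A. h (f x))" for f and A :: "'m set"
    by (induction A rule: infinite_finite_induct) (simp_all add: add assms)
  show ?thesis by (simp add: matrix_matrix_mult_def vec_eq_iff map_matrix_def sum mult)
qed

section \<open>Differentiation of matrix-valued functions\<close>

lemma has_derivative_vecI:
  fixes f :: "'a::real_normed_vector \<Rightarrow> ('b::real_normed_vector, 'n::finite) vec"
  assumes "\<And>i. ((\<lambda>z. f z $ i) has_derivative (\<lambda>v. f' v $ i)) F"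
  shows "(f has_derivative f') F"
  unfolding has_derivative_def
proof
  have bl: "bounded_linear (\<lambda>v. f' v $ i)" for i using assms by (rule has_derivative_bounded_linear)
  then have lin: "linear (\<lambda>v. f' v $ i)" for i by (simp add: bounded_linear.linear)
  have "\<forall>i. \<exists>K. \<forall>v. norm (f' v $ i) \<le> norm v * K" using bl bounded_linear.bounded by blast
  from choice[OF this] obtain K where K: "\<And>i v. norm (f' v $ i) \<le> norm v * K i" by blast
  show "bounded_linear f'"
  proof (rule bounded_linear_intro[where K = "\<Sum>i\<in>UNIV. K i"])
    show "f' (x + y) = f' x + f' y" for x y by (simp add: vec_eq_iff linear_add[OF lin])
    show "f' (r *\<^sub>R x) = r *\<^sub>R f' x" for r x by (simp add: vec_eq_iff linear_scale[OF lin])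
    show "norm (f' x) \<le> norm x * (\<Sum>i\<in>UNIV. K i)" for x
    proof -
      have "norm (f' x) \<le> (\<Sum>i\<in>UNIV. norm (f' x $ i))" unfolding norm_vec_def by (rule L2_set_le_sum) simp
      also have "\<dots> \<le> (\<Sum>i\<in>UNIV. norm x * K i)" by (intro sum_mono K)
      finally show ?thesis by (simp add: sum_distrib_left)
    qed
  qed
  show "((\<lambda>y. (f y - f (Lim F (\<lambda>x. x)) - f' (y - Lim F (\<lambda>x. x))) /\<^sub>R norm (y - Lim F (\<lambda>x. x))) \<longlongrightarrow> 0) F"
    by (rule vec_tendstoI) (use assms in \<open>simp add: has_derivative_def\<close>)
qed

lemma has_derivative_matrixI:
  fixes f :: "'a::real_normed_vector \<Rightarrow> 'b::real_normed_vector^'m::finite^'n::finite"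
  assumes "\<And>i j. ((\<lambda>z. f z $ i $ j) has_derivative (\<lambda>v. f' v $ i $ j)) F"
  shows "(f has_derivative f') F"
  by (intro has_derivative_vecI assms)

lemma has_derivative_matrix_nth:
  assumes "(f has_derivative f') F"
  shows "((\<lambda>z. f z $ i $ j) has_derivative (\<lambda>v. f' v $ i $ j)) F"
  by (intro bounded_linear.has_derivative[OF bounded_linear_vec_nth] assms)

lemma has_derivative_matrix_mult:
  fixes f :: "'a::real_normed_vector \<Rightarrow> 'b::real_normed_field^'m::finite^'n::finite" and g :: "'a \<Rightarrow> 'b^'l::finite^'m"
  assumes f: "(f has_derivative f') (at x within s)" and g: "(g has_derivative g') (at x within s)"
  shows "((\<lambda>z. f z ** g z) has_derivative (\<lambda>v. f x ** g' v + f' v ** g x)) (at x within s)"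
proof (rule has_derivative_matrixI)
  fix i j
  have "((\<lambda>z. \<Sum>k\<in>UNIV. f z $ i $ k * g z $ k $ j) has_derivative
      (\<lambda>v. \<Sum>k\<in>UNIV. f x $ i $ k * g' v $ k $ j + f' v $ i $ k * g x $ k $ j)) (at x within s)"
    by (intro has_derivative_sum has_derivative_mult has_derivative_matrix_nth f g)
  then show "((\<lambda>z. (f z ** g z) $ i $ j) has_derivative (\<lambda>v. (f x ** g' v + f' v ** g x) $ i $ j)) (at x within s)"
    by (simp add: matrix_matrix_mult_def sum.distrib)
qed

lemma has_derivative_matrix_mult_left:
  fixes A :: "'b::real_normed_field^'m::finite^'n::finite" and g :: "'a::real_normed_vector \<Rightarrow> 'b^'l::finite^'m"
  assumes "(g has_derivative g') (at x within s)"
  shows "((\<lambda>z. A ** g z) has_derivative (\<lambda>v. A ** g' v)) (at x within s)"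
  using has_derivative_matrix_mult[OF has_derivative_const assms, of A] by simp

lemma has_derivative_matrix_mult_right:
  fixes A :: "'b::real_normed_field^'l::finite^'m::finite" and g :: "'a::real_normed_vector \<Rightarrow> 'b^'m^'n::finite"
  assumes "(g has_derivative g') (at x within s)"
  shows "((\<lambda>z. g z ** A) has_derivative (\<lambda>v. g' v ** A)) (at x within s)"
  using has_derivative_matrix_mult[OF assms has_derivative_const, of A] by simp

text \<open>The representation of the Lie algebra gl(2) on binary forms, in the monomial
  basis.\<close>

definition dsympow :: "complex^2^2 \<Rightarrow> 'n::{finite,linorder} cmatrix" where
  "dsympow m = (\<chi> i j.
     if i = j then m$1$1 * of_nat (pos i - 1) + m$2$2 * of_nat (CARD('n) - pos i)
     else if pos j = pos i + 1 then m$2$1 * of_nat (pos i)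
     else if pos i = pos j + 1 then m$1$2 * of_nat (CARD('n) - pos j) else 0)"

context
  fixes z0 :: "'a::real_normed_vector"
begin

text \<open>Differentiation of a family of polynomials with respect to a parameter, one coefficient
  at a time: the entries of \<open>sympow\<close> are such coefficients.\<close>

definition poly_deriv :: "('a \<Rightarrow> complex poly) \<Rightarrow> ('a \<Rightarrow> complex poly) \<Rightarrow> bool" where
  "poly_deriv P P' \<longleftrightarrow> (\<forall>l. ((\<lambda>z. coeff (P z) l) has_derivative (\<lambda>v. coeff (P' v) l)) (at z0))"

lemma poly_deriv_mult:
  assumes "poly_deriv P P'" "poly_deriv Q Q'"
  shows "poly_deriv (\<lambda>z. P z * Q z) (\<lambda>v. P z0 * Q' v + P' v * Q z0)"
  unfolding poly_deriv_def
proof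
  fix l
  have "((\<lambda>z. \<Sum>i\<le>l. coeff (P z) i * coeff (Q z) (l - i)) has_derivative
      (\<lambda>v. \<Sum>i\<le>l. coeff (P z0) i * coeff (Q' v) (l - i) + coeff (P' v) i * coeff (Q z0) (l - i))) (at z0)"
    using assms unfolding poly_deriv_def by (intro has_derivative_sum has_derivative_mult) auto
  then show "((\<lambda>z. coeff (P z * Q z) l) has_derivative (\<lambda>v. coeff (P z0 * Q' v + P' v * Q z0) l)) (at z0)"
    by (simp add: coeff_mult sum.distrib)
qed

lemma poly_deriv_power:
  assumes "poly_deriv P P'"
  shows "poly_deriv (\<lambda>z. P z ^ m) (\<lambda>v. of_nat m * P z0 ^ (m - 1) * P' v)"
proof (induction m)
  case 0
  then show ?case by (simp add: poly_deriv_def)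
next
  case (Suc m)
  have "P z0 * (of_nat m * P z0 ^ (m - 1) * P' v) + P' v * P z0 ^ m = of_nat (Suc m) * P z0 ^ (Suc m - 1) * P' v" for v
    by (cases m) (simp_all add: algebra_simps)
  with poly_deriv_mult[OF assms Suc] show ?case by simp
qed

end

lemma sympow_has_derivative:
  "((sympow :: complex^2^2 \<Rightarrow> 'n::{finite,linorder} cmatrix) has_derivative dsympow) (at (mat 1))"
proof (rule has_derivative_matrixI)
  fix i j :: 'n
  let ?n = "CARD('n)"
  let ?I = "mat 1 :: complex^2^2"
  have nth: "((\<lambda>g. g $ a $ b) has_derivative (\<lambda>m. m $ a $ b)) (at ?I)" for a b
    by (rule has_derivative_matrix_nth) (rule has_derivative_ident)
  have lin: "poly_deriv ?I (\<lambda>g. [:g$2$b, g$1$b:]) (\<lambda>m. [:m$2$b, m$1$b:])" for b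
    unfolding poly_deriv_def
  proof
    fix l
    show "((\<lambda>g. coeff [:g$2$b, g$1$b:] l) has_derivative (\<lambda>m. coeff [:m$2$b, m$1$b:] l)) (at ?I)"
    proof (cases l)
      case (Suc l')
      then show ?thesis using nth[of 1 b] by (cases l') simp_all
    qed (use nth[of 2 b] in simp)
  qed
  have I: "[:?I$2$1, ?I$1$1:] = monom 1 1" "[:?I$2$2, ?I$1$2:] = monom 1 0"
    by (simp_all add: mat_def monom_altdef)
  \<comment> \<open>At the identity the two linear forms are the monomials x and 1, so the product
    rule only produces shifts. Where an exponent such as \<open>pos j - 1 - 1\<close> is truncated,
    the integer factor in front vanishes.\<close>
  define D where "D m = monom 1 1 ^ (pos j - 1) * (of_nat (?n - pos j) * monom 1 0 ^ (?n - pos j - 1) * [:m$2$2, m$1$2:])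
      + of_nat (pos j - 1) * monom 1 1 ^ (pos j - 1 - 1) * [:m$2$1, m$1$1:] * monom 1 0 ^ (?n - pos j)" for m :: "complex^2^2"
  have der: "((\<lambda>g. (sympow g :: 'n cmatrix) $ i $ j) has_derivative (\<lambda>m. coeff (D m) (pos i - 1))) (at ?I)"
    using poly_deriv_mult[OF poly_deriv_power[OF lin[of 1], of "pos j - 1"] poly_deriv_power[OF lin[of 2], of "?n - pos j"]]
    unfolding I by (simp add: poly_deriv_def sympow_def D_def)
  have "coeff (D m) (pos i - 1) = (dsympow m :: 'n cmatrix) $ i $ j" for m
  proof -
    have D: "D m = smult (of_nat (?n - pos j)) (monom 1 (pos j - 1) * [:m$2$2, m$1$2:])
        + smult (of_nat (pos j - 1)) (monom 1 (pos j - 2) * [:m$2$1, m$1$1:])"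
      unfolding D_def by (simp add: monom_power of_nat_poly numeral_2_eq_2 mult_ac smult_add_right)
    define P Q where "P = pos i" and "Q = pos j"
    have PQ: "1 \<le> P" "1 \<le> Q" "P \<le> ?n" "Q \<le> ?n" unfolding P_def Q_def by (rule pos_ge_1 pos_le_card)+
    consider "P = Q" | "Q = P + 1" | "P = Q + 1" | "Q \<ge> P + 2" | "P \<ge> Q + 2" by linarith
    then show ?thesis
    proof cases
      case 1
      then have "i = j" by (simp add: P_def Q_def)
      then show ?thesis using PQ
        unfolding D dsympow_def coeff_add coeff_smult coeff_monom_mult P_def[symmetric] Q_def[symmetric]
        by (cases "Q = 1") (auto simp: coeff_pCons P_def Q_def split: nat.splits)
    qed (use PQ in \<open>auto simp: D dsympow_def coeff_monom_mult coeff_pCons P_def[symmetric] Q_def[symmetric] pos_eq_iff[symmetric] simp del: pos_eq_iff split: nat.splits\<close>)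
  qed
  with der show "((\<lambda>g. (sympow g :: 'n cmatrix) $ i $ j) has_derivative (\<lambda>m. (dsympow m :: 'n cmatrix) $ i $ j)) (at ?I)"
    by simp
qed

text \<open>The derivative at the identity suffices: \<open>G w ** H\<close> passes through
  \<open>mat 1\<close> at \<open>w = z\<close>, and \<open>sympow_mult\<close> splits off the
  constant factor.\<close>

lemma sympow_has_derivative_left:
  fixes G :: "complex \<Rightarrow> complex^2^2" and m :: "complex \<Rightarrow> complex^2^2"
  assumes "(G has_derivative (\<lambda>v. m v ** G z)) (at z)" and inv: "G z ** H = mat 1" "H ** G z = mat 1"
  shows "((\<lambda>z. sympow (G z) :: 'n::{finite,linorder} cmatrix) has_derivative (\<lambda>v. dsympow (m v) ** sympow (G z))) (at z)"
proof -
  have "((\<lambda>w. G w ** H) has_derivative (\<lambda>v. m v ** G z ** H)) (at z)"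
    by (rule has_derivative_matrix_mult_right[OF assms(1)])
  then have K: "((\<lambda>w. G w ** H) has_derivative m) (at z)" by (simp add: inv flip: matrix_mul_assoc)
  have "((\<lambda>w. sympow (G w ** H) :: 'n cmatrix) has_derivative (\<lambda>v. dsympow (m v))) (at z)"
    by (rule has_derivative_compose[OF K]) (simp add: inv sympow_has_derivative)
  from has_derivative_matrix_mult_right[OF this, of "sympow (G z)"]
  show ?thesis by (simp add: sympow_mult[symmetric] inv flip: matrix_mul_assoc)
qed

lemma sympow_has_derivative_right:
  fixes G :: "complex \<Rightarrow> complex^2^2" and m :: "complex \<Rightarrow> complex^2^2"
  assumes "(G has_derivative (\<lambda>v. G z ** m v)) (at z)" and inv: "G z ** H = mat 1" "H ** G z = mat 1"
  shows "((\<lambda>z. sympow (G z) :: 'n::{finite,linorder} cmatrix) has_derivative (\<lambda>v. sympow (G z) ** dsympow (m v))) (at z)"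
proof -
  have "((\<lambda>w. H ** G w) has_derivative (\<lambda>v. H ** (G z ** m v))) (at z)"
    by (rule has_derivative_matrix_mult_left[OF assms(1)])
  then have K: "((\<lambda>w. H ** G w) has_derivative m) (at z)" by (simp add: inv matrix_mul_assoc)
  have "((\<lambda>w. sympow (H ** G w) :: 'n cmatrix) has_derivative (\<lambda>v. dsympow (m v))) (at z)"
    by (rule has_derivative_compose[OF K]) (simp add: inv sympow_has_derivative)
  from has_derivative_matrix_mult_left[OF this, of "sympow (G z)"]
  show ?thesis by (simp add: sympow_mult[symmetric] inv matrix_mul_assoc)
qed

section \<open>The weights of the standard basis and the flat frame in rank two\<close>

lemma matrix_inv_eqI:
  assumes "A ** B = mat 1" "B ** A = mat 1"
  shows "matrix_inv A = B"
proof -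
  have "A ** matrix_inv A = mat 1 \<and> matrix_inv A ** A = mat 1"
    unfolding matrix_inv_def by (rule someI[of _ B]) (use assms in simp)
  then show ?thesis using assms by (metis matrix_mul_assoc matrix_mul_lid matrix_mul_rid)
qed

lemma matrix_mult_nth: "(A ** B) $ i $ j = (\<Sum>k\<in>UNIV. A $ i $ k * B $ k $ j)"
  by (simp add: matrix_matrix_mult_def)

lemma diagm_diagm: "diagm a ** diagm b = diagm (\<lambda>i. a i * b i)"
  for a b :: "'n::finite \<Rightarrow> 'a::semiring_1"
  by (simp add: vec_eq_iff diagm_mult) (simp add: diagm_def)

lemma diagm_const_1: "diagm (\<lambda>_. 1) = mat 1"
  by (simp add: diagm_def mat_def)

lemma sum_pos_delta:
  "(\<Sum>k\<in>(UNIV :: 'n::{finite,linorder} set). if pos k = m then c else 0) =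
     (if 1 \<le> m \<and> m \<le> CARD('n) then c else (0::'a::semiring_1))"
proof -
  have "(\<Sum>k\<in>(UNIV :: 'n set). if pos k = m then c else 0) = (\<Sum>l\<in>{1..CARD('n)}. if l = m then c else 0)"
    using sum.reindex_bij_betw[OF bij_betw_pos, of "\<lambda>l. if l = m then c else 0"] .
  then show ?thesis by simp
qed

lemma An_nth:
  "(An :: 'n::{finite,linorder} cmatrix) $ i $ j =
     (if i = j then of_real (real (pos i) - (real CARD('n) + 1) / 2) else 0)"
proof -
  let ?n = "CARD('n)" and ?c = "\<lambda>p. complex_of_real (ccoef TYPE('n) p)"
  have c2: "?c p * ?c p = of_real (real p * (real ?n - real p) / 2)" if "p \<le> ?n" for p
    using that unfolding ccoef_def of_real_mult[symmetric] by (simp add: real_sqrt_mult_self)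
  have YX: "(Yn ** Xn :: 'n cmatrix) $ i $ j = (if i = j then - (?c (pos i) * ?c (pos i)) else 0)"
  proof -
    have "(Yn ** Xn :: 'n cmatrix) $ i $ j =
        (\<Sum>k\<in>(UNIV::'n set). if pos k = pos i + 1 then (if i = j then - (?c (pos i) * ?c (pos i)) else 0) else 0)"
      unfolding matrix_mult_nth by (rule sum.cong[OF refl]) (auto simp: Xn_def Yn_def)
    \<comment> \<open>For the last index the sum over \<open>k\<close> is empty. The formula
      persists because c_n = 0, and c_0 = 0 plays the same part for the first index below.\<close>
    moreover have "?c ?n = 0" by (simp add: ccoef_def)
    moreover have "pos i = ?n \<or> pos i + 1 \<le> ?n" using pos_le_card[of i] by linarith
    ultimately show ?thesis unfolding sum_pos_delta by (cases "i = j"; elim disjE; simp)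
  qed
  have XY: "(Xn ** Yn :: 'n cmatrix) $ i $ j = (if i = j then - (?c (pos i - 1) * ?c (pos i - 1)) else 0)"
  proof -
    have "(Xn ** Yn :: 'n cmatrix) $ i $ j =
        (\<Sum>k\<in>(UNIV::'n set). if pos k = pos i - 1 then (if i = j then - (?c (pos i - 1) * ?c (pos i - 1)) else 0) else 0)"
      unfolding matrix_mult_nth
    proof (rule sum.cong[OF refl])
      fix k :: 'n
      have 1: "pos i = pos k + 1 \<longleftrightarrow> pos k = pos i - 1" using pos_ge_1[of k] pos_ge_1[of i] by linarith
      show "Xn $ i $ k * Yn $ k $ j = (if pos k = pos i - 1 then if i = j then - (?c (pos i - 1) * ?c (pos i - 1)) else 0 else 0)"
      proof (cases "pos k = pos i - 1")
        case True
        then have k: "pos i = pos k + 1" using 1 by blast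
        have "pos j = pos k + 1 \<longleftrightarrow> i = j" using k by (metis pos_eq_iff)
        then show ?thesis using k by (cases "i = j") (simp_all add: Xn_def Yn_def)
      next
        case False
        then have "pos i \<noteq> pos k + 1" using 1 by blast
          then show ?thesis using False by (simp add: Xn_def)
      qed
    qed
    moreover have "?c 0 = 0" by (simp add: ccoef_def)
    moreover have "pos i = 1 \<or> 1 \<le> pos i - 1 \<and> pos i - 1 \<le> ?n" using pos_le_card[of i] pos_ge_1[of i] by linarith
    ultimately show ?thesis unfolding sum_pos_delta by (cases "i = j"; elim disjE; simp)
  qed
  have A: "(An :: 'n cmatrix) $ i $ j = (Yn ** Xn) $ i $ j - (Xn ** Yn) $ i $ j" by (simp add: An_def)
  show ?thesis
  proof (cases "i = j")
    case True
    have "(An :: 'n cmatrix) $ i $ j = ?c (pos i - 1) * ?c (pos i - 1) - ?c (pos i) * ?c (pos i)"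
      unfolding A YX XY using True by simp
    also have "\<dots> = of_real (real (pos i) - (real ?n + 1) / 2)"
      using pos_le_card[of i] pos_ge_1[of i] by (simp add: c2 of_nat_diff field_simps flip: of_real_diff)
    finally show ?thesis using True by simp
  qed (simp add: A YX XY)
qed

lemma Im_eq_cnj: "complex_of_real (Im v) = (v - cnj v) / (2 * \<i>)"
  by (simp add: complex_eq_iff)

text \<open>A flat frame in the case \<open>n = 2\<close>, in the ordering of \<open>SL(2)\<close>, that is with the second basis vector
  of \<^const>\<open>iota\<close> first.\<close>

definition frame2 :: "complex \<Rightarrow> complex^2^2" where
  "frame2 z = mat2 (- \<i> / (of_real (sqrt 2) * of_real (Im z))) (\<i> * cnj z / (of_real (sqrt 2) * of_real (Im z))) 1 (- z)"

definition frame2_inv :: "complex \<Rightarrow> complex^2^2" where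
  "frame2_inv z = mat2 (z / of_real (sqrt 2)) (\<i> * cnj z / (2 * of_real (Im z))) (1 / of_real (sqrt 2)) (\<i> / (2 * of_real (Im z)))"

text \<open>The traceless 2 x 2 matrix obtained from \<open>connD\<close> by undoing the scaling
  \<open>scl\<close> and inverting the representation; \<open>scaled_conn2\<close> is the
  check.\<close>

definition conn2 :: "complex \<Rightarrow> complex \<Rightarrow> complex^2^2" where
  "conn2 z v = mat2 (- \<i> * v / (2 * of_real (Im z))) (cnj v / (2 * of_real (sqrt 2) * (of_real (Im z))\<^sup>2))
      (v / of_real (sqrt 2)) (\<i> * v / (2 * of_real (Im z)))"

lemma sqrt2_complex: "complex_of_real (sqrt 2) * of_real (sqrt 2) = 2" "complex_of_real (sqrt 2) \<noteq> 0"
  by (simp_all flip: of_real_mult)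

lemma frame2_inverse:
  assumes "Im z > 0"
  shows "frame2 z ** frame2_inv z = mat 1" "frame2_inv z ** frame2 z = mat 1"
proof -
  define r where "r = complex_of_real (sqrt 2)"
  define y where "y = complex_of_real (Im z)"
  have r: "r * r = 2" "r \<noteq> 0" using sqrt2_complex by (simp_all add: r_def)
  have rr: "r * (r * x) = 2 * x" for x by (simp add: r flip: mult.assoc)
  have y: "y \<noteq> 0" using assms by (simp add: y_def)
  \<comment> \<open>Eliminating the conjugate leaves rational identities in the two unknowns
    \<open>z\<close> and \<open>y\<close>.\<close>
  have z: "cnj z = z - 2 * \<i> * y" by (simp add: y_def complex_eq_iff)
  show "frame2 z ** frame2_inv z = mat 1" "frame2_inv z ** frame2 z = mat 1"
    unfolding frame2_def frame2_inv_def r_def[symmetric] y_def[symmetric] z mat2_mult mat2_one mat2_eq_iff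
    using r y by (auto simp: field_simps rr)
qed

lemma has_derivative_mat2:
  fixes a b c d :: "'a::real_normed_vector \<Rightarrow> 'b::{real_normed_vector}"
  assumes "(a has_derivative a') F" "(b has_derivative b') F" "(c has_derivative c') F" "(d has_derivative d') F"
  shows "((\<lambda>z. mat2 (a z) (b z) (c z) (d z)) has_derivative (\<lambda>v. mat2 (a' v) (b' v) (c' v) (d' v))) F"
proof (rule has_derivative_matrixI)
  fix i j :: 2
  show "((\<lambda>z. mat2 (a z) (b z) (c z) (d z) $ i $ j) has_derivative (\<lambda>v. mat2 (a' v) (b' v) (c' v) (d' v) $ i $ j)) F"
    using exhaust_2[of i] exhaust_2[of j] assms by (elim disjE) simp_all
qed

lemma frame2_has_derivative:
  assumes "Im z > 0"
  shows "(frame2 has_derivative (\<lambda>v. - conn2 z v ** frame2 z)) (at z)"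
    "(frame2_inv has_derivative (\<lambda>v. frame2_inv z ** conn2 z v)) (at z)"
proof -
  define r where "r = complex_of_real (sqrt 2)"
  define y where "y = complex_of_real (Im z)"
  have r: "r * r = 2" "r \<noteq> 0" using sqrt2_complex by (simp_all add: r_def)
  have rr: "r * (r * x) = 2 * x" for x by (simp add: r flip: mult.assoc)
  have y: "y \<noteq> 0" using assms by (simp add: y_def)
  have z: "cnj z = z - 2 * \<i> * y" by (simp add: y_def complex_eq_iff)
  define iy where "iy w = inverse (complex_of_real (Im w))" for w
  have "((\<lambda>w. complex_of_real (Im w)) has_derivative (\<lambda>v. of_real (Im v))) (at z)"
    by (auto intro!: derivative_eq_intros)
  from Deriv.has_derivative_inverse[OF _ this] y
  have "(iy has_derivative (\<lambda>v. - (inverse y * of_real (Im v) * inverse y))) (at z)"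
    unfolding iy_def y_def by simp
  moreover have "- (inverse y * x * inverse y) = - x / y\<^sup>2" for x
    by (simp add: power2_eq_square divide_inverse)
  ultimately have iy: "(iy has_derivative (\<lambda>v. - ((v - cnj v) / (2 * \<i>)) / y\<^sup>2)) (at z)"
    by (simp only: Im_eq_cnj)
  have iyz: "iy z = 1 / y" by (simp add: iy_def y_def inverse_eq_divide)
  have cn: "(cnj has_derivative cnj) (at z)" by (rule bounded_linear_imp_has_derivative[OF bounded_linear_cnj])
  have c: "((\<lambda>w. c * iy w) has_derivative (\<lambda>v. c * (- ((v - cnj v) / (2 * \<i>)) / y\<^sup>2))) (at z)" for c
    by (rule has_derivative_mult_right[OF iy])
  have cz: "((\<lambda>w. c * (cnj w * iy w)) has_derivative (\<lambda>v. c * (cnj z * (- ((v - cnj v) / (2 * \<i>)) / y\<^sup>2) + cnj v * iy z))) (at z)" for c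
    by (rule has_derivative_mult_right[OF has_derivative_mult[OF cn iy]])
  have F: "frame2 = (\<lambda>w. mat2 ((- \<i> / r) * iy w) ((\<i> / r) * (cnj w * iy w)) 1 (- w))"
    by (rule ext) (simp add: frame2_def r_def iy_def inverse_eq_divide)
  have G: "frame2_inv = (\<lambda>w. mat2 (w / r) ((\<i> / 2) * (cnj w * iy w)) (1 / r) ((\<i> / 2) * iy w))"
    by (rule ext) (simp add: frame2_inv_def r_def iy_def inverse_eq_divide)
  have conn: "conn2 z v = mat2 (- \<i> * v / (2 * y)) (cnj v / (2 * r * y\<^sup>2)) (v / r) (\<i> * v / (2 * y))" for v
    by (simp add: conn2_def r_def y_def)
  have mneg: "- mat2 a b c d = mat2 (-a) (-b) (-c) (-d)" for a b c d :: complex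
    by (simp add: vec_eq_iff forall_2)
  have F': "- conn2 z v ** frame2 z = mat2 ((- \<i> / r) * (- ((v - cnj v) / (2 * \<i>)) / y\<^sup>2))
      ((\<i> / r) * (cnj z * (- ((v - cnj v) / (2 * \<i>)) / y\<^sup>2) + cnj v * iy z)) 0 (- v)" for v
    unfolding conn F mneg mat2_mult mat2_eq_iff iyz z using r y
    by (auto simp: field_simps power2_eq_square rr)
  have G': "frame2_inv z ** conn2 z v = mat2 (v / r) ((\<i> / 2) * (cnj z * (- ((v - cnj v) / (2 * \<i>)) / y\<^sup>2) + cnj v * iy z))
      0 ((\<i> / 2) * (- ((v - cnj v) / (2 * \<i>)) / y\<^sup>2))" for v
    unfolding conn G mat2_mult mat2_eq_iff iyz z using r y
    by (auto simp: field_simps power2_eq_square rr)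
  show "(frame2 has_derivative (\<lambda>v. - conn2 z v ** frame2 z)) (at z)"
    unfolding F' unfolding F
    by (intro has_derivative_mat2 c cz has_derivative_const has_derivative_minus has_derivative_ident)
  show "(frame2_inv has_derivative (\<lambda>v. frame2_inv z ** conn2 z v)) (at z)"
    unfolding G' unfolding G divide_inverse[of _ r]
    by (intro has_derivative_mat2 c cz has_derivative_const has_derivative_mult_left has_derivative_ident)
qed

lemma binomial_neighbours:
  assumes "1 \<le> P" "P \<le> N"
  shows "P * (N choose P) = (N + 1 - P) * (N choose (P - 1))"
proof -
  have "P * (N choose P) = N * ((N - 1) choose (P - 1))"
    using times_binomial_minus1_eq[of P N] assms by simp
  also have "\<dots> = (N - (P - 1)) * (N choose (P - 1))"
    using binomial_absorb_comp[of N "P - 1"] by simp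
  finally show ?thesis using assms by (simp add: algebra_simps)
qed

text \<open>The monomial basis of binary forms becomes the unitary basis of \<^const>\<open>Xn\<close> and \<^const>\<open>Yn\<close> after this scaling.\<close>

definition scl :: "'n::{finite,linorder} \<Rightarrow> complex" where
  "scl i = of_real (1 / sqrt (real ((CARD('n) - 1) choose (pos i - 1))))"

lemma scl_pos:
  fixes i :: "'n::{finite,linorder}"
  shows "0 < (CARD('n) - 1) choose (pos i - 1)"
  using pos_le_card[of i] by (simp add: zero_less_binomial_iff diff_le_mono)

lemma scl_ne_0 [simp]: "scl i \<noteq> 0"
  using scl_pos[of i] by (simp add: scl_def)

text \<open>The scaling balances the two off-diagonals of \<open>dsympow\<close>: the weights p and
  n - p both become their geometric mean, which is sqrt 2 times c_p. The reason is that consecutive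
  binomial coefficients have the ratio (n - p)/p.\<close>

lemma scl_step:
  fixes i j :: "'n::{finite,linorder}"
  assumes "pos j = pos i + 1"
  shows "scl i * of_nat (pos i) / scl j = of_real (sqrt 2 * ccoef TYPE('n) (pos i))"
    "scl j * of_nat (CARD('n) - pos i) / scl i = of_real (sqrt 2 * ccoef TYPE('n) (pos i))"
proof -
  define P where "P = pos i"
  define b1 where "b1 = real ((CARD('n) - 1) choose (pos i - 1))"
  define b2 where "b2 = real ((CARD('n) - 1) choose (pos j - 1))"
  have b: "b1 > 0" "b2 > 0" using scl_pos[of i] scl_pos[of j] by (simp_all add: b1_def b2_def)
  have s: "scl i = 1 / of_real (sqrt b1)" "scl j = 1 / of_real (sqrt b2)" by (simp_all add: scl_def b1_def b2_def)
  have P: "1 \<le> P" "P < CARD('n)" using pos_ge_1[of i] pos_le_card[of j] assms by (simp_all add: P_def)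
  have "P * ((CARD('n) - 1) choose P) = (CARD('n) - P) * ((CARD('n) - 1) choose (P - 1))"
    using binomial_neighbours[of P "CARD('n) - 1"] P by simp
  then have "real (P * ((CARD('n) - 1) choose P)) = real ((CARD('n) - P) * ((CARD('n) - 1) choose (P - 1)))"
    by (simp only: Im_eq_cnj)
  then have rel: "real P * b2 = real (CARD('n) - P) * b1" using assms by (simp add: b1_def b2_def P_def)
  have c: "sqrt 2 * ccoef TYPE('n) P = sqrt (real P * real (CARD('n) - P))"
    using P by (simp add: ccoef_def of_nat_diff flip: real_sqrt_mult)
  have "sqrt b2 / sqrt b1 * real P = sqrt (real P * real (CARD('n) - P))"
  proof (rule real_sqrt_unique[symmetric])
    have "(sqrt b2 / sqrt b1 * real P)\<^sup>2 = real P * (real P * b2) / b1"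
      using b by (simp add: power_mult_distrib power_divide power2_eq_square)
    also have "\<dots> = real P * real (CARD('n) - P)" unfolding rel using b by simp
    finally show "(sqrt b2 / sqrt b1 * real P)\<^sup>2 = real P * real (CARD('n) - P)" .
  qed (use b in simp)
  from arg_cong[OF this, of complex_of_real] show "scl i * of_nat (pos i) / scl j = of_real (sqrt 2 * ccoef TYPE('n) (pos i))"
    unfolding P_def[symmetric] c by (simp add: s mult.commute)
  have "sqrt b1 / sqrt b2 * real (CARD('n) - P) = sqrt (real P * real (CARD('n) - P))"
  proof (rule real_sqrt_unique[symmetric])
    have "(sqrt b1 / sqrt b2 * real (CARD('n) - P))\<^sup>2 = real (CARD('n) - P) * (real (CARD('n) - P) * b1) / b2"
      using b by (simp add: power_mult_distrib power_divide power2_eq_square)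
    also have "\<dots> = real P * real (CARD('n) - P)" unfolding rel[symmetric] using b by simp
    finally show "(sqrt b1 / sqrt b2 * real (CARD('n) - P))\<^sup>2 = real P * real (CARD('n) - P)" .
  qed (use b in simp)
  from arg_cong[OF this, of complex_of_real] show "scl j * of_nat (CARD('n) - pos i) / scl i = of_real (sqrt 2 * ccoef TYPE('n) (pos i))"
    unfolding P_def[symmetric] c by (simp add: s mult.commute)
qed

text \<open>The connection form takes its values in the image of sl(2), so its frame in any rank is
  the symmetric power of the one in rank two.\<close>

lemma scaled_conn2:
  assumes "Im z > 0"
  shows "diagm scl ** dsympow (conn2 z v) ** diagm (\<lambda>i. 1 / scl i) = (connD z v :: 'n::{finite,linorder} cmatrix)"
proof -
  let ?n = "CARD('n)"
  define y where "y = complex_of_real (Im z)"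
  have y: "y \<noteq> 0" using assms by (simp add: y_def)
  note r = sqrt2_complex
  have "(diagm scl ** dsympow (conn2 z v) ** diagm (\<lambda>i. 1 / scl i)) $ i $ j = (connD z v) $ i $ j" for i j :: 'n
  proof -
    have L: "(diagm scl ** dsympow (conn2 z v) ** diagm (\<lambda>i. 1 / scl i)) $ i $ j = scl i * dsympow (conn2 z v) $ i $ j / scl j"
      by (simp add: mult_diagm diagm_mult)
    have R: "connD z v $ i $ j = (- (\<i> / y) * v) * An $ i $ j + v * Yn $ i $ j + of_real (hh z powi (int (pos i) - int (pos j))) * cnj (v * Yn $ j $ i)"
      by (simp add: connD_def Phi0_def cscale_def rho_def map_matrix_def y_def)
    consider "i = j" | "pos j = pos i + 1" | "pos i = pos j + 1" | "i \<noteq> j" "pos j \<noteq> pos i + 1" "pos i \<noteq> pos j + 1" by blast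
    then show ?thesis
    proof cases
      case 1
      have nat: "complex_of_nat (pos j - 1) = of_nat (pos j) - 1" "complex_of_nat (?n - pos j) = of_nat ?n - of_nat (pos j)"
        using pos_ge_1[of j] pos_le_card[of j] by (simp_all add: of_nat_diff)
      have key: "s * (- \<i> * v / (2 * y) * (p - 1) + \<i> * v / (2 * y) * (N - p)) / s = (- (\<i> / y) * v) * (p - (N + 1) / 2)"
        if "s \<noteq> 0" for s p N using that y by (simp add: field_simps)
      have "dsympow (conn2 z v) $ j $ j = - \<i> * v / (2 * y) * of_nat (pos j - 1) + \<i> * v / (2 * y) * of_nat (?n - pos j)"
        by (simp add: dsympow_def conn2_def y_def)
      moreover have "(An :: 'n cmatrix) $ j $ j = of_nat (pos j) - (of_nat ?n + 1) / 2" "(Yn :: 'n cmatrix) $ j $ j = 0"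
        by (simp_all add: An_nth Yn_def)
      ultimately show ?thesis unfolding L R unfolding 1 using key[OF scl_ne_0[of j]] by (simp add: nat nat(1)[unfolded One_nat_def])
    next
      case 2
      then have "i \<noteq> j" "pos i \<noteq> pos j + 1" by auto
      moreover have "scl i * (v / of_real (sqrt 2) * of_nat (pos i)) / scl j = v * of_real (ccoef TYPE('n) (pos i))"
        using scl_step(1)[OF 2] r by (simp add: field_simps)
      ultimately show ?thesis unfolding L R using 2 by (simp add: An_nth dsympow_def conn2_def Yn_def)
    next
      case 3
      then have "i \<noteq> j" "pos j \<noteq> pos i + 1" by auto
      moreover have "scl i * (cnj v / (2 * of_real (sqrt 2) * y\<^sup>2) * of_nat (?n - pos j)) / scl j
          = 1 / (2 * y\<^sup>2) * (cnj v * of_real (ccoef TYPE('n) (pos j)))"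
        using scl_step(2)[OF 3] r y by (simp add: field_simps)
      moreover have "complex_of_real (hh z powi (int (pos i) - int (pos j))) = 1 / (2 * y\<^sup>2)"
        using 3 by (simp add: hh_def y_def)
      ultimately show ?thesis unfolding L R using 3 by (simp add: An_nth dsympow_def conn2_def Yn_def y_def[symmetric])
    next
      case 4
      then show ?thesis unfolding L R by (simp add: An_nth dsympow_def Yn_def)
    qed
  qed
  then show ?thesis by (simp add: vec_eq_iff)
qed

lemma cscale_nth [simp]: "cscale c A $ i $ j = c * A $ i $ j"
  by (simp add: cscale_def map_matrix_def)

lemma cscale_mult_left: "cscale c A ** B = cscale c (A ** B)"
  by (simp add: vec_eq_iff matrix_mult_nth sum_distrib_left mult.assoc)

lemma cscale_mult_right: "A ** cscale c B = cscale c (A ** B)"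
  by (simp add: vec_eq_iff matrix_mult_nth sum_distrib_left mult_ac)

lemma map_matrix_cnj_mult: "map_matrix cnj (A ** B) = map_matrix cnj A ** map_matrix cnj B"
  for A :: "complex^'m::finite^'n::finite"
  by (rule map_matrix_mult_hom) auto

lemma map_matrix_of_real_mult: "map_matrix complex_of_real (A ** B) = map_matrix of_real A ** map_matrix of_real B"
  for A :: "real^'m::finite^'n::finite"
  by (rule map_matrix_mult_hom) auto

lemma map_matrix_of_real_one: "map_matrix complex_of_real (mat 1) = mat 1"
  by (simp add: vec_eq_iff map_matrix_def mat_def)

lemma map_matrix_cnj_cscale: "map_matrix cnj (cscale c A) = cscale (cnj c) (map_matrix cnj A)"
  by (simp add: vec_eq_iff map_matrix_def)

lemma sympow_cnj: "map_matrix cnj (sympow g) = sympow (map_matrix cnj g)"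
  by (rule sympow_hom) auto

lemma cmat_iota: "cmat (iota g) = sympow (map_matrix of_real g)"
  unfolding iota_eq_sympow by (rule sympow_hom) auto

lemma dsympow_minus: "dsympow (- m) = - dsympow m"
  by (simp add: vec_eq_iff dsympow_def)

lemma matrix_neg_left: "(- A) ** B = - (A ** (B :: 'a::ring_1^'l^'m::finite))"
  by (simp add: vec_eq_iff matrix_mult_nth sum_negf)

lemma matrix_neg_right: "A ** (- B) = - (A ** (B :: 'a::ring_1^'l^'m::finite))"
  by (simp add: vec_eq_iff matrix_mult_nth sum_negf)

section \<open>The flat frame\<close>

definition frame :: "complex \<Rightarrow> 'n::{finite,linorder} cmatrix" where
  "frame z = diagm scl ** sympow (frame2 z)"

definition frame_inv :: "complex \<Rightarrow> 'n::{finite,linorder} cmatrix" where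
  "frame_inv z = sympow (frame2_inv z) ** diagm (\<lambda>i. 1 / scl i)"

lemma diagm_scl_inverse:
  "diagm (\<lambda>i. 1 / scl i) ** diagm scl = (mat 1 :: 'n::{finite,linorder} cmatrix)"
  "diagm scl ** diagm (\<lambda>i. 1 / scl i) = (mat 1 :: 'n::{finite,linorder} cmatrix)"
  by (simp_all add: diagm_diagm diagm_const_1)

lemma frame_inverse:
  assumes "Im z > 0"
  shows "frame z ** frame_inv z = (mat 1 :: 'n::{finite,linorder} cmatrix)"
    "frame_inv z ** frame z = (mat 1 :: 'n::{finite,linorder} cmatrix)"
proof -
  have "frame z ** frame_inv z = (diagm scl ** (sympow (frame2 z ** frame2_inv z)) ** diagm (\<lambda>i. 1 / scl i) :: 'n cmatrix)"
    by (simp add: frame_def frame_inv_def sympow_mult matrix_mul_assoc)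
  then show "frame z ** frame_inv z = (mat 1 :: 'n cmatrix)"
    by (simp add: frame2_inverse[OF assms] sympow_one diagm_scl_inverse)
  have "frame_inv z ** frame z = (sympow (frame2_inv z) ** (diagm (\<lambda>i. 1 / scl i) ** diagm scl) ** sympow (frame2 z) :: 'n cmatrix)"
    by (simp add: frame_def frame_inv_def matrix_mul_assoc)
  then show "frame_inv z ** frame z = (mat 1 :: 'n cmatrix)"
    by (simp add: diagm_scl_inverse frame2_inverse[OF assms] sympow_one flip: sympow_mult)
qed

lemma frame_has_derivative:
  assumes "Im z > 0"
  shows "((frame :: complex \<Rightarrow> 'n::{finite,linorder} cmatrix) has_derivative (\<lambda>v. - (connD z v ** frame z))) (at z)"
    "((frame_inv :: complex \<Rightarrow> 'n::{finite,linorder} cmatrix) has_derivative (\<lambda>v. frame_inv z ** connD z v)) (at z)"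
proof -
  let ?S = "diagm scl :: 'n cmatrix" and ?T = "diagm (\<lambda>i. 1 / scl i) :: 'n cmatrix"
  have d1: "?S ** (dsympow (- conn2 z v) ** sympow (frame2 z)) = - (connD z v ** frame z)" for v
  proof -
    have "connD z v ** frame z = ?S ** dsympow (conn2 z v) ** (?T ** ?S) ** sympow (frame2 z)"
      unfolding scaled_conn2[OF assms, symmetric] frame_def by (simp only: matrix_mul_assoc)
    then show ?thesis by (simp add: diagm_scl_inverse dsympow_minus matrix_neg_left matrix_neg_right matrix_mul_assoc)
  qed
  have d2: "(sympow (frame2_inv z) ** dsympow (conn2 z v)) ** ?T = frame_inv z ** connD z v" for v
  proof -
    have "frame_inv z ** connD z v = sympow (frame2_inv z) ** (?T ** ?S) ** dsympow (conn2 z v) ** ?T"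
      unfolding scaled_conn2[OF assms, symmetric] frame_inv_def by (simp only: matrix_mul_assoc)
    then show ?thesis by (simp add: diagm_scl_inverse)
  qed
  show "((frame :: complex \<Rightarrow> 'n cmatrix) has_derivative (\<lambda>v. - (connD z v ** frame z))) (at z)"
    unfolding frame_def[abs_def] d1[symmetric, unfolded frame_def]
    by (rule has_derivative_matrix_mult_left[OF sympow_has_derivative_left[OF frame2_has_derivative(1)[OF assms] frame2_inverse[OF assms]]])
  show "((frame_inv :: complex \<Rightarrow> 'n cmatrix) has_derivative (\<lambda>v. frame_inv z ** connD z v)) (at z)"
    unfolding frame_inv_def[abs_def] d2[symmetric, unfolded frame_inv_def]
    by (rule has_derivative_matrix_mult_right[OF sympow_has_derivative_right[OF frame2_has_derivative(2)[OF assms] frame2_inverse(2,1)[OF assms]]])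
qed

section \<open>Moebius transformations\<close>

lemma det_mat2: "det (mat2 a b c d) = a * d - b * (c :: 'a::comm_ring_1)"
  by (simp add: det_2)

lemma mob_mat2: "mob (mat2 a b c d) z = (of_real a * z + of_real b) / (of_real c * z + of_real d)"
  by (simp add: mob_def moebius_def)

lemma autf_mat2: "autf (mat2 a b c d) z = of_real c * z + of_real d"
  by (simp add: autf_def)

lemma autf_ne_0:
  assumes "det g = 1" "Im z > 0"
  shows "autf g z \<noteq> 0"
proof
  obtain a b c d where g: "g = mat2 a b c d" by (rule mat2_cases)
  assume "autf g z = 0"
  then have "Im (of_real c * z + of_real d) = 0" "Re (of_real c * z + of_real d) = 0" by (simp_all add: g autf_mat2)
  then have "c = 0" "d = 0" using assms by auto
  then show False using assms by (simp add: g det_mat2)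
qed

lemma of_real_det_1: "a * d - b * c = 1 \<Longrightarrow> complex_of_real a * of_real d = 1 + of_real b * of_real c"
  by (metis add.commute diff_add_cancel of_real_1 of_real_add of_real_mult)

lemma Im_mob:
  assumes "det g = 1" "Im z > 0"
  shows "complex_of_real (Im (mob g z)) = of_real (Im z) / (autf g z * cnj (autf g z))" "Im (mob g z) > 0"
proof -
  obtain a b c d where g: "g = mat2 a b c d" by (rule mat2_cases)
  have det: "complex_of_real a * of_real d = 1 + of_real b * of_real c"
    using assms by (intro of_real_det_1) (simp add: g det_mat2)
  define j j' where "j = autf g z" and "j' = cnj j"
  have j: "j \<noteq> 0" "j' \<noteq> 0" using autf_ne_0[OF assms] by (simp_all add: j_def j'_def)
  have m: "mob g z * j = of_real a * z + of_real b" using j by (simp add: g mob_mat2 j_def autf_mat2)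
  have m': "cnj (mob g z) * j' = of_real a * cnj z + of_real b" using arg_cong[OF m, of cnj] by (simp add: j'_def)
  have "(mob g z - cnj (mob g z)) * (j * j') = (mob g z * j) * j' - (cnj (mob g z) * j') * j" by (simp add: algebra_simps)
  also have "\<dots> = (of_real a * z + of_real b) * (of_real c * cnj z + of_real d) - (of_real a * cnj z + of_real b) * (of_real c * z + of_real d)"
    unfolding m m' by (simp add: j_def j'_def g autf_mat2)
  also have "\<dots> = (of_real a * of_real d - of_real b * of_real c) * (z - cnj z)" by (simp add: algebra_simps)
  also have "\<dots> = z - cnj z" unfolding det by simp
  finally have "mob g z - cnj (mob g z) = (z - cnj z) / (j * j')" using j by (simp add: field_simps)
  then show e: "complex_of_real (Im (mob g z)) = of_real (Im z) / (autf g z * cnj (autf g z))"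
    unfolding Im_eq_cnj by (simp add: j_def j'_def)
  have "complex_of_real (Im (mob g z)) = of_real (Im z / (norm (autf g z))\<^sup>2)"
    unfolding e by (simp only: of_real_divide complex_norm_square)
  then have "Im (mob g z) = Im z / (norm (autf g z))\<^sup>2" using of_real_eq_iff by blast
  then show "Im (mob g z) > 0" using assms autf_ne_0[OF assms] by simp
qed

lemma mob_mult:
  assumes "det h = 1" "Im z > 0"
  shows "mob (g ** h) z = mob g (mob h z)" "autf (g ** h) z = autf g (mob h z) * autf h z"
proof -
  obtain a b c d where g: "g = mat2 a b c d" by (rule mat2_cases)
  obtain a' b' c' d' where h: "h = mat2 a' b' c' d'" by (rule mat2_cases)
  define j where "j = autf h z"
  have j: "j \<noteq> 0" using autf_ne_0[OF assms] by (simp add: j_def)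
  define w where "w = mob h z"
  have w: "of_real a' * z + of_real b' = w * j" "of_real c' * z + of_real d' = j"
    using j by (simp_all add: w_def h mob_mat2 j_def autf_mat2)
  have 1: "of_real (a * a' + b * c') * z + of_real (a * b' + b * d') = of_real a * (of_real a' * z + of_real b') + of_real b * (of_real c' * z + of_real d')"
    "of_real (c * a' + d * c') * z + of_real (c * b' + d * d') = of_real c * (of_real a' * z + of_real b') + of_real d * (of_real c' * z + of_real d')"
    by (simp_all add: algebra_simps)
  have 2: "of_real a * (w * j) + of_real b * j = (of_real a * w + of_real b) * j" "of_real c * (w * j) + of_real d * j = (of_real c * w + of_real d) * j"
    by (simp_all add: algebra_simps)
  show "mob (g ** h) z = mob g (mob h z)" "autf (g ** h) z = autf g (mob h z) * autf h z"
    unfolding g h mat2_mult mob_mat2 autf_mat2 1 w 2 using j by simp_all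
qed

lemma mob_has_field_derivative:
  assumes "det g = 1" "Im z > 0"
  shows "(mob g has_field_derivative 1 / (autf g z)\<^sup>2) (at z)"
proof -
  obtain a b c d where g: "g = mat2 a b c d" by (rule mat2_cases)
  have det: "complex_of_real a * of_real d = 1 + of_real b * of_real c"
    using assms by (intro of_real_det_1) (simp add: g det_mat2)
  have j: "of_real c * z + of_real d \<noteq> 0" using autf_ne_0[OF assms] by (simp add: g autf_mat2)
  have f: "mob g = (\<lambda>z. (of_real a * z + of_real b) / (of_real c * z + of_real d))" by (rule ext) (simp add: g mob_mat2)
  have "((\<lambda>z. (of_real a * z + of_real b) / (of_real c * z + of_real d)) has_field_derivative
      (of_real a * (of_real c * z + of_real d) - (of_real a * z + of_real b) * of_real c) / ((of_real c * z + of_real d) * (of_real c * z + of_real d))) (at z)"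
    using j by (auto intro!: derivative_eq_intros)
  also have "(of_real a * (of_real c * z + of_real d) - (of_real a * z + of_real b) * of_real c) = of_real a * of_real d - of_real b * of_real c"
    by (simp add: algebra_simps)
  also have "\<dots> = 1" unfolding det by simp
  finally show ?thesis unfolding f by (simp add: g autf_mat2 power2_eq_square)
qed

section \<open>Equivariance\<close>

text \<open>The monodromy condition for n = 2: in this ordering diag(1/j, j) with j =
  \<open>autf g z\<close> is the factor of automorphy. Once the transformation rule of the imaginary
  part is inserted, each entry reduces to \<open>det g = 1\<close>.\<close>

lemma frame2_equivariant:
  assumes "det g = 1" "Im z > 0"
  shows "mat2 (1 / autf g z) 0 0 (autf g z) ** frame2 (mob g z) ** map_matrix of_real g = frame2 z"
proof -
  obtain a b c d where g: "g = mat2 a b c d" by (rule mat2_cases)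
  have mm: "map_matrix complex_of_real g = mat2 (of_real a) (of_real b) (of_real c) (of_real d)"
    by (simp add: g vec_eq_iff forall_2 map_matrix_def)
  have det: "complex_of_real a * of_real d = 1 + of_real b * of_real c"
    using assms by (intro of_real_det_1) (simp add: g det_mat2)
  define A B C D where "A = complex_of_real a" and "B = complex_of_real b" and "C = complex_of_real c" and "D = complex_of_real d"
  define j j' where "j = autf g z" and "j' = cnj j"
  define r where "r = complex_of_real (sqrt 2)"
  define y where "y = complex_of_real (Im z)"
  have nz: "j \<noteq> 0" "j' \<noteq> 0" "r \<noteq> 0" "y \<noteq> 0" using autf_ne_0[OF assms] assms sqrt2_complex by (simp_all add: j_def j'_def r_def y_def)
  have je: "j = C * z + D" "j' = C * cnj z + D" by (simp_all add: j_def j'_def g autf_mat2 C_def D_def)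
  have m: "mob g z = (A * z + B) / j" by (simp add: je g mob_mat2 A_def B_def C_def D_def)
  have m': "cnj (mob g z) = (A * cnj z + B) / j'" unfolding m by (simp add: j'_def A_def B_def)
  have y': "complex_of_real (Im (mob g z)) = y / (j * j')" unfolding Im_mob(1)[OF assms] by (simp add: j_def j'_def y_def)
  have 1: "- (A * j') + (A * cnj z + B) * C = -1" "- (B * j') + (A * cnj z + B) * D = cnj z"
    "j * A - (A * z + B) * C = 1" "j * B - (A * z + B) * D = - z"
    using det unfolding je A_def[symmetric] B_def[symmetric] C_def[symmetric] D_def[symmetric] by (algebra, algebra, algebra, algebra)
  have "(1 / j) * (- \<i> / (r * (y / (j * j')))) * A + (1 / j) * (\<i> * ((A * cnj z + B) / j') / (r * (y / (j * j')))) * C = \<i> / (r * y) * (- (A * j') + (A * cnj z + B) * C)"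
    "(1 / j) * (- \<i> / (r * (y / (j * j')))) * B + (1 / j) * (\<i> * ((A * cnj z + B) / j') / (r * (y / (j * j')))) * D = \<i> / (r * y) * (- (B * j') + (A * cnj z + B) * D)"
    "j * 1 * A + j * (- ((A * z + B) / j)) * C = j * A - (A * z + B) * C"
    "j * 1 * B + j * (- ((A * z + B) / j)) * D = j * B - (A * z + B) * D"
    using nz by (simp_all add: field_simps)
  note E = this[unfolded 1]
  have prod: "mat2 (1 / j) 0 0 j ** frame2 (mob g z) = mat2 ((1 / j) * (- \<i> / (r * (y / (j * j')))))
     ((1 / j) * (\<i> * ((A * cnj z + B) / j') / (r * (y / (j * j'))))) (j * 1) (j * (- ((A * z + B) / j)))"
    unfolding frame2_def mat2_mult m' y' r_def[symmetric] unfolding m by simp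
  have fr: "frame2 z = mat2 (\<i> / (r * y) * - 1) (\<i> / (r * y) * cnj z) 1 (- z)"
    by (simp add: frame2_def r_def y_def)
  show ?thesis
    unfolding mm A_def[symmetric] B_def[symmetric] C_def[symmetric] D_def[symmetric] j_def[symmetric] prod
    unfolding fr mat2_mult E ..
qed

text \<open>The exponent n + 1 - 2p is (n - p) - (p - 1), as for diag(1/j, j) acting on monomials.
  So the equivariance in rank n is the symmetric power of the one in rank two.\<close>

lemma Jfac_eq_sympow:
  assumes "det g = 1" "Im z > 0"
  shows "(Jfac g z :: 'n::{finite,linorder} cmatrix) = sympow (mat2 (1 / autf g z) 0 0 (autf g z))"
proof -
  define j where "j = autf g z"
  have j: "j \<noteq> 0" using autf_ne_0[OF assms] by (simp add: j_def)
  have "j powi (int CARD('n) + 1 - 2 * int (pos i)) = (1 / j) ^ (pos i - 1) * j ^ (CARD('n) - pos i)" for i :: 'n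
  proof -
    have e: "int CARD('n) + 1 - 2 * int (pos i) = int (CARD('n) - pos i) - int (pos i - 1)"
      using pos_le_card[of i] pos_ge_1[of i] by (simp add: of_nat_diff)
    have "j powi (int (CARD('n) - pos i) - int (pos i - 1)) = j ^ (CARD('n) - pos i) / j ^ (pos i - 1)"
      using j by (subst power_int_diff) (simp_all only: power_int_of_nat simp_thms)
    then show ?thesis unfolding e by (simp add: power_divide)
  qed
  then show ?thesis unfolding sympow_diag by (simp add: Jfac_def diagm_def vec_eq_iff j_def)
qed

lemma frame_equivariant:
  assumes "det g = 1" "Im z > 0"
  shows "Jfac g z ** frame (mob g z) ** cmat (iota g) = (frame z :: 'n::{finite,linorder} cmatrix)"
proof -
  have comm: "Jfac g z ** diagm scl = (diagm scl ** Jfac g z :: 'n cmatrix)"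
    unfolding Jfac_eq_sympow[OF assms] sympow_diag diagm_diagm by (simp add: mult.commute)
  have "Jfac g z ** frame (mob g z) ** cmat (iota g) = (Jfac g z ** diagm scl) ** sympow (frame2 (mob g z)) ** (sympow (map_matrix of_real g) :: 'n cmatrix)"
    by (simp add: frame_def cmat_iota matrix_mul_assoc)
  also have "\<dots> = diagm scl ** (sympow (mat2 (1 / autf g z) 0 0 (autf g z)) ** sympow (frame2 (mob g z)) ** sympow (map_matrix of_real g))"
    unfolding comm by (simp add: Jfac_eq_sympow[OF assms] matrix_mul_assoc)
  also have "\<dots> = frame z" unfolding sympow_mult[symmetric] frame2_equivariant[OF assms] frame_def ..
  finally show ?thesis .
qed

lemma invertible_frame: "Im z > 0 \<Longrightarrow> invertible (frame z :: 'n::{finite,linorder} cmatrix)"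
  unfolding invertible_def using frame_inverse by blast

lemma flat_frame_frame:
  assumes "\<And>g. g \<in> \<Gamma> \<Longrightarrow> det g = 1"
  shows "flat_frame \<Gamma> (frame :: complex \<Rightarrow> 'n::{finite,linorder} cmatrix)"
  unfolding flat_frame_def upper_half_def using assms
  by (auto simp: invertible_frame frame_has_derivative frame_equivariant)

section \<open>The powers \<open>E0\<close> and their image in the flat frame\<close>

lemma E0_0: "E0 0 = mat 1"
  by (simp add: E0_def)

lemma E0_Suc: "E0 (Suc m) = cscale (- of_real (sqrt 2)) Xn ** E0 m"
  by (simp add: E0_def)

lemma E0_Suc2: "E0 (Suc m) = E0 m ** cscale (- of_real (sqrt 2)) Xn"
  by (induction m) (simp_all add: E0_0 E0_Suc matrix_mul_assoc)

lemma E0_weight: "(E0 m :: 'n::{finite,linorder} cmatrix) $ i $ j \<noteq> 0 \<Longrightarrow> pos i = pos j + m"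
proof (induction m arbitrary: i)
  case 0
  then show ?case by (simp add: E0_0 mat_def split: if_splits)
next
  case (Suc m)
  from Suc.prems obtain k where "cscale (- of_real (sqrt 2)) (Xn :: 'n cmatrix) $ i $ k * E0 m $ k $ j \<noteq> 0"
    unfolding E0_Suc matrix_mult_nth by (meson sum.not_neutral_contains_not_neutral)
  then have "(Xn :: 'n cmatrix) $ i $ k \<noteq> 0" "(E0 m :: 'n cmatrix) $ k $ j \<noteq> 0" by auto
  then show ?case using Suc.IH[of k] by (simp add: Xn_def split: if_splits)
qed

lemma E0_cnj: "map_matrix cnj (E0 m) = (E0 m :: 'n::{finite,linorder} cmatrix)"
proof (induction m)
  case 0
  show ?case by (simp add: E0_0 vec_eq_iff map_matrix_def mat_def)
next
  case (Suc m)
  have "map_matrix cnj Xn = (Xn :: 'n cmatrix)" by (simp add: vec_eq_iff map_matrix_def Xn_def)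
  then show ?case by (simp add: E0_Suc map_matrix_cnj_mult map_matrix_cnj_cscale Suc)
qed

lemma Xn_E0_commute: "Xn ** E0 m = E0 m ** Xn"
  by (induction m) (simp_all add: E0_0 E0_Suc cscale_mult_left cscale_mult_right matrix_mul_assoc[symmetric], simp_all add: matrix_mul_assoc)

lemma An_eq_diagm: "(An :: 'n::{finite,linorder} cmatrix) = diagm (\<lambda>i. of_real (real (pos i) - (real CARD('n) + 1) / 2))"
  by (simp add: vec_eq_iff An_nth diagm_def)

text \<open>Separates the part that is linear in \<open>v\<close> from the part that is linear in
  \<open>cnj v\<close>. The latter comes from \<open>rho z (Phi0 z v)\<close> alone and is a
  multiple of \<open>Xn\<close>.\<close>

lemma connD_eq:
  "connD z v = cscale v (cscale (- (\<i> / of_real (Im z))) An + Yn) - cscale (of_real (hh z) * cnj v) (Xn :: 'n::{finite,linorder} cmatrix)"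
proof -
  have "rho z (cscale v Yn) $ i $ j = of_real (hh z) * cnj v * Xn $ i $ j" for i j :: 'n
    by (simp add: rho_def Yn_def Xn_def)
  then show ?thesis by (simp add: connD_def Phi0_def vec_eq_iff algebra_simps)
qed

definition Om :: "nat \<Rightarrow> complex \<Rightarrow> 'n::{finite,linorder} cmatrix" where
  "Om m z = frame_inv z ** E0 m ** frame z"

text \<open>\<open>Om\<close> is holomorphic since the antiholomorphic part of the connection form is a multiple of \<open>Xn\<close>,
  which commutes with \<open>E0 m\<close>.\<close>

lemma Om_has_field_derivative:
  assumes "Im z > 0"
  shows "\<exists>D. ((\<lambda>z. (Om m z :: 'n::{finite,linorder} cmatrix) $ i $ j) has_field_derivative D) (at z)"
proof -
  define C :: "'n cmatrix" where "C = cscale (- (\<i> / of_real (Im z))) An + Yn"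
  define C' where "C' = C ** E0 m - E0 m ** C"
  have comm: "connD z v ** E0 m - E0 m ** connD z v = cscale v C'" for v
    unfolding connD_eq C_def[symmetric] C'_def matrix_diff_ldistrib matrix_diff_rdistrib cscale_mult_left cscale_mult_right Xn_E0_commute
    by (simp add: vec_eq_iff algebra_simps)
  have "((\<lambda>z. frame_inv z ** E0 m ** frame z :: 'n cmatrix) has_derivative
      (\<lambda>v. (frame_inv z ** E0 m) ** (- (connD z v ** frame z)) + (frame_inv z ** connD z v ** E0 m) ** frame z)) (at z)"
    by (intro has_derivative_matrix_mult has_derivative_matrix_mult_right frame_has_derivative assms)
  moreover have "(frame_inv z ** E0 m) ** (- (connD z v ** frame z)) + (frame_inv z ** connD z v ** E0 m) ** frame z
      = cscale v (frame_inv z ** C' ** (frame z :: 'n cmatrix))" for v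
  proof -
    have "(frame_inv z ** E0 m) ** (- (connD z v ** frame z)) + (frame_inv z ** connD z v ** E0 m) ** frame z
        = frame_inv z ** (connD z v ** E0 m - E0 m ** connD z v) ** (frame z :: 'n cmatrix)"
      by (simp add: matrix_neg_right matrix_diff_ldistrib matrix_diff_rdistrib matrix_mul_assoc)
    then show ?thesis unfolding comm by (simp add: cscale_mult_left cscale_mult_right)
  qed
  ultimately have "(Om m has_derivative (\<lambda>v. cscale v (frame_inv z ** C' ** (frame z :: 'n cmatrix)))) (at z)"
    unfolding Om_def[abs_def] by simp
  from has_derivative_matrix_nth[OF this, of i j]
  have "((\<lambda>z. (Om m z :: 'n cmatrix) $ i $ j) has_field_derivative (frame_inv z ** C' ** (frame z :: 'n cmatrix)) $ i $ j) (at z)"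
    unfolding has_field_derivative_def by (rule has_derivative_eq_rhs) (simp add: fun_eq_iff)
  then show ?thesis ..
qed

text \<open>By \<open>E0_weight\<close> all entries lie on a single subdiagonal, so diagonal
  matrices act by one scalar.\<close>

lemma sympow_diag_E0:
  assumes "s * s' = 1" "t * t' = 1"
  shows "sympow (mat2 s 0 0 t) ** E0 m ** sympow (mat2 s' 0 0 t') = cscale ((s * t') ^ m) (E0 m :: 'n::{finite,linorder} cmatrix)"
proof -
  have "s ^ (pos i - 1) * t ^ (CARD('n) - pos i) * (E0 m :: 'n cmatrix) $ i $ j * (s' ^ (pos j - 1) * t' ^ (CARD('n) - pos j))
      = (s * t') ^ m * (E0 m :: 'n cmatrix) $ i $ j" for i j :: 'n
  proof (cases "(E0 m :: 'n cmatrix) $ i $ j = 0")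
    case False
    from E0_weight[OF False] have "pos i - 1 = pos j - 1 + m" "CARD('n) - pos j = CARD('n) - pos i + m"
      using pos_ge_1[of j] pos_le_card[of i] by linarith+
    then have "s ^ (pos i - 1) * t ^ (CARD('n) - pos i) * (s' ^ (pos j - 1) * t' ^ (CARD('n) - pos j))
        = (s * s') ^ (pos j - 1) * (t * t') ^ (CARD('n) - pos i) * (s * t') ^ m"
      by (simp only: power_add power_mult_distrib mult_ac)
    then show ?thesis by (simp add: assms mult_ac)
  qed simp
  then show ?thesis unfolding sympow_diag by (simp add: vec_eq_iff mult_diagm diagm_mult)
qed

text \<open>This holds for every real matrix of determinant 1. With elements of \<Gamma> it makes
  the periods constant in z; with \<open>MA\<close> it carries the axis of \<alpha> back to the
  imaginary axis.\<close>

lemma Om_equivariant: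
  assumes g: "det g = 1" "g ** g' = mat 1" and z: "Im z > 0"
  shows "Om m (mob g z) = cscale ((1 / (autf g z)\<^sup>2) ^ m) (cmat (iota g) ** Om m z ** (cmat (iota g') :: 'n::{finite,linorder} cmatrix))"
proof -
  let ?w = "mob g z"
  define j where "j = autf g z"
  have j: "j \<noteq> 0" using autf_ne_0[OF g(1) z] by (simp add: j_def)
  have w: "Im ?w > 0" by (rule Im_mob[OF g(1) z])
  define J J' where "J = (sympow (mat2 (1 / j) 0 0 j) :: 'n cmatrix)" and "J' = (sympow (mat2 j 0 0 (1 / j)) :: 'n cmatrix)"
  define I I' where "I = (cmat (iota g) :: 'n cmatrix)" and "I' = (cmat (iota g') :: 'n cmatrix)"
  have "map_matrix complex_of_real g ** map_matrix complex_of_real g' = mat 1"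
    unfolding map_matrix_of_real_mult[symmetric] g(2) by (rule map_matrix_of_real_one)
  then have I: "I ** I' = mat 1" unfolding I_def I'_def cmat_iota sympow_mult[symmetric] by (simp add: sympow_one)
  have J: "J ** J' = mat 1" "J' ** J = mat 1"
    unfolding J_def J'_def sympow_mult[symmetric] using j by (simp_all add: mat2_mult sympow_one flip: mat2_one)
  have eq: "J ** frame ?w ** I = frame z"
    using frame_equivariant[OF g(1) z, where ?'n = 'n] unfolding Jfac_eq_sympow[OF g(1) z] J_def I_def j_def .
  have "J' ** frame z ** I' = (J' ** J) ** frame ?w ** (I ** I')" unfolding eq[symmetric] by (simp only: matrix_mul_assoc)
  then have F: "frame ?w = J' ** frame z ** I'" by (simp add: I J)
  have I2: "I' ** I = mat 1" using I matrix_left_right_inverse by blast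
  have "I ** frame_inv z ** J ** frame ?w = I ** (frame_inv z ** ((J ** J') ** frame z)) ** I'"
    unfolding F by (simp only: matrix_mul_assoc)
  also have "\<dots> = mat 1" by (simp add: J frame_inverse[OF z] I)
  finally have "I ** frame_inv z ** J ** (frame ?w ** frame_inv ?w) = frame_inv ?w" by (simp add: matrix_mul_assoc)
  then have Fi: "frame_inv ?w = I ** frame_inv z ** J" by (simp add: frame_inverse[OF w])
  have "Om m ?w = I ** frame_inv z ** (J ** E0 m ** J') ** frame z ** I'"
    unfolding Om_def Fi F by (simp only: matrix_mul_assoc)
  also have "J ** E0 m ** J' = cscale ((1 / j\<^sup>2) ^ m) (E0 m)"
    unfolding J_def J'_def using j by (subst sympow_diag_E0) (simp_all add: power2_eq_square)
  finally show ?thesis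
    by (simp add: cscale_mult_left cscale_mult_right Om_def I_def I'_def j_def matrix_mul_assoc)
qed

section \<open>The real structure\<close>

text \<open>The Cartan involution becomes complex conjugation in the flat frame, up to the sign: \<open>opp\<close> is the
  permutation in the matrix that relates the frame to its complex conjugate.\<close>

definition opp :: "'n::{finite,linorder} \<Rightarrow> 'n" where
  "opp i = (THE k. pos k + pos i = CARD('n) + 1)"

lemma pos_opp:
  fixes i :: "'n::{finite,linorder}"
  shows "pos (opp i) + pos i = CARD('n) + 1"
proof -
  have "1 \<le> CARD('n) + 1 - pos i" "CARD('n) + 1 - pos i \<le> CARD('n)" using pos_ge_1[of i] pos_le_card[of i] by linarith+
  from pos_surj[OF this] obtain k :: 'n where "pos k = CARD('n) + 1 - pos i" by blast
  then have k: "pos k + pos i = CARD('n) + 1" using pos_le_card[of i] by simp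
  show ?thesis unfolding opp_def
    by (rule theI[of _ k]) (use k in \<open>auto simp flip: pos_eq_iff\<close>)
qed

lemma opp_eq_iff:
  fixes i k :: "'n::{finite,linorder}"
  shows "pos i + pos k = CARD('n) + 1 \<longleftrightarrow> k = opp i"
proof -
  have "pos i + pos k = CARD('n) + 1 \<longleftrightarrow> pos k = pos (opp i)" using pos_opp[of i] by linarith
  then show ?thesis by simp
qed

lemma opp_opp [simp]: "opp (opp i) = i"
  using opp_eq_iff[of "opp i" i] pos_opp[of i] by simp

lemma bij_opp: "bij opp"
  by (rule involuntory_imp_bij) simp

text \<open>Reversing the basis transposes \<open>Xn\<close>, because c_p = c_(n-p), and therefore
  also its powers.\<close>

lemma E0_opp: "E0 m $ opp i $ opp j = (E0 m :: 'n::{finite,linorder} cmatrix) $ j $ i"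
proof (induction m arbitrary: i j)
  case 0
  have "opp i = opp j \<longleftrightarrow> i = j" by (metis opp_opp)
  then show ?case by (auto simp: E0_0 mat_def)
next
  case (Suc m)
  define Z where "Z = cscale (- of_real (sqrt 2)) (Xn :: 'n cmatrix)"
  have Z: "Z $ opp i $ opp k = Z $ k $ i" for i k
  proof -
    have p: "pos (opp i) = CARD('n) + 1 - pos i" for i :: 'n using pos_opp[of i] by linarith
    have "pos (opp i) = pos (opp k) + 1 \<longleftrightarrow> pos k = pos i + 1"
      using pos_opp[of i] pos_opp[of k] by linarith
    moreover have "ccoef TYPE('n) (pos (opp k)) = ccoef TYPE('n) (pos i)" if "pos k = pos i + 1"
    proof -
      have "pos (opp k) = CARD('n) - pos i" using pos_opp[of k] that by linarith
      then show ?thesis using pos_le_card[of i] by (simp add: ccoef_def of_nat_diff mult.commute)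
    qed
    ultimately show ?thesis by (auto simp: Z_def Xn_def)
  qed
  have "E0 (Suc m) $ opp i $ opp j = (\<Sum>k\<in>UNIV. Z $ opp i $ k * E0 m $ k $ opp j)"
    unfolding E0_Suc Z_def matrix_mult_nth ..
  also have "\<dots> = (\<Sum>k\<in>UNIV. Z $ opp i $ opp k * E0 m $ opp k $ opp j)"
    by (rule sum.reindex_bij_betw[OF bij_opp, symmetric])
  also have "\<dots> = (\<Sum>k\<in>UNIV. E0 m $ j $ k * Z $ k $ i)" by (simp add: Z Suc mult.commute)
  also have "\<dots> = E0 (Suc m) $ j $ i" unfolding E0_Suc2 Z_def matrix_mult_nth ..
  finally show ?case .
qed

lemma scl_opp: "scl (opp i) = scl i" for i :: "'n::{finite,linorder}"
proof -
  have "pos (opp i) - 1 = (CARD('n) - 1) - (pos i - 1)" "pos i - 1 \<le> CARD('n) - 1"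
    using pos_opp[of i] pos_ge_1[of i] pos_le_card[of i] by linarith+
  then have "(CARD('n) - 1) choose (pos (opp i) - 1) = (CARD('n) - 1) choose (pos i - 1)"
    by (metis binomial_symmetric)
  then show ?thesis by (simp add: scl_def)
qed

lemma sympow_antidiag_nth:
  "(sympow (mat2 0 b c 0) :: ('a::field, 'n::{finite,linorder}) sqmat) $ i $ k =
     (if k = opp i then c ^ (pos k - 1) * b ^ (CARD('n) - pos k) else 0)"
  unfolding sympow_antidiag opp_eq_iff ..

lemma antidiag_commute:
  assumes "\<And>i. f (opp i) = f i"
  shows "diagm f ** sympow (mat2 0 b c 0) = sympow (mat2 0 b c 0) ** (diagm f :: 'n::{finite,linorder} cmatrix)"
  by (simp add: vec_eq_iff diagm_mult mult_diagm sympow_antidiag_nth assms mult.commute)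

lemma antidiag_mult:
  "(sympow (mat2 0 b c 0) ** A) $ i $ j =
     (sympow (mat2 0 b c 0) :: 'n::{finite,linorder} cmatrix) $ i $ opp i * A $ opp i $ j"
proof -
  have "(sympow (mat2 0 b c 0) ** A) $ i $ j = (\<Sum>k\<in>(UNIV::'n set). if k = opp i then
      (sympow (mat2 0 b c 0) :: 'n cmatrix) $ i $ opp i * A $ opp i $ j else 0)"
    unfolding matrix_mult_nth by (rule sum.cong) (auto simp: sympow_antidiag_nth)
  then show ?thesis by simp
qed

lemma mult_antidiag:
  "(A ** sympow (mat2 0 b c 0)) $ i $ j =
     A $ i $ opp j * (sympow (mat2 0 b c 0) :: 'n::{finite,linorder} cmatrix) $ opp j $ j"
proof -
  have *: "j = opp k \<longleftrightarrow> k = opp j" for k by (metis opp_opp)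
  have "(A ** sympow (mat2 0 b c 0)) $ i $ j = (\<Sum>k\<in>(UNIV::'n set). if k = opp j then
      A $ i $ opp j * (sympow (mat2 0 b c 0) :: 'n cmatrix) $ opp j $ j else 0)"
    unfolding matrix_mult_nth by (rule sum.cong) (auto simp: sympow_antidiag_nth *)
  then show ?thesis by simp
qed

text \<open>Complex conjugation multiplies the frame by an antidiagonal symmetric power
  \<open>B\<close>. Conjugating by \<open>B\<close> reverses the basis, which transposes
  \<open>E0\<close>, and supplies the powers of \<open>hh\<close>. So \<open>- rho z\<close> becomes
  entrywise conjugation and the form is real in the flat frame.\<close>

lemma psi0_frame:
  assumes z: "Im z > 0"
  shows "frame_inv z ** psi0 k q z v ** frame z =
     cscale (q z * v) (Om (k - 1) z) + map_matrix cnj (cscale (q z * v) (Om (k - 1) z :: 'n::{finite,linorder} cmatrix))"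
proof -
  define m where "m = k - 1"
  define c where "c = q z * v"
  define y where "y = complex_of_real (Im z)"
  define r where "r = complex_of_real (sqrt 2)"
  have r: "r * r = 2" "r \<noteq> 0" "cnj r = r" using sqrt2_complex by (simp_all add: r_def)
  have y: "y \<noteq> 0" "cnj y = y" using z by (simp_all add: y_def)
  \<comment> \<open>The rows of \<open>frame2 z\<close> are conjugate to each other up to scalar
    factors; \<open>b\<close> collects these factors, and \<open>b'\<close> is its inverse.\<close>
  define b b' where "b = mat2 0 (\<i> / (r * y)) (\<i> * r * y) 0" and "b' = mat2 0 (- \<i> / (r * y)) (- \<i> * r * y) 0"
  define B B' where "B = (sympow b :: 'n cmatrix)" and "B' = (sympow b' :: 'n cmatrix)"
  have bb: "b ** b' = mat 1" using r y by (simp add: b_def b'_def mat2_mult mat2_one mat2_eq_iff)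
  have cnj_mat2: "map_matrix cnj (mat2 a b c d) = mat2 (cnj a) (cnj b) (cnj c) (cnj d)" for a b c d
    by (simp add: vec_eq_iff forall_2 map_matrix_def)
  have F2: "map_matrix cnj (frame2 z) = b ** frame2 z"
    unfolding frame2_def cnj_mat2 b_def mat2_mult mat2_eq_iff y_def[symmetric] r_def[symmetric]
    using r y by simp
  have "map_matrix cnj (frame2_inv z) ** map_matrix cnj (frame2 z) = map_matrix cnj (mat 1)"
    unfolding map_matrix_cnj_mult[symmetric] frame2_inverse[OF z] ..
  also have "map_matrix cnj (mat 1) = (mat 1 :: complex^2^2)" unfolding mat2_one cnj_mat2 by simp
  finally have "map_matrix cnj (frame2_inv z) ** (b ** frame2 z) = mat 1" unfolding F2 .
  then have "map_matrix cnj (frame2_inv z) ** b ** frame2 z ** (frame2_inv z ** b') = frame2_inv z ** b'"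
    by (simp add: matrix_mul_assoc)
  moreover have "map_matrix cnj (frame2_inv z) ** b ** frame2 z ** (frame2_inv z ** b')
      = map_matrix cnj (frame2_inv z) ** (b ** ((frame2 z ** frame2_inv z) ** b'))" by (simp only: matrix_mul_assoc)
  ultimately have G2: "map_matrix cnj (frame2_inv z) = frame2_inv z ** b'"
    by (simp add: frame2_inverse[OF z] bb)
  have cd: "map_matrix cnj (diagm f) = diagm f" if "\<And>i. cnj (f i) = f i" for f :: "'n \<Rightarrow> complex"
    using that by (simp add: vec_eq_iff map_matrix_def diagm_def)
  have cs: "cnj (scl i) = scl i" for i :: 'n by (simp add: scl_def)
  have "map_matrix cnj (frame z) = diagm scl ** B ** (sympow (frame2 z) :: 'n cmatrix)"
    unfolding frame_def map_matrix_cnj_mult sympow_cnj F2 sympow_mult B_def by (subst cd) (simp_all add: cs matrix_mul_assoc)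
  also have "diagm scl ** B = B ** (diagm scl :: 'n cmatrix)" unfolding B_def b_def by (rule antidiag_commute[of scl, OF scl_opp])
  finally have F: "map_matrix cnj (frame z) = B ** (frame z :: 'n cmatrix)" by (simp add: frame_def matrix_mul_assoc)
  have "map_matrix cnj (frame_inv z) = sympow (frame2_inv z) ** (B' ** (diagm (\<lambda>i. 1 / scl i) :: 'n cmatrix))"
    unfolding frame_inv_def map_matrix_cnj_mult sympow_cnj G2 sympow_mult B'_def by (subst cd) (simp_all add: cs matrix_mul_assoc)
  also have "B' ** diagm (\<lambda>i. 1 / scl i) = (diagm (\<lambda>i. 1 / scl i) :: 'n cmatrix) ** B'"
    unfolding B'_def b'_def by (rule antidiag_commute[symmetric]) (simp add: scl_opp)
  finally have G: "map_matrix cnj (frame_inv z) = frame_inv z ** (B' :: 'n cmatrix)" by (simp add: frame_inv_def matrix_mul_assoc)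
  define \<phi> where "\<phi> = cscale c (E0 m :: 'n cmatrix)"
  have "(B' ** map_matrix cnj \<phi> ** B) $ i $ j = - rho z \<phi> $ i $ j" for i j
  proof (cases "(E0 m :: 'n cmatrix) $ j $ i = 0")
    case True
    then show ?thesis
      by (simp add: B'_def B_def b_def b'_def mult_antidiag antidiag_mult \<phi>_def map_matrix_def E0_opp rho_def)
  next
    case False
    have w: "pos j = pos i + m" by (rule E0_weight[OF False])
    have oi: "pos (opp i) - 1 = CARD('n) - pos j + m" "CARD('n) - pos (opp i) = pos i - 1" "pos j - 1 = pos i - 1 + m"
      using pos_opp[of i] pos_ge_1[of i] pos_le_card[of j] w by linarith+
    \<comment> \<open>The factors of \<open>\<i>\<close> cancel in pairs and leave
      \<open>(2 * y\<^sup>2) ^ m\<close>, which is \<open>hh z\<close> to the power -m = pos i - pos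
      j.\<close>
    have "B' $ i $ opp i * B $ opp j $ j = (- \<i> * r * y) ^ (CARD('n) - pos j + m) * (- \<i> / (r * y)) ^ (pos i - 1)
        * ((\<i> * r * y) ^ (pos i - 1 + m) * (\<i> / (r * y)) ^ (CARD('n) - pos j))"
      unfolding B'_def B_def b_def b'_def sympow_antidiag_nth oi by (simp add: oi(3)[unfolded One_nat_def] oi(1)[unfolded One_nat_def] oi(2))
    also have "\<dots> = ((- \<i> * r * y) * (\<i> / (r * y))) ^ (CARD('n) - pos j) * ((- \<i> / (r * y)) * (\<i> * r * y)) ^ (pos i - 1)
        * ((- \<i> * r * y) * (\<i> * r * y)) ^ m"
      by (simp only: power_add power_mult_distrib mult_ac)
    also have "\<dots> = (2 * y\<^sup>2) ^ m"
    proof -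
      have "(- \<i> * r * y) * (\<i> / (r * y)) = 1" "(- \<i> / (r * y)) * (\<i> * r * y) = 1" using r y by simp_all
      moreover have "(- \<i> * r * y) * (\<i> * r * y) = (r * r) * (y * y)" by (simp add: mult_ac)
      ultimately show ?thesis by (simp add: r(1) power2_eq_square)
    qed
    also have "\<dots> = of_real (hh z powi (int (pos i) - int (pos j)))"
    proof -
      have e: "int (pos i) - int (pos j) = - int m" using w by simp
      show ?thesis unfolding e by (simp add: hh_def power_int_minus y_def power_divide)
    qed
    finally have BB: "B' $ i $ opp i * B $ opp j $ j = of_real (hh z powi (int (pos i) - int (pos j)))" .
    have "(B' ** map_matrix cnj \<phi> ** B) $ i $ j = (B' $ i $ opp i * B $ opp j $ j) * cnj (c * E0 m $ j $ i)"
      unfolding B'_def B_def b_def b'_def mult_antidiag antidiag_mult by (simp add: \<phi>_def map_matrix_def E0_opp mult_ac)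
    then show ?thesis unfolding BB by (simp add: rho_def \<phi>_def)
  qed
  then have rho: "B' ** map_matrix cnj \<phi> ** B = - rho z \<phi>" by (simp add: vec_eq_iff)
  have "map_matrix cnj (frame_inv z ** \<phi> ** frame z) = frame_inv z ** (B' ** map_matrix cnj \<phi> ** B) ** frame z"
    by (simp add: map_matrix_cnj_mult F G matrix_mul_assoc)
  then have "map_matrix cnj (frame_inv z ** \<phi> ** frame z) = - (frame_inv z ** rho z \<phi> ** frame z)"
    unfolding rho by (simp add: matrix_neg_left matrix_neg_right)
  moreover have "psi0 k q z v = \<phi> - rho z \<phi>" by (simp add: psi0_def phi0_def \<phi>_def c_def m_def)
  moreover have "frame_inv z ** \<phi> ** frame z = cscale (q z * v) (Om (k - 1) z)"
    by (simp add: \<phi>_def cscale_mult_left cscale_mult_right Om_def c_def m_def)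
  ultimately show ?thesis
    by (simp add: matrix_diff_ldistrib matrix_diff_rdistrib)
qed

section \<open>The diagonal entries along an axis\<close>

text \<open>On the imaginary axis \<open>frame2\<close> is the real matrix with rows (1, 1) and (1,
  -1) between two diagonal matrices; this is what remains of the diagonal entry of \<open>Om\<close>
  when the diagonal factors are taken out. It depends on \<open>m\<close>, \<open>j\<close> and the
  rank only.\<close>

definition axis_coeff :: "nat \<Rightarrow> 'n::{finite,linorder} \<Rightarrow> complex" where
  "axis_coeff m j = (sympow (mat2 (1/2) (1/2) (1/2) (-1/2)) ** diagm (\<lambda>i. 1 / scl i) ** E0 m ** diagm scl ** sympow (mat2 1 1 1 (-1)) :: 'n cmatrix) $ j $ j
     * of_real (sqrt 2) ^ m"

text \<open>All factors are real matrices. Reality is what later turns the real part of i times the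
  integrand into minus its imaginary part.\<close>

lemma axis_coeff_real: "cnj (axis_coeff m j) = axis_coeff m (j :: 'n::{finite,linorder})"
proof -
  have cnj_mat2: "map_matrix cnj (mat2 a b c d) = mat2 (cnj a) (cnj b) (cnj c) (cnj d)" for a b c d
    by (simp add: vec_eq_iff forall_2 map_matrix_def)
  have "map_matrix cnj (diagm (\<lambda>i. 1 / scl i)) = (diagm (\<lambda>i. 1 / scl i) :: 'n cmatrix)" "map_matrix cnj (diagm scl) = (diagm scl :: 'n cmatrix)"
    by (simp_all add: vec_eq_iff map_matrix_def diagm_def scl_def)
  then have "map_matrix cnj (sympow (mat2 (1/2) (1/2) (1/2) (-1/2)) ** diagm (\<lambda>i. 1 / scl i) ** E0 m ** diagm scl ** sympow (mat2 1 1 1 (-1)) :: 'n cmatrix)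
    = sympow (mat2 (1/2) (1/2) (1/2) (-1/2)) ** diagm (\<lambda>i. 1 / scl i) ** E0 m ** diagm scl ** sympow (mat2 1 1 1 (-1))"
    by (simp add: map_matrix_cnj_mult sympow_cnj E0_cnj cnj_mat2)
  from arg_cong[OF this, of "\<lambda>A. A $ j $ j"] show ?thesis
    unfolding axis_coeff_def by (simp only: map_matrix_def vec_lambda_beta complex_cnj_mult complex_cnj_power complex_cnj_complex_of_real)
qed

lemma Om_axis:
  assumes s: "s > 0"
  shows "(Om m (\<i> * of_real s) :: 'n::{finite,linorder} cmatrix) $ j $ j = axis_coeff m j * (\<i> * of_real s) ^ m"
proof -
  define w where "w = \<i> * complex_of_real s"
  define r where "r = complex_of_real (sqrt 2)"
  have r: "r * r = 2" "r \<noteq> 0" using sqrt2_complex by (simp_all add: r_def)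
  have w: "w \<noteq> 0" "Im w = s" "cnj w = - w" "complex_of_real s = - \<i> * w" using s by (simp_all add: w_def)
  have Imw: "Im w > 0" using s w by simp
  let ?h = "mat2 1 1 1 (-1) :: complex^2^2" and ?h' = "mat2 (1/2) (1/2) (1/2) (-1/2) :: complex^2^2"
  \<comment> \<open>The factorisation relies on \<open>cnj w = - w\<close>. The inner diagonal
    factor acts on \<open>E0 m\<close> by a scalar, and the outer one cancels in a diagonal
    entry.\<close>
  have F2: "frame2 w = mat2 (1 / (r * w)) 0 0 1 ** ?h ** mat2 1 0 0 w"
    unfolding frame2_def mat2_mult mat2_eq_iff r_def[symmetric] w(2) using r w by (simp add: field_simps)
  have G2: "frame2_inv w = mat2 1 0 0 (1 / w) ** ?h' ** mat2 (r * w) 0 0 1"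
    unfolding frame2_inv_def mat2_mult mat2_eq_iff r_def[symmetric] w(2) using r w by (simp add: field_simps)
  define S T where "S = (diagm scl :: 'n cmatrix)" and "T = (diagm (\<lambda>i. 1 / scl i) :: 'n cmatrix)"
  define D D' where "D = (sympow (mat2 (1 / (r * w)) 0 0 1) :: 'n cmatrix)" and "D' = (sympow (mat2 (r * w) 0 0 1) :: 'n cmatrix)"
  define H H' where "H = (sympow ?h :: 'n cmatrix)" and "H' = (sympow ?h' :: 'n cmatrix)"
  have comm: "S ** D = D ** S" "D' ** T = T ** D'"
    unfolding S_def T_def D_def D'_def sympow_diag diagm_diagm by (simp_all add: mult.commute)
  have "Om m w = sympow (mat2 1 0 0 (1 / w)) ** (H' ** (D' ** T) ** E0 m ** (S ** D) ** H) ** (sympow (mat2 1 0 0 w) :: 'n cmatrix)"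
    unfolding Om_def frame_def frame_inv_def F2 G2 sympow_mult S_def T_def D_def D'_def H_def H'_def
    by (simp only: matrix_mul_assoc)
  also have "H' ** (D' ** T) ** E0 m ** (S ** D) ** H = H' ** T ** (D' ** E0 m ** D) ** S ** H"
    unfolding comm by (simp only: matrix_mul_assoc)
  also have "D' ** E0 m ** D = cscale ((r * w) ^ m) (E0 m)"
    unfolding D_def D'_def using r w by (subst sympow_diag_E0) simp_all
  finally have "Om m w $ j $ j = (1 / w) ^ (CARD('n) - pos j) * ((r * w) ^ m * (H' ** T ** E0 m ** S ** H) $ j $ j) * w ^ (CARD('n) - pos j)"
    by (simp add: sympow_diag diagm_mult mult_diagm cscale_mult_left cscale_mult_right)
  also have "\<dots> = (H' ** T ** E0 m ** S ** H) $ j $ j * r ^ m * w ^ m"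
    using w by (simp add: power_divide power_mult_distrib)
  finally show ?thesis unfolding w_def[symmetric] axis_coeff_def H_def H'_def T_def S_def r_def by simp
qed

section \<open>Hyperbolic elements\<close>

text \<open>The adjugate. It is the inverse on determinant 1, but \<open>inv2_mult\<close> and
  \<open>inv2_inv2\<close> hold for all matrices.\<close>

definition inv2 :: "real^2^2 \<Rightarrow> real^2^2" where
  "inv2 g = mat2 (g$2$2) (- g$1$2) (- g$2$1) (g$1$1)"

lemma inv2_mat2: "inv2 (mat2 a b c d) = mat2 d (- b) (- c) a"
  by (simp add: inv2_def)

lemma inv2_mult: "inv2 (g ** h) = inv2 h ** inv2 g"
proof -
  obtain a b c d where g: "g = mat2 a b c d" by (rule mat2_cases)
  obtain a' b' c' d' where h: "h = mat2 a' b' c' d'" by (rule mat2_cases)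
  show ?thesis by (simp add: g h inv2_mat2 mat2_mult mat2_eq_iff algebra_simps)
qed

lemma inv2_inverse:
  assumes "det g = 1"
  shows "g ** inv2 g = mat 1" "inv2 g ** g = mat 1"
proof -
  obtain a b c d where g: "g = mat2 a b c d" by (rule mat2_cases)
  show "g ** inv2 g = mat 1" "inv2 g ** g = mat 1"
    using assms by (simp_all add: g det_mat2 inv2_mat2 mat2_mult mat2_one mat2_eq_iff algebra_simps)
qed

lemma det_inv2 [simp]: "det (inv2 g) = det g"
  by (simp add: inv2_def det_mat2 det_2 mult.commute)

lemma inv2_inv2 [simp]: "inv2 (inv2 g) = g"
  by (simp add: inv2_def mat2_eta)

lemma inv2_minus: "inv2 (- mat 1) = - mat 1"
  by (simp add: inv2_def vec_eq_iff forall_2 mat_def)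

text \<open>\<open>\<theta>\<^bsub>u,U\<^esub>\<close> for the geodesic from \<open>M 0\<close> to \<open>M \<infinity>\<close> if \<open>det M = 1\<close>.\<close>

definition thM :: "real^2^2 \<Rightarrow> complex \<Rightarrow> complex" where
  "thM M z = 1 / (hlin (column 1 M) z * hlin (column 2 M) z)"

lemma thM_mat2: "thM (mat2 a b c d) z = 1 / ((of_real c * z - of_real a) * (of_real d * z - of_real b))"
  by (simp add: thM_def hlin_def column_def)

lemma thM_pullback:
  assumes "det g = 1" "Im z > 0"
  shows "thM M (mob g z) * (1 / (autf g z)\<^sup>2) = thM (inv2 g ** M) z"
proof -
  obtain a b c d where g: "g = mat2 a b c d" by (rule mat2_cases)
  obtain p q r s where M: "M = mat2 p q r s" by (rule mat2_cases)
  define j where "j = autf g z"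
  have j: "j \<noteq> 0" using autf_ne_0[OF assms] by (simp add: j_def)
  have jz: "of_real c * z + of_real d = j" by (simp add: j_def g autf_mat2)
  have lin: "(of_real x * ((of_real a * z + of_real b) / j) - of_real y) * j
      = of_real (- c * y + a * x) * z - of_real (d * y + - b * x)" for x y
    using j by (simp add: field_simps flip: jz)
  show ?thesis
    unfolding g M inv2_mat2 mat2_mult thM_mat2 mob_mat2 autf_mat2 jz lin[symmetric]
    using j by (simp add: power2_eq_square mult_ac)
qed

text \<open>A diagonal factor on the right keeps both ends M 0 and M \<infinity>. This makes the
  summands of the series independent of the representatives of the cosets.\<close>

lemma thM_scale:
  assumes "x \<noteq> 0"
  shows "thM (M ** mat2 x 0 0 (1 / x)) z = thM M z"
proof -
  obtain p q r s where M: "M = mat2 p q r s" by (rule mat2_cases)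
  have 1: "of_real (r * x) * z - of_real (p * x) = of_real x * (of_real r * z - of_real p)"
    "of_real (s * (1 / x)) * z - of_real (q * (1 / x)) = (1 / of_real x) * (of_real s * z - of_real q)" 
    using assms by (simp_all add: algebra_simps diff_divide_distrib)
  show ?thesis
    unfolding M mat2_mult thM_mat2 using 1 assms by simp
qed

text \<open>The imaginary part at \<open>z\<close> controls c, and then the value at
  \<open>z\<close> controls a. What matters is that the factor depends on \<open>z\<close> only, not
  on the geodesic.\<close>

lemma thM_linear_bound:
  assumes "Im z > 0"
  shows "norm (of_real c * \<i> - of_real a :: complex) \<le> (1 + (1 + norm z) / Im z) * norm (of_real c * z - of_real a :: complex)"
proof -
  define n where "n = norm (of_real c * z - of_real a :: complex)"
  have c: "\<bar>c\<bar> \<le> n / Im z"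
    using abs_Im_le_cmod[of "of_real c * z - of_real a"] assms by (simp add: n_def abs_mult field_simps)
  have "of_real a = of_real c * z - (of_real c * z - of_real a)" by simp
  then have "\<bar>a\<bar> \<le> norm (of_real c * z) + n"
    by (metis n_def norm_of_real norm_triangle_ineq4)
  then have a: "\<bar>a\<bar> \<le> \<bar>c\<bar> * norm z + n" by (simp add: norm_mult)
  have "norm (of_real c * \<i> - of_real a :: complex) \<le> \<bar>c\<bar> + \<bar>a\<bar>"
    using norm_triangle_ineq4[of "of_real c * \<i>" "of_real a"] by (simp add: norm_mult)
  also have "\<dots> \<le> \<bar>c\<bar> * (1 + norm z) + n" using a by (simp add: algebra_simps)
  also have "\<dots> \<le> n / Im z * (1 + norm z) + n" using c by (intro add_mono mult_right_mono) auto
  also have "\<dots> = (1 + (1 + norm z) / Im z) * n" by (simp add: algebra_simps)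
  finally show ?thesis by (simp add: n_def)
qed

lemma thM_denom_ne_0:
  assumes "det (mat2 a b c d) = 1" "Im z > 0"
  shows "of_real c * z - of_real a \<noteq> 0" "of_real d * z - of_real b \<noteq> 0"
proof -
  show "of_real c * z - of_real a \<noteq> 0" "of_real d * z - of_real b \<noteq> 0"
    using assms by (auto simp: det_mat2 complex_eq_iff)
qed

text \<open>By the first bound a majorant at the single point \<open>\<i>\<close> serves any compact
  set of \<open>z\<close>, uniformly in \<open>M\<close>. The second is the boundedness of \<theta>
  in the hyperbolic metric.\<close>

lemma norm_thM_le:
  assumes "det M = 1" "Im z > 0"
  shows "norm (thM M z) \<le> (1 + (1 + norm z) / Im z)\<^sup>2 * norm (thM M \<i>)" "norm (thM M z) * Im z \<le> 1"
proof -
  obtain a b c d where M: "M = mat2 a b c d" by (rule mat2_cases)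
  define K where "K = 1 + (1 + norm z) / Im z"
  have K: "K > 0" using assms by (simp add: K_def add_pos_nonneg)
  have nz: "of_real c * z - of_real a \<noteq> 0" "of_real d * z - of_real b \<noteq> 0"
    "of_real c * \<i> - of_real a \<noteq> (0::complex)" "of_real d * \<i> - of_real b \<noteq> (0::complex)"
    using thM_denom_ne_0[of a b c d z] thM_denom_ne_0[of a b c d \<i>] assms M by auto
  define p q where "p = norm (of_real c * \<i> - of_real a :: complex)" and "q = norm (of_real d * \<i> - of_real b :: complex)"
  define p' q' where "p' = norm (of_real c * z - of_real a)" and "q' = norm (of_real d * z - of_real b)"
  have pos: "p > 0" "q > 0" "p' > 0" "q' > 0" using nz by (simp_all add: p_def q_def p'_def q'_def)
  have "p \<le> K * p'" "q \<le> K * q'" unfolding K_def p_def q_def p'_def q'_def using thM_linear_bound[OF assms(2)] by blast+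
  then have "p * q \<le> (K * p') * (K * q')" using pos by (intro mult_mono) auto
  then have "1 / (p' * q') \<le> K\<^sup>2 * (1 / (p * q))" using pos by (simp add: field_simps power2_eq_square)
  then show "norm (thM M z) \<le> (1 + (1 + norm z) / Im z)\<^sup>2 * norm (thM M \<i>)"
    by (simp add: M thM_mat2 norm_divide norm_mult p_def q_def p'_def q'_def K_def)
  \<comment> \<open>One linear form times the conjugate of the other has imaginary part
    \<open>det M * Im z\<close>, which bounds the product of the moduli from below.\<close>
  have "Im z = Im ((of_real c * z - of_real a) * cnj (of_real d * z - of_real b))"
  proof -
    have "Im ((of_real c * z - of_real a) * cnj (of_real d * z - of_real b)) = (a * d - b * c) * Im z"
      by (simp add: algebra_simps)
    then show ?thesis using assms by (simp add: M det_mat2)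
  qed
  also have "\<dots> \<le> norm ((of_real c * z - of_real a) * cnj (of_real d * z - of_real b))"
    using abs_Im_le_cmod[of "(of_real c * z - of_real a) * cnj (of_real d * z - of_real b)"] by linarith
  also have "\<dots> = p' * q'" by (simp only: norm_mult complex_mod_cnj p'_def q'_def)
  finally show "norm (thM M z) * Im z \<le> 1"
    using pos by (simp add: M thM_mat2 norm_divide norm_mult p'_def[symmetric] q'_def[symmetric])
qed

lemma mob_inverse:
  assumes "det g = 1" "Im z > 0"
  shows "mob g (mob (inv2 g) z) = z" "mob (inv2 g) (mob g z) = z"
proof -
  have one: "mob (mat 1) z = z" by (simp add: mat2_one mob_mat2)
  show "mob g (mob (inv2 g) z) = z" "mob (inv2 g) (mob g z) = z"
    using mob_mult[of "inv2 g" z g] mob_mult[of g z "inv2 g"] assms inv2_inverse[OF assms(1)] one by simp_all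
qed

text \<open>With this coordinate \<open>thM M\<close> is \<open>-dw\<close>; the upper half plane becomes the strip \<open>0 < Im w < \<pi>\<close>.\<close>

definition logc :: "real^2^2 \<Rightarrow> complex \<Rightarrow> complex" where
  "logc M z = Ln (mob (inv2 M) z)"

lemma logc_has_field_derivative:
  assumes "det M = 1" "Im z > 0"
  shows "(logc M has_field_derivative - thM M z) (at z)"
proof -
  obtain a b c d where M: "M = mat2 a b c d" by (rule mat2_cases)
  have det: "det (inv2 M) = 1" using assms by simp
  have w: "Im (mob (inv2 M) z) > 0" by (rule Im_mob[OF det assms(2)])
  then have "mob (inv2 M) z \<notin> \<real>\<^sub>\<le>\<^sub>0" by (auto simp: complex_nonpos_Reals_iff)
  from has_field_derivative_Ln[OF this]
  have "((\<lambda>z. Ln (mob (inv2 M) z)) has_field_derivative inverse (mob (inv2 M) z) * (1 / (autf (inv2 M) z)\<^sup>2)) (at z)"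
    by (rule DERIV_chain2[OF _ mob_has_field_derivative[OF det assms(2)]])
  moreover have "inverse (mob (inv2 M) z) * (1 / (autf (inv2 M) z)\<^sup>2) = - thM M z"
  proof -
    have nz: "of_real c * z - of_real a \<noteq> 0" "of_real d * z - of_real b \<noteq> 0"
      using thM_denom_ne_0[of a b c d z] assms M by auto
    have e: "of_real (- c) * z + of_real a = - (of_real c * z - of_real a)" "of_real d * z + of_real (- b) = of_real d * z - of_real b"
      by simp_all
    define p q where "p = of_real c * z - of_real a" and "q = of_real d * z - of_real b"
    show ?thesis
      unfolding M inv2_mat2 mob_mat2 autf_mat2 thM_mat2 e p_def[symmetric] q_def[symmetric] using nz[folded p_def q_def]
      by (simp add: power2_eq_square inverse_eq_divide)
  qed
  ultimately show ?thesis by (simp add: logc_def[abs_def])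
qed

lemma logc_Im:
  assumes "det M = 1" "Im z > 0"
  shows "0 < Im (logc M z)" "Im (logc M z) < pi"
proof -
  have w: "Im (mob (inv2 M) z) > 0" using Im_mob[of "inv2 M" z] assms by simp
  show "0 < Im (logc M z)" "Im (logc M z) < pi"
    unfolding logc_def using w Im_Ln_pos_lt_imp by blast+
qed

lemma logc_inj:
  assumes "det M = 1" "Im z > 0" "Im z' > 0" "logc M z = logc M z'"
  shows "z = z'"
proof -
  have w: "Im (mob (inv2 M) z) > 0" "Im (mob (inv2 M) z') > 0" using Im_mob[of "inv2 M"] assms by simp_all
  then have "mob (inv2 M) z \<noteq> 0" "mob (inv2 M) z' \<noteq> 0" by auto
  then have "mob (inv2 M) z = mob (inv2 M) z'" using assms(4) unfolding logc_def by (metis exp_Ln)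
  then show ?thesis using mob_inverse[OF assms(1,2)] mob_inverse[OF assms(1,3)] by metis
qed

lemma logc_translate:
  assumes "det M = 1" "Im z > 0" "det g = 1" "g ** M = M ** mat2 x 0 0 (1 / x)" "x \<noteq> 0"
  shows "logc M (mob g z) = logc M z + of_real (2 * ln \<bar>x\<bar>)"
proof -
  have "inv2 M ** g = inv2 M ** g ** (M ** inv2 M)" by (simp add: inv2_inverse[OF assms(1)])
  also have "\<dots> = inv2 M ** (g ** M) ** inv2 M" by (simp only: matrix_mul_assoc)
  also have "\<dots> = (inv2 M ** M) ** mat2 x 0 0 (1 / x) ** inv2 M" unfolding assms(4) by (simp only: matrix_mul_assoc)
  finally have e: "inv2 M ** g = mat2 x 0 0 (1 / x) ** inv2 M" by (simp add: inv2_inverse[OF assms(1)])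
  define w where "w = mob (inv2 M) z"
  have w: "Im w > 0" unfolding w_def using Im_mob[of "inv2 M" z] assms by simp
  then have w0: "w \<noteq> 0" by auto
  have "mob (inv2 M) (mob g z) = mob (mat2 x 0 0 (1 / x)) w"
    unfolding w_def using mob_mult[of g z "inv2 M"] mob_mult[of "inv2 M" z "mat2 x 0 0 (1 / x)"] assms e by simp
  also have "\<dots> = of_real (x\<^sup>2) * w" using assms(5) by (simp add: mob_mat2 power2_eq_square)
  finally have "logc M (mob g z) = Ln (of_real (x\<^sup>2) * w)" by (simp add: logc_def)
  also have "\<dots> = ln (x\<^sup>2) + Ln w" using assms(5) w0 by (subst Ln_times_of_real) (auto simp: Ln_of_real simp del: of_real_power)
  also have "ln (x\<^sup>2) = 2 * ln \<bar>x\<bar>" using assms(5) by (metis abs_ge_zero ln_realpow power2_abs of_nat_numeral zero_less_abs_iff)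
  finally show ?thesis by (simp add: logc_def w_def)
qed

text \<open>The columns of \<open>M\<close> are the attracting and the repelling eigenvector, scaled to determinant 1.\<close>

lemma hyperbolic_normal_form:
  assumes det: "det \<gamma> = 1" and tr: "\<bar>trace \<gamma>\<bar> > 2"
  obtains M \<mu> where "det M = 1" "\<bar>\<mu>\<bar> > 1" "\<gamma> ** M = M ** mat2 \<mu> 0 0 (1 / \<mu>)" "\<And>z. theta \<gamma> z = thM M z"
proof -
  obtain a b c d where g: "\<gamma> = mat2 a b c d" by (rule mat2_cases)
  define t where "t = a + d"
  have t: "\<bar>t\<bar> > 2" using tr by (simp add: g t_def trace_def sum_2)
  have dg: "a * d - b * c = 1" using det by (simp add: g det_mat2)
  have eig: "\<exists>w. w \<noteq> 0 \<and> \<gamma> *v w = x *s w" if "x * x - t * x + 1 = 0" for x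
  proof -
    have "det (\<gamma> - mat2 x 0 0 x) = 0"
      using that dg by (simp add: g det_2 t_def algebra_simps)
    then have "\<not> invertible (\<gamma> - mat2 x 0 0 x)" by (simp add: invertible_det_nz)
    then have "\<not> (\<exists>B. B ** (\<gamma> - mat2 x 0 0 x) = mat 1)" by (simp add: invertible_left_inverse)
    then obtain w where w: "(\<gamma> - mat2 x 0 0 x) *v w = 0" "w \<noteq> 0" using matrix_left_invertible_ker by blast
    have "mat2 x 0 0 x *v w = x *s w" by (simp add: vec_eq_iff forall_2 matrix_vector_mult_def sum_2)
    then show ?thesis using w by (auto simp: matrix_vector_mult_diff_rdistrib)
  qed
  define e where "e = sqrt (t\<^sup>2 - 4)"
  have "2\<^sup>2 < \<bar>t\<bar>\<^sup>2" using t by (intro power_strict_mono) auto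
  then have t2: "t\<^sup>2 > 4" by simp
  then have e: "e * e = t\<^sup>2 - 4" "e > 0" by (simp_all add: e_def)
  \<comment> \<open>With the sign of the trace in front of the root, \<open>x1\<close> is the root
    of modulus greater than 1 for either sign of the trace.\<close>
  define s where "s = sgn t"
  have s: "s * s = 1" "s * t = \<bar>t\<bar>" using t by (auto simp: s_def sgn_if)
  define x1 where "x1 = (t + s * e) / 2"
  define x2 where "x2 = (t - s * e) / 2"
  have x12: "x1 * x1 - t * x1 + 1 = 0" "x2 * x2 - t * x2 + 1 = 0" "x1 * x2 = 1"
  proof -
    have se: "(s * e) * (s * e) = t * t - 4" using s(1) e(1) by (metis mult.assoc mult.left_commute mult.right_neutral power2_eq_square)
    have "4 * (x1 * x2) = t * t - (s * e) * (s * e)" by (simp add: x1_def x2_def field_simps)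
    then show "x1 * x2 = 1" using se by simp
    have "x1 * x1 - t * x1 + 1 = ((s * e) * (s * e) - t * t + 4) / 4" "x2 * x2 - t * x2 + 1 = ((s * e) * (s * e) - t * t + 4) / 4"
      by (simp_all add: x1_def x2_def field_simps)
    then show "x1 * x1 - t * x1 + 1 = 0" "x2 * x2 - t * x2 + 1 = 0" using se by simp_all
  qed
  have "s * x1 = (\<bar>t\<bar> + e) / 2" using s by (simp add: x1_def algebra_simps)
  moreover have "\<bar>s\<bar> = 1" using s(1) t by (auto simp: s_def sgn_if)
  ultimately have "\<bar>x1\<bar> = \<bar>(\<bar>t\<bar> + e) / 2\<bar>" by (metis abs_mult mult_1)
  then have x1: "\<bar>x1\<bar> > 1" using t e(2) by simp
  have x2: "\<bar>x2\<bar> < 1"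
  proof -
    have "\<bar>x1\<bar> * \<bar>x2\<bar> = 1" using x12(3) by (metis abs_mult abs_one)
    then show ?thesis using x1 by (smt (verit) mult_le_cancel_left1 mult_left_le)
  qed
  define U where "U = attracting \<gamma>"
  define u where "u = repelling \<gamma>"
  \<comment> \<open>The vectors in \<open>attracting\<close> and \<open>repelling\<close> are chosen
    only by the size of their eigenvalues \<open>m1\<close> and \<open>m2\<close>; that these are
    inverse to each other follows from the determinant below.\<close>
  have "\<exists>w. w \<noteq> 0 \<and> (\<exists>\<mu>. \<bar>\<mu>\<bar> > 1 \<and> \<gamma> *v w = \<mu> *s w)" using eig[OF x12(1)] x1 by blast
  from someI_ex[OF this] obtain m1 where U: "U \<noteq> 0" "\<bar>m1\<bar> > 1" "\<gamma> *v U = m1 *s U" unfolding U_def attracting_def by blast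
  have "\<exists>w. w \<noteq> 0 \<and> (\<exists>\<mu>. \<bar>\<mu>\<bar> < 1 \<and> \<gamma> *v w = \<mu> *s w)" using eig[OF x12(2)] x2 by blast
  from someI_ex[OF this] obtain m2 where u: "u \<noteq> 0" "\<bar>m2\<bar> < 1" "\<gamma> *v u = m2 *s u" unfolding u_def repelling_def by blast
  define D where "D = U$1 * u$2 - u$1 * U$2"
  have eqs: "a * U$1 + b * U$2 = m1 * U$1" "c * U$1 + d * U$2 = m1 * U$2" "a * u$1 + b * u$2 = m2 * u$1" "c * u$1 + d * u$2 = m2 * u$2"
    using U(3) u(3) by (simp_all add: g vec_eq_iff forall_2 matrix_vector_mult_def sum_2)
  have D: "D \<noteq> 0"
  proof
    assume "D = 0"
    then have par: "u$2 *s U = U$2 *s u" "u$1 *s U = U$1 *s u" by (simp_all add: D_def vec_eq_iff forall_2 mult.commute)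
    have key: "y = 0" if "x *s U = y *s u" for x y
    proof -
      have "\<gamma> *v (x *s U) = \<gamma> *v (y *s u)" using that by simp
      then have "m1 *s (x *s U) = m2 *s (y *s u)" by (simp add: vector_scalar_commute U u vector_smult_assoc mult.commute)
      then have "(m1 - m2) *s (y *s u) = 0" unfolding that by (auto simp: vector_sub_rdistrib)
      moreover have "m1 - m2 \<noteq> 0" using U(2) u(2) by auto
      ultimately show "y = 0" using u(1) by (simp add: vector_mul_eq_0)
    qed
    have "U = 0" using key[OF par(1)] key[OF par(2)] by (simp add: vec_eq_iff forall_2)
    then show False using U by simp
  qed
  \<comment> \<open>Dividing one column by \<open>D\<close> gives determinant 1 and absorbs the
    numerator of \<open>theta\<close>.\<close>
  define M where "M = mat2 (U$1 / D) (u$1) (U$2 / D) (u$2)"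
  have "det M = (U$1 * u$2 - u$1 * U$2) / D" by (simp add: M_def det_mat2 diff_divide_distrib)
  then have dM: "det M = 1" using D by (simp add: D_def)
  have gM: "\<gamma> ** M = M ** mat2 m1 0 0 m2"
    unfolding g M_def mat2_mult mat2_eq_iff using eqs by (simp add: mult.commute flip: add_divide_distrib)
  have "det (\<gamma> ** M) = det (M ** mat2 m1 0 0 m2)" using gM by simp
  then have "m1 * m2 = 1" by (simp add: det_mul det dM det_mat2)
  then have m2: "m2 = 1 / m1" by (metis mult_zero_left nonzero_mult_div_cancel_left zero_neq_one)
  have th: "theta \<gamma> z = thM M z" for z
  proof -
    have "of_real (U$2 / D) * z - of_real (U$1 / D) = (of_real (U$2) * z - of_real (U$1)) / of_real D"
      by (simp add: diff_divide_distrib)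
    then show ?thesis unfolding M_def thM_mat2 theta_def Let_def U_def[symmetric] u_def[symmetric] D_def[symmetric] hlin_def
      using D by (simp add: mult.commute)
  qed
  show ?thesis using that[OF dM U(2) gM[unfolded m2] th] .
qed

section \<open>The relative Poincare series\<close>

lemma group_SL: "group (SL :: (real^2^2) monoid)"
proof (rule groupI)
  fix x y z :: "real^2^2"
  assume "x \<in> carrier SL" "y \<in> carrier SL" "z \<in> carrier SL"
  then show "x \<otimes>\<^bsub>SL\<^esub> y \<in> carrier SL" "x \<otimes>\<^bsub>SL\<^esub> y \<otimes>\<^bsub>SL\<^esub> z = x \<otimes>\<^bsub>SL\<^esub> (y \<otimes>\<^bsub>SL\<^esub> z)" "\<one>\<^bsub>SL\<^esub> \<otimes>\<^bsub>SL\<^esub> x = x"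
    by (simp_all add: SL_def det_mul matrix_mul_assoc)
next
  fix x :: "real^2^2" assume "x \<in> carrier SL"
  then have "inv2 x \<in> carrier SL" "inv2 x \<otimes>\<^bsub>SL\<^esub> x = \<one>\<^bsub>SL\<^esub>" by (simp_all add: SL_def inv2_inverse)
  then show "\<exists>y\<in>carrier SL. y \<otimes>\<^bsub>SL\<^esub> x = \<one>\<^bsub>SL\<^esub>" by blast
qed (simp add: SL_def)

lemma SL_mult: "x \<otimes>\<^bsub>SL\<^esub> y = x ** y"
  by (simp add: SL_def)

locale surface =
  fixes \<Gamma> :: "(real^2^2) set"
  assumes surface: "closed_hyperbolic_surface \<Gamma>"
begin

lemma subgroup_Gamma: "subgroup \<Gamma> SL" and minus_one_Gamma: "- mat 1 \<in> \<Gamma>"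
  using surface by (simp_all add: closed_hyperbolic_surface_def)

lemma proper: "compact K \<Longrightarrow> K \<subseteq> upper_half \<Longrightarrow> finite {g\<in>\<Gamma>. mob g ` K \<inter> K \<noteq> {}}"
  using surface by (simp add: closed_hyperbolic_surface_def)

sublocale G: group "grp \<Gamma>"
  using subgroup.subgroup_is_group[OF subgroup_Gamma group_SL] .

lemma grp_simps [simp]: "carrier (grp \<Gamma>) = \<Gamma>" "x \<otimes>\<^bsub>grp \<Gamma>\<^esub> y = x ** y" "\<one>\<^bsub>grp \<Gamma>\<^esub> = mat 1"
  by (simp_all add: SL_def)

lemma det_Gamma: "g \<in> \<Gamma> \<Longrightarrow> det g = 1"
  using subgroup.subset[OF subgroup_Gamma] by (auto simp: SL_def)

lemma inv_grp: "g \<in> \<Gamma> \<Longrightarrow> inv\<^bsub>grp \<Gamma>\<^esub> g = inv2 g"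
proof -
  assume g: "g \<in> \<Gamma>"
  have "inv\<^bsub>grp \<Gamma>\<^esub> g ** g = mat 1" using G.l_inv[of g] g by (simp add: SL_mult)
  then have "inv\<^bsub>grp \<Gamma>\<^esub> g ** (g ** inv2 g) = inv2 g" by (simp add: matrix_mul_assoc)
  then show ?thesis by (simp add: inv2_inverse[OF det_Gamma[OF g]])
qed

lemma inv2_Gamma: "g \<in> \<Gamma> \<Longrightarrow> inv2 g \<in> \<Gamma>"
  using G.inv_closed[of g] by (simp add: inv_grp)

lemma mult_Gamma: "g \<in> \<Gamma> \<Longrightarrow> h \<in> \<Gamma> \<Longrightarrow> g ** h \<in> \<Gamma>"
  using G.m_closed[of g h] by (simp add: SL_mult)

end

locale hyperbolic_element = surface +
  fixes \<gamma> M :: "real^2^2" and \<mu> :: real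
  assumes gamma: "\<gamma> \<in> \<Gamma>" and det_M: "det M = 1" and mu: "\<bar>\<mu>\<bar> > 1"
    and gamma_M: "\<gamma> ** M = M ** mat2 \<mu> 0 0 (1 / \<mu>)" and theta: "\<And>z. theta \<gamma> z = thM M z"
begin

definition cosets :: "(real^2^2) set set" where
  "cosets = rcosets\<^bsub>grp \<Gamma>\<^esub> (stab \<Gamma> \<gamma>)"

definition len :: real where
  "len = 2 * ln \<bar>\<mu>\<bar>"

lemma len_pos: "len > 0"
  using mu by (simp add: len_def)

lemma mu_ne_0: "\<mu> \<noteq> 0"
  using mu by auto

lemma stab_subgroup: "subgroup (stab \<Gamma> \<gamma>) (grp \<Gamma>)"
  unfolding stab_def using gamma minus_one_Gamma by (intro G.generate_is_subgroup) auto

lemma stab_subset: "stab \<Gamma> \<gamma> \<subseteq> \<Gamma>"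
  using subgroup.subset[OF stab_subgroup] by simp

text \<open>One matrix \<open>M\<close> diagonalises the whole subgroup, as it does so for the
  generators; for \<open>- mat 1\<close> the eigenvalue is x = -1.\<close>

lemma stab_diag:
  assumes "\<sigma> \<in> stab \<Gamma> \<gamma>"
  obtains x where "x \<noteq> 0" "\<sigma> ** M = M ** mat2 x 0 0 (1 / x)"
proof -
  have inverse: "\<exists>y. y \<noteq> 0 \<and> inv2 \<sigma> ** M = M ** mat2 y 0 0 (1 / y)"
    if "\<sigma> \<in> \<Gamma>" "x \<noteq> 0" "\<sigma> ** M = M ** mat2 x 0 0 (1 / x)" for \<sigma> x
  proof -
    have "mat2 x 0 0 (1 / x) ** mat2 (1 / x) 0 0 (1 / (1 / x)) = mat 1" using that by (simp add: mat2_mult mat2_one)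
    then have "inv2 \<sigma> ** M = inv2 \<sigma> ** (M ** mat2 x 0 0 (1 / x)) ** mat2 (1 / x) 0 0 (1 / (1 / x))"
      by (simp flip: matrix_mul_assoc)
    also have "\<dots> = (inv2 \<sigma> ** \<sigma>) ** M ** mat2 (1 / x) 0 0 (1 / (1 / x))" unfolding that(3)[symmetric] by (simp only: matrix_mul_assoc)
    also have "\<dots> = M ** mat2 (1 / x) 0 0 (1 / (1 / x))" by (simp add: inv2_inverse[OF det_Gamma[OF that(1)]])
    finally show ?thesis using that(2) by (intro exI[of _ "1 / x"]) simp
  qed
  have minus: "(- mat 1) ** M = M ** mat2 (-1) 0 0 (1 / (-1))"
  proof -
    have "mat2 (-1) 0 0 (1 / (-1)) = (- mat 1 :: real^2^2)" by (simp add: vec_eq_iff forall_2 mat_def)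
    then show ?thesis by (simp add: vec_eq_iff matrix_mult_nth mat_def if_distrib[of "\<lambda>x. x * _"] if_distrib[of "\<lambda>x. _ * x"] if_distrib[of uminus] cong: if_cong)
  qed
  have gen: "\<exists>x. x \<noteq> 0 \<and> h ** M = M ** mat2 x 0 0 (1 / x)" if "h \<in> {- mat 1, \<gamma>}" for h
  proof (cases "h = \<gamma>")
    case True
    then show ?thesis using gamma_M mu_ne_0 by blast
  next
    case False
    with that have "h = - mat 1" by simp
    then show ?thesis using minus by (intro exI[of _ "-1"]) simp
  qed
  have "\<exists>x. x \<noteq> 0 \<and> \<sigma> ** M = M ** mat2 x 0 0 (1 / x)"
    using assms unfolding stab_def
  proof (induction rule: generate.induct)
    case one
    show ?case by (intro exI[of _ 1]) (simp flip: mat2_one)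
  next
    case (incl h)
    then show ?case by (rule gen)
  next
    case (inv h)
    then have "h \<in> \<Gamma>" using gamma minus_one_Gamma by auto
    with gen[OF inv] obtain x where "x \<noteq> 0" "h ** M = M ** mat2 x 0 0 (1 / x)" by blast
    from inverse[OF \<open>h \<in> \<Gamma>\<close> this] show ?case unfolding inv_grp[OF \<open>h \<in> \<Gamma>\<close>] .
  next
    case (eng h1 h2)
    then obtain x y where x: "x \<noteq> 0" "h1 ** M = M ** mat2 x 0 0 (1 / x)" and y: "y \<noteq> 0" "h2 ** M = M ** mat2 y 0 0 (1 / y)" by blast
    have "h1 ** h2 ** M = h1 ** M ** mat2 y 0 0 (1 / y)" unfolding matrix_mul_assoc[symmetric] y(2) ..
    also have "\<dots> = M ** (mat2 x 0 0 (1 / x) ** mat2 y 0 0 (1 / y))" unfolding x(2) by (simp only: matrix_mul_assoc)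
    also have "mat2 x 0 0 (1 / x) ** mat2 y 0 0 (1 / y) = mat2 (x * y) 0 0 (1 / (x * y))" by (simp add: mat2_mult)
    finally show ?case using x(1) y(1) by (intro exI[of _ "x * y"]) (simp add: SL_mult)
  qed
  then show ?thesis using that by blast
qed

lemma stab_power:
  obtains \<sigma> where "\<sigma> \<in> stab \<Gamma> \<gamma>" "\<sigma> ** M = M ** mat2 (\<mu> powi m) 0 0 (1 / \<mu> powi m)"
proof -
  have g: "\<gamma> \<in> stab \<Gamma> \<gamma>" unfolding stab_def by (rule generate.incl) simp
  have nat: "\<exists>\<sigma>\<in>stab \<Gamma> \<gamma>. \<sigma> ** M = M ** mat2 (\<mu> ^ n) 0 0 (1 / \<mu> ^ n)" for n
  proof (induction n)
    case 0
    show ?case using subgroup.one_closed[OF stab_subgroup] by (intro bexI[of _ "mat 1"]) (simp_all flip: mat2_one)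
  next
    case (Suc n)
    then obtain \<sigma> where s: "\<sigma> \<in> stab \<Gamma> \<gamma>" "\<sigma> ** M = M ** mat2 (\<mu> ^ n) 0 0 (1 / \<mu> ^ n)" by blast
    have "\<gamma> ** \<sigma> ** M = \<gamma> ** M ** mat2 (\<mu> ^ n) 0 0 (1 / \<mu> ^ n)" unfolding matrix_mul_assoc[symmetric] s(2) ..
    also have "\<dots> = M ** mat2 (\<mu> ^ Suc n) 0 0 (1 / \<mu> ^ Suc n)" unfolding gamma_M matrix_mul_assoc[symmetric] by (simp add: mat2_mult)
    finally show ?case using subgroup.m_closed[OF stab_subgroup g s(1)] by (auto simp: SL_mult)
  qed
  show ?thesis
  proof (cases "m \<ge> 0")
    case True
    then obtain n where "m = int n" using nonneg_int_cases by blast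
    then show ?thesis using nat[of n] that by auto
  next
    case False
    then obtain n where m: "m = - int n" by (metis int_cases4 not_le of_nat_0_le_iff)
    obtain \<sigma> where s: "\<sigma> \<in> stab \<Gamma> \<gamma>" "\<sigma> ** M = M ** mat2 (\<mu> ^ n) 0 0 (1 / \<mu> ^ n)" using nat by blast
    have "\<sigma> \<in> \<Gamma>" using s stab_subset by blast
    then have "inv2 \<sigma> \<in> stab \<Gamma> \<gamma>" using subgroup.m_inv_closed[OF stab_subgroup s(1)] inv_grp by simp
    moreover have "inv2 \<sigma> ** M = M ** mat2 (\<mu> powi m) 0 0 (1 / \<mu> powi m)"
    proof -
      have "mat2 (\<mu> ^ n) 0 0 (1 / \<mu> ^ n) ** mat2 (1 / \<mu> ^ n) 0 0 (\<mu> ^ n) = mat 1" using mu_ne_0 by (simp add: mat2_mult mat2_one)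
      then have "inv2 \<sigma> ** M = inv2 \<sigma> ** (M ** mat2 (\<mu> ^ n) 0 0 (1 / \<mu> ^ n)) ** mat2 (1 / \<mu> ^ n) 0 0 (\<mu> ^ n)"
        by (simp flip: matrix_mul_assoc)
      also have "\<dots> = (inv2 \<sigma> ** \<sigma>) ** M ** mat2 (1 / \<mu> ^ n) 0 0 (\<mu> ^ n)" unfolding s(2)[symmetric] by (simp only: matrix_mul_assoc)
      also have "\<dots> = M ** mat2 (1 / \<mu> ^ n) 0 0 (\<mu> ^ n)" by (simp add: inv2_inverse[OF det_Gamma[OF \<open>\<sigma> \<in> \<Gamma>\<close>]])
      finally show ?thesis unfolding m by (simp add: power_int_minus inverse_eq_divide)
    qed
    ultimately show ?thesis using that by blast
  qed
qed

text \<open>The representative that occurs in \<open>Theta\<close>.\<close>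

definition rep :: "(real^2^2) set \<Rightarrow> real^2^2" where
  "rep C = (SOME \<eta>. \<eta> \<in> C)"

definition tt :: "(real^2^2) set \<Rightarrow> complex \<Rightarrow> complex" where
  "tt C z = thM (inv2 (rep C) ** M) z"

lemma cosets_cases:
  assumes "C \<in> cosets"
  obtains \<eta> where "\<eta> \<in> \<Gamma>" "C = stab \<Gamma> \<gamma> #>\<^bsub>grp \<Gamma>\<^esub> \<eta>"
  using assms unfolding cosets_def RCOSETS_def by auto

lemma coset_mem: "\<eta>' \<in> stab \<Gamma> \<gamma> #>\<^bsub>grp \<Gamma>\<^esub> \<eta> \<longleftrightarrow> (\<exists>\<sigma>\<in>stab \<Gamma> \<gamma>. \<eta>' = \<sigma> ** \<eta>)"
  by (auto simp: r_coset_def SL_mult)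

lemma coset_subset:
  assumes "C \<in> cosets"
  shows "C \<subseteq> \<Gamma>"
proof
  fix x assume x: "x \<in> C"
  obtain \<eta> where \<eta>: "\<eta> \<in> \<Gamma>" "C = stab \<Gamma> \<gamma> #>\<^bsub>grp \<Gamma>\<^esub> \<eta>" using cosets_cases[OF assms] .
  then obtain \<sigma> where "\<sigma> \<in> stab \<Gamma> \<gamma>" "x = \<sigma> ** \<eta>" using x coset_mem by blast
  then show "x \<in> \<Gamma>" using mult_Gamma stab_subset \<eta>(1) by blast
qed

lemma rep_mem:
  assumes "C \<in> cosets"
  shows "rep C \<in> C"
proof -
  obtain \<eta> where \<eta>: "\<eta> \<in> \<Gamma>" "C = stab \<Gamma> \<gamma> #>\<^bsub>grp \<Gamma>\<^esub> \<eta>" using cosets_cases[OF assms] .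
  then have "\<eta> \<in> C" using G.rcos_self[OF _ stab_subgroup] by simp
  then show ?thesis unfolding rep_def by (rule someI)
qed

lemma coset_mem_eq:
  assumes "C \<in> cosets" "\<eta> \<in> C"
  shows "C = stab \<Gamma> \<gamma> #>\<^bsub>grp \<Gamma>\<^esub> \<eta>"
proof -
  obtain \<eta>' where "\<eta>' \<in> \<Gamma>" "C = stab \<Gamma> \<gamma> #>\<^bsub>grp \<Gamma>\<^esub> \<eta>'" using cosets_cases[OF assms(1)] .
  then show ?thesis using G.repr_independence[of \<eta> "stab \<Gamma> \<gamma>" \<eta>'] assms stab_subgroup by simp
qed

lemma thM_stab:
  assumes "\<sigma> \<in> stab \<Gamma> \<gamma>"
  shows "thM (A ** inv2 \<sigma> ** M) z = thM (A ** M) z"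
proof -
  have s: "\<sigma> \<in> \<Gamma>" using assms stab_subset by blast
  have "inv2 \<sigma> \<in> stab \<Gamma> \<gamma>" using subgroup.m_inv_closed[OF stab_subgroup assms] inv_grp[OF s] by simp
  from stab_diag[OF this] obtain x where x: "x \<noteq> 0" "inv2 \<sigma> ** M = M ** mat2 x 0 0 (1 / x)" .
  have "A ** inv2 \<sigma> ** M = A ** M ** mat2 x 0 0 (1 / x)" unfolding matrix_mul_assoc[symmetric] x(2) ..
  then show ?thesis using thM_scale[OF x(1)] by simp
qed

lemma tt_eq:
  assumes "C \<in> cosets" "\<eta> \<in> C"
  shows "tt C z = thM (inv2 \<eta> ** M) z"
proof -
  obtain \<sigma> where s: "\<sigma> \<in> stab \<Gamma> \<gamma>" "rep C = \<sigma> ** \<eta>"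
    using rep_mem[OF assms(1)] coset_mem_eq[OF assms] coset_mem by blast
  show ?thesis unfolding tt_def s(2) inv2_mult using thM_stab[OF s(1)] by simp
qed

lemma det_inv2_M: "\<eta> \<in> \<Gamma> \<Longrightarrow> det (inv2 \<eta> ** M) = 1"
  by (simp add: det_mul det_M det_Gamma)

lemma Theta_eq:
  assumes "Im z > 0"
  shows "Theta \<Gamma> k \<gamma> z = (\<Sum>\<^sub>\<infinity>C\<in>cosets. tt C z ^ k)"
  unfolding Theta_def cosets_def[symmetric]
proof (rule infsum_cong)
  fix C assume C: "C \<in> cosets"
  have "rep C \<in> \<Gamma>" using rep_mem[OF C] coset_subset[OF C] by blast
  from thM_pullback[OF det_Gamma[OF this] assms, of M]
  show "pullback k (SOME \<eta>. \<eta> \<in> C) (\<lambda>w. theta \<gamma> w ^ k) z = tt C z ^ k"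
    unfolding rep_def[symmetric] pullback_def theta tt_def by (simp flip: power_mult_distrib)
qed

text \<open>In the coordinate \<open>logc M\<close> a power of \<gamma> is a translation by a
  multiple of \<open>len\<close>, so the image of \<open>\<i>\<close> can be moved into a strip of
  this width.\<close>

lemma coset_normalised_rep:
  assumes "C \<in> cosets"
  shows "\<exists>\<eta>\<in>C. 0 \<le> Re (logc M (mob \<eta> \<i>)) \<and> Re (logc M (mob \<eta> \<i>)) \<le> len"
proof -
  define \<eta> where "\<eta> = rep C"
  have e: "\<eta> \<in> C" "\<eta> \<in> \<Gamma>" using rep_mem[OF assms] coset_subset[OF assms] by (auto simp: \<eta>_def)
  define x where "x = Re (logc M (mob \<eta> \<i>))"
  define m where "m = - \<lfloor>x / len\<rfloor>"
  obtain \<sigma> where s: "\<sigma> \<in> stab \<Gamma> \<gamma>" "\<sigma> ** M = M ** mat2 (\<mu> powi m) 0 0 (1 / \<mu> powi m)" by (rule stab_power)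
  have "\<sigma> \<in> \<Gamma>" using s stab_subset by blast
  have w: "Im (mob \<eta> \<i>) > 0" using Im_mob(2)[OF det_Gamma[OF e(2)], of \<i>] by simp
  have "logc M (mob (\<sigma> ** \<eta>) \<i>) = logc M (mob \<eta> \<i>) + of_real (2 * ln \<bar>\<mu> powi m\<bar>)"
    using logc_translate[OF det_M w det_Gamma[OF \<open>\<sigma> \<in> \<Gamma>\<close>] s(2)] mob_mult[OF det_Gamma[OF e(2)], of \<i> \<sigma>] mu_ne_0 by simp
  also have "2 * ln \<bar>\<mu> powi m\<bar> = of_int m * len"
  proof (cases "m \<ge> 0")
    case True
    then obtain n where m: "m = int n" using nonneg_int_cases by blast
    show ?thesis unfolding m using mu_ne_0 by (simp add: len_def power_abs ln_realpow)
  next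
    case False
    then obtain n where m: "m = - int n" by (metis int_cases4 not_le of_nat_0_le_iff)
    show ?thesis unfolding m using mu_ne_0 by (simp add: len_def power_int_minus power_abs ln_realpow ln_inverse)
  qed
  finally have "Re (logc M (mob (\<sigma> ** \<eta>) \<i>)) = x - of_int \<lfloor>x / len\<rfloor> * len" by (simp add: x_def m_def)
  moreover have "of_int \<lfloor>x / len\<rfloor> * len \<le> x" "x \<le> of_int \<lfloor>x / len\<rfloor> * len + len"
  proof -
    show "of_int \<lfloor>x / len\<rfloor> * len \<le> x" using floor_divide_lower[OF len_pos, of x] .
    show "x \<le> of_int \<lfloor>x / len\<rfloor> * len + len"
      using floor_divide_upper[OF len_pos, of x] by (simp add: distrib_right)
  qed
  moreover have "\<sigma> ** \<eta> \<in> C" using coset_mem_eq[OF assms e(1)] coset_mem s(1) by blast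
  ultimately show ?thesis by (intro bexI[of _ "\<sigma> ** \<eta>"]) auto
qed

text \<open>Summability follows by comparing areas: by Bloch's theorem the image of a fixed disc around \<open>\<i>\<close> under
  the chart of a coset contains a disc of radius proportional to \<open>\<bar>tt C \<i>\<bar>\<close>. As the representatives are
  normalised by \<open>stab\<close>, all images lie in a fixed rectangle, and proper discontinuity bounds the number of
  images through a point.\<close>

definition nrep :: "(real^2^2) set \<Rightarrow> real^2^2" where
  "nrep C = (SOME \<eta>. \<eta> \<in> C \<and> 0 \<le> Re (logc M (mob \<eta> \<i>)) \<and> Re (logc M (mob \<eta> \<i>)) \<le> len)"

lemma nrep:
  assumes "C \<in> cosets"
  shows "nrep C \<in> C" "nrep C \<in> \<Gamma>" "0 \<le> Re (logc M (mob (nrep C) \<i>))" "Re (logc M (mob (nrep C) \<i>)) \<le> len"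
proof -
  have "\<exists>\<eta>. \<eta> \<in> C \<and> 0 \<le> Re (logc M (mob \<eta> \<i>)) \<and> Re (logc M (mob \<eta> \<i>)) \<le> len"
    using coset_normalised_rep[OF assms] by blast
  from someI_ex[OF this, folded nrep_def]
  show *: "nrep C \<in> C" "0 \<le> Re (logc M (mob (nrep C) \<i>))" "Re (logc M (mob (nrep C) \<i>)) \<le> len" by blast+
  show "nrep C \<in> \<Gamma>" using *(1) coset_subset[OF assms] by blast
qed

definition chart :: "(real^2^2) set \<Rightarrow> complex \<Rightarrow> complex" where
  "chart C z = logc M (mob (nrep C) z)"

lemma chart_has_field_derivative:
  assumes "C \<in> cosets" "Im z > 0"
  shows "(chart C has_field_derivative - tt C z) (at z)"
proof -
  have d: "det (nrep C) = 1" using nrep(2)[OF assms(1)] det_Gamma by blast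
  have "((\<lambda>z. logc M (mob (nrep C) z)) has_field_derivative (- thM M (mob (nrep C) z)) * (1 / (autf (nrep C) z)\<^sup>2)) (at z)"
    by (rule DERIV_chain2[OF logc_has_field_derivative[OF det_M Im_mob(2)[OF d assms(2)]] mob_has_field_derivative[OF d assms(2)]])
  moreover have "(- thM M (mob (nrep C) z)) * (1 / (autf (nrep C) z)\<^sup>2) = - tt C z"
    unfolding tt_eq[OF assms(1) nrep(1)[OF assms(1)]] thM_pullback[OF d assms(2), symmetric] by simp
  ultimately show ?thesis by (simp add: chart_def[abs_def])
qed

lemma norm_tt_le:
  assumes "C \<in> cosets" "Im z > 0"
  shows "norm (tt C z) \<le> (1 + (1 + norm z) / Im z)\<^sup>2 * norm (tt C \<i>)" "norm (tt C z) * Im z \<le> 1"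
  using norm_thM_le[OF det_inv2_M[OF nrep(2)[OF assms(1)]] assms(2)]
  unfolding tt_eq[OF assms(1) nrep(1)[OF assms(1)]] by blast+

lemma half_ball:
  assumes "z \<in> cball \<i> (1/2)"
  shows "Im z \<ge> 1/2"
  using assms abs_Im_le_cmod[of "\<i> - z"] by (simp add: dist_norm)

text \<open>Since \<open>Im z \<ge> 1/2\<close> on the disc, the derivative is at most 2 there, so
  the real part moves by at most 1 from its normalised value at the centre. The imaginary part is
  confined by the strip.\<close>

lemma chart_image:
  assumes "C \<in> cosets"
  shows "chart C ` ball \<i> (1/2) \<subseteq> cbox (Complex (-1) 0) (Complex (len + 1) pi)"
proof
  fix p assume "p \<in> chart C ` ball \<i> (1/2)"
  then obtain z where z: "z \<in> ball \<i> (1/2)" "p = chart C z" by blast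
  have I: "Im w \<ge> 1/2" if "w \<in> ball \<i> (1/2)" for w using half_ball[of w] that by auto
  have "norm (chart C z - chart C \<i>) \<le> 2 * norm (z - \<i>)"
  proof (rule field_differentiable_bound[of "ball \<i> (1/2)"])
    fix w :: complex assume w: "w \<in> ball \<i> (1/2)"
    have Iw: "Im w \<ge> 1/2" by (rule I[OF w])
    then have "Im w > 0" by simp
    then show "(chart C has_field_derivative - tt C w) (at w within ball \<i> (1/2))"
      by (rule has_field_derivative_at_within[OF chart_has_field_derivative[OF assms]])
    have "norm (tt C w) * (1/2) \<le> norm (tt C w) * Im w" using Iw by (intro mult_left_mono) auto
    also have "\<dots> \<le> 1" using norm_tt_le(2)[OF assms] Iw by simp
    finally show "norm (- tt C w) \<le> 2" by simp
  qed (use z in auto)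
  also have "\<dots> \<le> 1" using z(1) by (simp add: dist_norm norm_minus_commute)
  finally have "\<bar>Re (chart C z) - Re (chart C \<i>)\<bar> \<le> 1"
    using abs_Re_le_cmod[of "chart C z - chart C \<i>"] by simp
  moreover have "0 \<le> Re (chart C \<i>)" "Re (chart C \<i>) \<le> len" using nrep(3,4)[OF assms] by (simp_all add: chart_def)
  moreover have "0 < Im (chart C z)" "Im (chart C z) < pi"
    unfolding chart_def using logc_Im[OF det_M Im_mob(2)[OF det_Gamma[OF nrep(2)[OF assms]]]] I[OF z(1)] by auto
  ultimately show "p \<in> cbox (Complex (-1) 0) (Complex (len + 1) pi)"
    unfolding z(2) in_cbox_complex_iff by (simp add: abs_le_iff)
qed

lemma chart_overlap:
  obtains N where "\<And>Y p. finite Y \<Longrightarrow> Y \<subseteq> cosets \<Longrightarrow> card {C\<in>Y. p \<in> chart C ` ball \<i> (1/2)} \<le> N"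
proof -
  let ?K = "cball \<i> (1/2)"
  define S where "S = {g\<in>\<Gamma>. mob g ` ?K \<inter> ?K \<noteq> {}}"
  have K: "?K \<subseteq> upper_half"
  proof
    fix z :: complex assume "z \<in> ?K"
    then show "z \<in> upper_half" using half_ball[of z] by (simp add: upper_half_def)
  qed
  have fin: "finite S" unfolding S_def by (rule proper[OF compact_cball K])
  have "card {C\<in>Y. p \<in> chart C ` ball \<i> (1/2)} \<le> card S" if Y: "finite Y" "Y \<subseteq> cosets" for Y p
  proof (cases "{C\<in>Y. p \<in> chart C ` ball \<i> (1/2)} = {}")
    case False
    then obtain C0 where C0: "C0 \<in> Y" "p \<in> chart C0 ` ball \<i> (1/2)" by blast
    then obtain z0 where z0: "z0 \<in> ball \<i> (1/2)" "p = chart C0 z0" by blast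
    have C0': "C0 \<in> cosets" using C0 Y by blast
    \<comment> \<open>If the charts of C and C0 take the value \<open>p\<close> at z and z0,
      injectivity of \<open>logc\<close> shows that \<open>?F C\<close> maps z to z0. So it is one
      of the finitely many elements that carry some point of the closed disc into the disc.\<close>
    let ?F = "\<lambda>C. inv2 (nrep C0) ** nrep C"
    show ?thesis
    proof (rule card_inj_on_le[OF _ _ fin])
      show "inj_on ?F {C\<in>Y. p \<in> chart C ` ball \<i> (1/2)}"
      proof (rule inj_onI)
        fix C C' assume CC: "C \<in> {C\<in>Y. p \<in> chart C ` ball \<i> (1/2)}" "C' \<in> {C\<in>Y. p \<in> chart C ` ball \<i> (1/2)}" "?F C = ?F C'"
        then have "nrep C0 ** ?F C = nrep C0 ** ?F C'" by simp
        then have e: "nrep C = nrep C'" by (simp add: matrix_mul_assoc inv2_inverse[OF det_Gamma[OF nrep(2)[OF C0']]])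
        have c: "C \<in> cosets" "C' \<in> cosets" using CC Y by auto
        show "C = C'"
          using coset_mem_eq[OF c(1) nrep(1)[OF c(1)]] coset_mem_eq[OF c(2) nrep(1)[OF c(2)]] unfolding e by (simp only:)
      qed
      show "?F ` {C\<in>Y. p \<in> chart C ` ball \<i> (1/2)} \<subseteq> S"
      proof
        fix g assume "g \<in> ?F ` {C\<in>Y. p \<in> chart C ` ball \<i> (1/2)}"
        then obtain C z where C: "C \<in> Y" "g = ?F C" "z \<in> ball \<i> (1/2)" "p = chart C z" by blast
        have C': "C \<in> cosets" using C Y by blast
        have Iz: "Im z > 0" "Im z0 > 0" using half_ball[of z] half_ball[of z0] C(3) z0(1) by auto
        note dC = det_Gamma[OF nrep(2)[OF C']] and d0 = det_Gamma[OF nrep(2)[OF C0']]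
        have "mob (nrep C) z = mob (nrep C0) z0"
          using logc_inj[OF det_M Im_mob(2)[OF dC Iz(1)] Im_mob(2)[OF d0 Iz(2)]] C(4) z0(2) by (simp add: chart_def)
        then have "mob g z = z0"
          using mob_mult(1)[OF dC Iz(1), of "inv2 (nrep C0)"] mob_inverse(2)[OF d0 Iz(2)] by (simp add: C(2))
        moreover have "g \<in> \<Gamma>" unfolding C(2) using nrep(2) C' C0' by (intro mult_Gamma inv2_Gamma) auto
        ultimately show "g \<in> S" unfolding S_def using C(3) z0(1) by (auto intro!: image_eqI)
      qed
    qed
  qed (simp only: card.empty le0)
  then show ?thesis using that by blast
qed

lemma summable_norm_tt_square: "(\<lambda>C. (norm (tt C \<i>))\<^sup>2) summable_on cosets"
proof -
  obtain N where N: "\<And>Y p. finite Y \<Longrightarrow> Y \<subseteq> cosets \<Longrightarrow> card {C\<in>Y. p \<in> chart C ` ball \<i> (1/2)} \<le> N"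
    using chart_overlap by blast
  let ?R = "cbox (Complex (-1) 0) (Complex (len + 1) pi)"
  \<comment> \<open>Bloch's theorem on a disc of radius 1/2 with the constant 1/12.\<close>
  define \<rho> where "\<rho> C = norm (tt C \<i>) / 24" for C
  have "\<exists>b. ball b (\<rho> C) \<subseteq> chart C ` ball \<i> (1/2)" if C: "C \<in> cosets" for C
  proof -
    have hol: "chart C holomorphic_on ball \<i> (1/2)"
    proof (rule holomorphic_onI)
      fix z :: complex assume "z \<in> ball \<i> (1/2)"
      then have "Im z > 0" using half_ball[of z] by auto
      then show "chart C field_differentiable at z within ball \<i> (1/2)"
        using chart_has_field_derivative[OF C] field_differentiable_def field_differentiable_at_within by blast
    qed
    have "deriv (chart C) \<i> = - tt C \<i>" by (rule DERIV_imp_deriv) (simp add: chart_has_field_derivative[OF C])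
    then have "\<rho> C \<le> 1 / 2 * norm (deriv (chart C) \<i>) / 12" by (simp add: \<rho>_def)
    from Bloch[OF hol _ this] show ?thesis by (metis half_gt_zero_iff zero_less_one)
  qed
  then have "\<forall>C. \<exists>b. C \<in> cosets \<longrightarrow> ball b (\<rho> C) \<subseteq> chart C ` ball \<i> (1/2)" by blast
  from choice[OF this] obtain b where b: "\<And>C. C \<in> cosets \<Longrightarrow> ball (b C) (\<rho> C) \<subseteq> chart C ` ball \<i> (1/2)" by blast
  have bound: "(\<Sum>C\<in>Y. (norm (tt C \<i>))\<^sup>2) \<le> 576 / pi * (N * measure lborel ?R)" if Y: "finite Y" "Y \<subseteq> cosets" for Y
  proof -
    \<comment> \<open>The area count: the discs lie in the rectangle and cover each of its points at
      most \<open>N\<close> times, so their total area is bounded independently of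
      \<open>Y\<close>.\<close>
    have "(\<Sum>C\<in>Y. measure lborel (ball (b C) (\<rho> C))) = (\<Sum>C\<in>Y. integral\<^sup>L lborel (indicator (ball (b C) (\<rho> C))))"
      by simp
    also have "\<dots> = integral\<^sup>L lborel (\<lambda>p. \<Sum>C\<in>Y. indicator (ball (b C) (\<rho> C)) p)"
      by (rule Bochner_Integration.integral_sum[symmetric]) (auto intro!: integrable_real_indicator emeasure_lborel_ball_finite)
    also have "\<dots> \<le> integral\<^sup>L lborel (\<lambda>p. real N * indicator ?R p)"
    proof (rule integral_mono)
      show "integrable lborel (\<lambda>p. \<Sum>C\<in>Y. indicator (ball (b C) (\<rho> C)) p :: real)"
        by (auto intro!: integrable_real_indicator emeasure_lborel_ball_finite)
      show "integrable lborel (\<lambda>p. real N * indicator ?R p)"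
        by (auto intro!: integrable_real_indicator emeasure_lborel_cbox_finite)
      fix p
      have "(\<Sum>C\<in>Y. indicator (ball (b C) (\<rho> C)) p :: real) = real (card {C\<in>Y. p \<in> ball (b C) (\<rho> C)})"
        unfolding indicator_def using Y(1) by (simp add: sum.If_cases Int_def of_bool_def)
      also have "\<dots> \<le> real (card {C\<in>Y. p \<in> chart C ` ball \<i> (1/2)})"
      proof -
        have "{C\<in>Y. p \<in> ball (b C) (\<rho> C)} \<subseteq> {C\<in>Y. p \<in> chart C ` ball \<i> (1/2)}" using b Y(2) by blast
        then show ?thesis using Y(1) by (intro of_nat_mono card_mono) auto
      qed
      also have "\<dots> \<le> real N * indicator ?R p"
      proof (cases "p \<in> ?R")
        case True
        then show ?thesis using N[OF Y] by simp
      next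
        case False
        then have "{C\<in>Y. p \<in> chart C ` ball \<i> (1/2)} = {}" using chart_image Y(2) by blast
        then show ?thesis by (simp only: card.empty) simp
      qed
      finally show "(\<Sum>C\<in>Y. indicator (ball (b C) (\<rho> C)) p) \<le> real N * indicator ?R p" .
    qed
    also have "\<dots> = real N * measure lborel ?R" by simp
    finally have "(\<Sum>C\<in>Y. measure lborel (ball (b C) (\<rho> C))) \<le> real N * measure lborel ?R" .
    moreover have "measure lborel (ball (b C) (\<rho> C)) = pi / 576 * (norm (tt C \<i>))\<^sup>2" for C
      by (subst content_ball) (simp_all add: \<rho>_def unit_ball_vol_2 power_divide)
    ultimately have "pi / 576 * (\<Sum>C\<in>Y. (norm (tt C \<i>))\<^sup>2) \<le> real N * measure lborel ?R"
      by (simp add: sum_distrib_left)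
    then have "576 / pi * (pi / 576 * (\<Sum>C\<in>Y. (norm (tt C \<i>))\<^sup>2)) \<le> 576 / pi * (real N * measure lborel ?R)"
      by (intro mult_left_mono) auto
    then show ?thesis by simp
  qed
  show ?thesis
    by (rule nonneg_bdd_above_summable_on) (auto intro!: bdd_aboveI2[of _ _ "576 / pi * (N * measure lborel ?R)"] bound)
qed

section \<open>Locally uniform convergence and holomorphy\<close>

lemma norm_tt_power_le:
  assumes "C \<in> cosets" "Im z > 0" "k \<ge> 2"
  shows "norm (tt C z ^ k) \<le> (1 + (1 + norm z) / Im z) ^ (2 * k) * (norm (tt C \<i>))\<^sup>2"
proof -
  \<comment> \<open>This lets squares dominate k-th powers for \<open>k \<ge> 2\<close>, so the
    single majorant from the area count serves all orders.\<close>
  have le1: "norm (tt C \<i>) \<le> 1" using norm_tt_le(2)[OF assms(1), of \<i>] by simp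
  have "norm (tt C z ^ k) \<le> ((1 + (1 + norm z) / Im z)\<^sup>2 * norm (tt C \<i>)) ^ k"
    unfolding norm_power by (intro power_mono norm_tt_le(1) assms) simp
  also have "\<dots> = (1 + (1 + norm z) / Im z) ^ (2 * k) * norm (tt C \<i>) ^ k"
    by (simp add: power_mult_distrib power_mult)
  also have "\<dots> \<le> (1 + (1 + norm z) / Im z) ^ (2 * k) * (norm (tt C \<i>))\<^sup>2"
    using assms le1 by (intro mult_left_mono power_decreasing zero_le_power) (auto intro!: add_nonneg_nonneg)
  finally show ?thesis .
qed

lemma Theta_uniform_limit:
  assumes "compact S" "\<And>z. z \<in> S \<Longrightarrow> Im z > 0" "k \<ge> 2"
  shows "uniform_limit S (\<lambda>Y z. \<Sum>C\<in>Y. tt C z ^ k) (Theta \<Gamma> k \<gamma>) (finite_subsets_at_top cosets)"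
    "\<exists>B. \<forall>z\<in>S. \<forall>C\<in>cosets. norm (tt C z ^ k) \<le> B * (norm (tt C \<i>))\<^sup>2"
proof -
  have "continuous_on S (\<lambda>z. (1 + (1 + norm z) / Im z) ^ (2 * k))"
    using assms(2) by (intro continuous_intros) force
  then have "compact ((\<lambda>z. (1 + (1 + norm z) / Im z) ^ (2 * k)) ` S)" by (rule compact_continuous_image[OF _ assms(1)])
  then have "bounded ((\<lambda>z. (1 + (1 + norm z) / Im z) ^ (2 * k)) ` S)" by (rule compact_imp_bounded)
  then obtain B where "\<forall>x\<in>(\<lambda>z. (1 + (1 + norm z) / Im z) ^ (2 * k)) ` S. \<bar>x\<bar> \<le> B" unfolding bounded_real by blast
  then have B: "\<And>z. z \<in> S \<Longrightarrow> (1 + (1 + norm z) / Im z) ^ (2 * k) \<le> B" by fastforce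
  have le: "norm (tt C z ^ k) \<le> B * (norm (tt C \<i>))\<^sup>2" if "C \<in> cosets" "z \<in> S" for C z
    using norm_tt_power_le[OF that(1) assms(2)[OF that(2)] assms(3)] B[OF that(2)]
    by (meson mult_right_mono order_trans zero_le_power2)
  then show "\<exists>B. \<forall>z\<in>S. \<forall>C\<in>cosets. norm (tt C z ^ k) \<le> B * (norm (tt C \<i>))\<^sup>2" by blast
  have "uniform_limit S (\<lambda>Y z. \<Sum>C\<in>Y. tt C z ^ k) (\<lambda>z. \<Sum>\<^sub>\<infinity>C\<in>cosets. tt C z ^ k) (finite_subsets_at_top cosets)"
    by (rule Weierstrass_m_test_general[OF le]) (auto intro!: summable_on_cmult_right summable_norm_tt_square)
  then show "uniform_limit S (\<lambda>Y z. \<Sum>C\<in>Y. tt C z ^ k) (Theta \<Gamma> k \<gamma>) (finite_subsets_at_top cosets)"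
    by (rule uniform_limit_cong[THEN iffD1, rotated -1]) (auto simp: Theta_eq assms)
qed

lemma tt_holomorphic: "C \<in> cosets \<Longrightarrow> (\<And>z. z \<in> S \<Longrightarrow> Im z > 0) \<Longrightarrow> (\<lambda>z. tt C z ^ k) holomorphic_on S"
proof -
  assume C: "C \<in> cosets" and S: "\<And>z. z \<in> S \<Longrightarrow> Im z > 0"
  have d: "det (inv2 (rep C) ** M) = 1" using rep_mem[OF C] coset_subset[OF C] det_inv2_M by blast
  obtain a b c d where e: "inv2 (rep C) ** M = mat2 a b c d" by (rule mat2_cases)
  show ?thesis unfolding tt_def e thM_mat2
    using thM_denom_ne_0[OF d[unfolded e] S] by (intro holomorphic_intros) auto
qed

lemma Theta_holomorphic:
  assumes "k \<ge> 2"
  shows "Theta \<Gamma> k \<gamma> holomorphic_on upper_half"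
proof (rule holomorphic_onI)
  fix z assume "z \<in> upper_half"
  moreover have op: "open upper_half" unfolding upper_half_def by (rule open_halfspace_Im_gt)
  ultimately obtain r where r: "r > 0" "cball z r \<subseteq> upper_half" using open_contains_cball by blast
  have I: "Im w > 0" if "w \<in> cball z r" for w using r that by (auto simp: upper_half_def)
  have ev: "\<forall>\<^sub>F Y in finite_subsets_at_top cosets. Y \<subseteq> cosets"
    by (rule eventually_finite_subsets_at_top_weakI) blast
  have "Theta \<Gamma> k \<gamma> holomorphic_on ball z r"
  proof (rule holomorphic_uniform_limit[where F = "finite_subsets_at_top cosets"])
    show "\<forall>\<^sub>F Y in finite_subsets_at_top cosets. continuous_on (cball z r) (\<lambda>z. \<Sum>C\<in>Y. tt C z ^ k) \<and> (\<lambda>z. \<Sum>C\<in>Y. tt C z ^ k) holomorphic_on ball z r"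
      using ev
    proof eventually_elim
      case (elim Y)
      have "(\<lambda>z. \<Sum>C\<in>Y. tt C z ^ k) holomorphic_on cball z r"
        using elim I by (intro holomorphic_on_sum tt_holomorphic) auto
      then show ?case using holomorphic_on_imp_continuous_on holomorphic_on_subset ball_subset_cball by blast
    qed
    show "uniform_limit (cball z r) (\<lambda>Y z. \<Sum>C\<in>Y. tt C z ^ k) (Theta \<Gamma> k \<gamma>) (finite_subsets_at_top cosets)"
      by (rule Theta_uniform_limit(1)[OF compact_cball I assms])
  qed auto
  then have "Theta \<Gamma> k \<gamma> field_differentiable at z"
    using r(1) holomorphic_on_imp_differentiable_at[of _ "ball z r" z] by auto
  then show "Theta \<Gamma> k \<gamma> field_differentiable at z within upper_half" by (rule field_differentiable_at_within)
qed

section \<open>Automorphy\<close>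

lemma coset_mult_Gamma:
  assumes "C \<in> cosets" "g \<in> \<Gamma>"
  shows "C #>\<^bsub>grp \<Gamma>\<^esub> g \<in> cosets"
    and "\<eta> \<in> C \<Longrightarrow> \<eta> ** g \<in> C #>\<^bsub>grp \<Gamma>\<^esub> g"
    and "C #>\<^bsub>grp \<Gamma>\<^esub> g #>\<^bsub>grp \<Gamma>\<^esub> inv2 g = C"
proof -
  obtain \<eta> where \<eta>: "\<eta> \<in> \<Gamma>" "C = stab \<Gamma> \<gamma> #>\<^bsub>grp \<Gamma>\<^esub> \<eta>" using cosets_cases[OF assms(1)] .
  have sub: "stab \<Gamma> \<gamma> \<subseteq> carrier (grp \<Gamma>)" using stab_subset by simp
  have e: "C #>\<^bsub>grp \<Gamma>\<^esub> g = stab \<Gamma> \<gamma> #>\<^bsub>grp \<Gamma>\<^esub> (\<eta> ** g)"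
    unfolding \<eta>(2) using G.coset_mult_assoc[OF sub, of \<eta> g] \<eta>(1) assms(2) by (simp add: SL_mult)
  show "C #>\<^bsub>grp \<Gamma>\<^esub> g \<in> cosets"
    unfolding e cosets_def using G.rcosetsI[OF sub] mult_Gamma[OF \<eta>(1) assms(2)] by simp
  show "\<eta> ** g \<in> C #>\<^bsub>grp \<Gamma>\<^esub> g" if "\<eta> \<in> C" for \<eta> using that by (auto simp: r_coset_def SL_mult)
  have "C #>\<^bsub>grp \<Gamma>\<^esub> g #>\<^bsub>grp \<Gamma>\<^esub> inv2 g = stab \<Gamma> \<gamma> #>\<^bsub>grp \<Gamma>\<^esub> (\<eta> ** g ** inv2 g)"
    unfolding e using G.coset_mult_assoc[OF sub, of "\<eta> ** g" "inv2 g"] \<eta>(1) assms(2) mult_Gamma inv2_Gamma by (simp add: SL_mult)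
  also have "\<eta> ** g ** inv2 g = \<eta>" by (simp add: inv2_inverse[OF det_Gamma[OF assms(2)]] flip: matrix_mul_assoc)
  finally show "C #>\<^bsub>grp \<Gamma>\<^esub> g #>\<^bsub>grp \<Gamma>\<^esub> inv2 g = C" using \<eta>(2) by simp
qed

lemma tt_mult:
  assumes "C \<in> cosets" "g \<in> \<Gamma>" "Im z > 0"
  shows "tt (C #>\<^bsub>grp \<Gamma>\<^esub> g) z = tt C (mob g z) * (1 / (autf g z)\<^sup>2)"
proof -
  have "tt (C #>\<^bsub>grp \<Gamma>\<^esub> g) z = thM (inv2 (rep C ** g) ** M) z"
    by (rule tt_eq[OF coset_mult_Gamma(1,2)[OF assms(1,2) ]]) (rule rep_mem[OF assms(1)])
  also have "\<dots> = tt C (mob g z) * (1 / (autf g z)\<^sup>2)"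
    unfolding tt_def thM_pullback[OF det_Gamma[OF assms(2)] assms(3)] inv2_mult by (simp add: matrix_mul_assoc)
  finally show ?thesis .
qed

lemma bij_betw_coset_mult:
  assumes "g \<in> \<Gamma>"
  shows "bij_betw (\<lambda>C. C #>\<^bsub>grp \<Gamma>\<^esub> g) cosets cosets"
proof (rule bij_betw_byWitness[where f' = "\<lambda>C. C #>\<^bsub>grp \<Gamma>\<^esub> inv2 g"])
  show "\<forall>C\<in>cosets. C #>\<^bsub>grp \<Gamma>\<^esub> g #>\<^bsub>grp \<Gamma>\<^esub> inv2 g = C" using coset_mult_Gamma(3)[OF _ assms] by blast
  show "\<forall>C\<in>cosets. C #>\<^bsub>grp \<Gamma>\<^esub> inv2 g #>\<^bsub>grp \<Gamma>\<^esub> g = C"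
    using coset_mult_Gamma(3)[OF _ inv2_Gamma[OF assms]] by simp
qed (use coset_mult_Gamma(1) assms inv2_Gamma in auto)

text \<open>Right multiplication by \<open>g\<close> permutes the cosets, and the pullback by
  \<open>g\<close> permutes the terms accordingly.\<close>

lemma Theta_automorphic:
  assumes "g \<in> \<Gamma>" "Im z > 0"
  shows "Theta \<Gamma> k \<gamma> (mob g z) * (1 / (autf g z)\<^sup>2) ^ k = Theta \<Gamma> k \<gamma> z"
proof -
  have "Theta \<Gamma> k \<gamma> z = (\<Sum>\<^sub>\<infinity>C\<in>cosets. tt (C #>\<^bsub>grp \<Gamma>\<^esub> g) z ^ k)"
    unfolding Theta_eq[OF assms(2)] by (rule infsum_reindex_bij_betw[OF bij_betw_coset_mult[OF assms(1)], symmetric])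
  also have "\<dots> = (\<Sum>\<^sub>\<infinity>C\<in>cosets. tt C (mob g z) ^ k * (1 / (autf g z)\<^sup>2) ^ k)"
    by (rule infsum_cong) (simp only: tt_mult assms power_mult_distrib)
  also have "\<dots> = (\<Sum>\<^sub>\<infinity>C\<in>cosets. tt C (mob g z) ^ k) * (1 / (autf g z)\<^sup>2) ^ k"
    by (rule infsum_cmult_left') 
  finally show ?thesis using Theta_eq[OF Im_mob(2)[OF det_Gamma[OF assms(1)] assms(2)]] by simp
qed

section \<open>Powers of the hyperbolic element\<close>

definition pw :: "int \<Rightarrow> real^2^2" where
  "pw m = M ** mat2 (\<mu> powi m) 0 0 (1 / \<mu> powi m) ** inv2 M"

lemma pw_M: "pw m ** M = M ** mat2 (\<mu> powi m) 0 0 (1 / \<mu> powi m)"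
  unfolding pw_def by (simp add: inv2_inverse[OF det_M] flip: matrix_mul_assoc)

lemma diag_unique:
  assumes "\<sigma> ** M = M ** X"
  shows "\<sigma> = M ** X ** inv2 M"
proof -
  have "\<sigma> = \<sigma> ** M ** inv2 M" by (simp add: inv2_inverse[OF det_M] flip: matrix_mul_assoc)
  then show ?thesis unfolding assms .
qed

lemma pw_stab: "pw m \<in> stab \<Gamma> \<gamma>"
proof -
  obtain \<sigma> where "\<sigma> \<in> stab \<Gamma> \<gamma>" "\<sigma> ** M = M ** mat2 (\<mu> powi m) 0 0 (1 / \<mu> powi m)" by (rule stab_power)
  then show ?thesis unfolding pw_def using diag_unique by metis
qed

lemma pw_Gamma: "pw m \<in> \<Gamma>"
  using pw_stab stab_subset by blast

lemma pw_add: "pw (m + n) = pw m ** pw n"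
proof -
  have "pw m ** pw n = pw m ** M ** mat2 (\<mu> powi n) 0 0 (1 / \<mu> powi n) ** inv2 M"
    unfolding pw_def[of n] by (simp only: matrix_mul_assoc)
  also have "\<dots> = M ** (mat2 (\<mu> powi m) 0 0 (1 / \<mu> powi m) ** mat2 (\<mu> powi n) 0 0 (1 / \<mu> powi n)) ** inv2 M"
    unfolding pw_M by (simp only: matrix_mul_assoc)
  also have "\<dots> = pw (m + n)" unfolding pw_def mat2_mult using mu_ne_0 by (simp add: power_int_add)
  finally show ?thesis ..
qed

lemma pw_0: "pw 0 = mat 1"
  unfolding pw_def by (simp add: inv2_inverse[OF det_M] flip: mat2_one)

lemma pw_1: "pw 1 = \<gamma>"
  unfolding pw_def using diag_unique[OF gamma_M] by simp

text \<open>Up to sign the subgroup consists of the powers of \<gamma>, so that sums over its cosets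
  can be indexed by integers.\<close>

lemma stab_eq_pw:
  assumes "\<sigma> \<in> stab \<Gamma> \<gamma>"
  shows "\<exists>m. \<sigma> = pw m \<or> \<sigma> = - mat 1 ** pw m"
  using assms unfolding stab_def
proof (induction rule: generate.induct)
  case one
  show ?case by (intro exI[of _ 0]) (simp add: pw_0)
next
  case (incl h)
  then show ?case using pw_1 by (metis insertE matrix_mul_rid pw_0 singletonD)
next
  case (inv h)
  have minus: "inv2 (- mat 1) = - mat 1 ** pw 0" by (simp add: inv2_minus pw_0)
  have "pw (-1) ** \<gamma> = mat 1" using pw_add[of "-1" 1] by (simp add: pw_0 pw_1)
  then have "pw (-1) ** (\<gamma> ** inv2 \<gamma>) = inv2 \<gamma>" by (simp add: matrix_mul_assoc)
  then have g: "inv2 \<gamma> = pw (-1)" by (simp add: inv2_inverse[OF det_Gamma[OF gamma]])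
  from inv have "h = - mat 1 \<or> h = \<gamma>" by blast
  then show ?case
  proof
    assume h: "h = - mat 1"
    show ?thesis unfolding h inv_grp[OF minus_one_Gamma] minus by blast
  next
    assume h: "h = \<gamma>"
    show ?thesis unfolding h inv_grp[OF gamma] g by blast
  qed
next
  case (eng h1 h2)
  from eng obtain m n where "h1 = pw m \<or> h1 = - mat 1 ** pw m" "h2 = pw n \<or> h2 = - mat 1 ** pw n" by blast
  then have "h1 ** h2 = pw (m + n) \<or> h1 ** h2 = - mat 1 ** pw (m + n)"
    unfolding pw_add by (elim disjE) (simp_all add: matrix_neg_left matrix_neg_right)
  then show ?case by (auto simp: SL_mult)
qed

lemma ln_abs_power_mu: "2 * ln \<bar>\<mu> powi m\<bar> = of_int m * len"
proof (cases "m \<ge> 0")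
  case True
  then obtain n where m: "m = int n" using nonneg_int_cases by blast
  show ?thesis unfolding m using mu_ne_0 by (simp add: len_def power_abs ln_realpow)
next
  case False
  then obtain n where m: "m = - int n" by (metis int_cases4 not_le of_nat_0_le_iff)
  show ?thesis unfolding m using mu_ne_0 by (simp add: len_def power_int_minus power_abs ln_realpow ln_inverse)
qed

lemma minus_one_stab: "- mat 1 \<in> stab \<Gamma> \<gamma>"
  unfolding stab_def by (rule generate.incl) simp

lemma coset_I: "\<eta> \<in> \<Gamma> \<Longrightarrow> stab \<Gamma> \<gamma> #>\<^bsub>grp \<Gamma>\<^esub> \<eta> \<in> cosets"
  unfolding cosets_def using G.rcosetsI[of "stab \<Gamma> \<gamma>" \<eta>] stab_subset by simp

lemma coset_self: "\<eta> \<in> \<Gamma> \<Longrightarrow> \<eta> \<in> stab \<Gamma> \<gamma> #>\<^bsub>grp \<Gamma>\<^esub> \<eta>"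
  using G.rcos_self[OF _ stab_subgroup] by simp

end

section \<open>Consequences of periodicity and summability for the kernel\<close>

lemma kern_minus: "kern (-a) (-b) (-c) (-d) t = kern a b c d t"
proof -
  have "complex_of_real (- c) * \<i> * of_real (exp t) - of_real (- a) = - (of_real c * \<i> * of_real (exp t) - of_real a)"
    "complex_of_real (- d) * \<i> * of_real (exp t) - of_real (- b) = - (of_real d * \<i> * of_real (exp t) - of_real b)" by simp_all
  then show ?thesis unfolding kern_def by (simp only: minus_mult_minus)
qed

text \<open>The lift of a hyperbolic element may have negative eigenvalues; only their absolute
  value enters, as the kernel does not see the sign of the matrix.\<close>

lemma kern_shift_abs:
  assumes "x \<noteq> 0"
  shows "kern (a / x) (b / x) (c * x) (d * x) t = kern a b c d (t + 2 * ln \<bar>x\<bar>)"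
proof (cases "x > 0")
  case True
  then show ?thesis using kern_shift[OF True] by simp
next
  case False
  then have "- x > 0" using assms by simp
  from kern_shift[OF this, of a b c d t] show ?thesis using False kern_minus[of "a / x" "b / x" "c * x" "d * x"] by simp
qed

text \<open>Unless the geodesic coincides with the axis up to orientation, the kernel decays at one
  end at least. Being nowhere zero, it cannot have periodic modulus.\<close>

lemma kern_not_periodic:
  assumes det: "a * d - b * c = 1" and nd: "\<not> (b = 0 \<and> c = 0)" "\<not> (a = 0 \<and> d = 0)"
    and T: "T > 0" and per: "\<And>t. norm (kern a b c d (t + T)) = norm (kern a b c d t)"
  shows False
proof -
  let ?g = "\<lambda>t. norm (kern a b c d t)"
  have nat: "?g (t + of_nat n * T) = ?g t" for t n
  proof (induction n)
    case (Suc n)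
    have "?g (t + of_nat (Suc n) * T) = ?g ((t + of_nat n * T) + T)" by (simp add: algebra_simps)
    then show ?case using per Suc by simp
  qed simp
  have pos: "?g 0 \<noteq> 0" using kern_ne_0[OF det] by simp
  have lin: "filterlim (\<lambda>n. of_nat n * T) at_top sequentially"
    using T by (intro filterlim_at_top_mult_tendsto_pos[OF tendsto_const] filterlim_real_sequentially) auto
  have nz: "(a \<noteq> 0 \<and> b \<noteq> 0) \<or> (c \<noteq> 0 \<and> d \<noteq> 0)" using nd det by auto
  then show False
  proof
    assume "c \<noteq> 0 \<and> d \<noteq> 0"
    then have "(?g \<longlongrightarrow> 0) at_top" using norm_kern_top by blast
    from filterlim_compose[OF this lin] have "(\<lambda>n::nat. ?g 0) \<longlonglongrightarrow> 0" using nat[of 0] by simp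
    then show False using pos by (simp add: tendsto_const_iff)
  next
    assume "a \<noteq> 0 \<and> b \<noteq> 0"
    then have "(?g \<longlongrightarrow> 0) at_bot" using norm_kern_bot by blast
    moreover have "filterlim (\<lambda>n. - (of_nat n * T)) at_bot sequentially" using lin by (simp add: filterlim_uminus_at_top)
    ultimately have "(\<lambda>n::nat. ?g (- (of_nat n * T))) \<longlonglongrightarrow> 0" by (rule filterlim_compose)
    moreover have "?g (- (of_nat n * T)) = ?g 0" for n using nat[of "- (of_nat n * T)" n] by simp
    ultimately show False using pos by (simp add: tendsto_const_iff)
  qed
qed

text \<open>A zero entry is a common end, where the modulus tends to 1 and the sum of squares
  diverges. This is the analytic form of the fact that discreteness forbids exactly one common
  end.\<close>

lemma kern_entries_ne_0:
  assumes det: "a * d - b * c = 1" and T: "T > 0"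
    and sum: "(\<lambda>m::int. (norm (kern a b c d (of_int m * T)))\<^sup>2) summable_on UNIV"
  shows "a \<noteq> 0" "b \<noteq> 0" "c \<noteq> 0" "d \<noteq> 0"
proof -
  let ?g = "\<lambda>t. norm (kern a b c d t)"
  have lin: "filterlim (\<lambda>n. of_nat n * T) at_top sequentially"
    using T by (intro filterlim_at_top_mult_tendsto_pos[OF tendsto_const] filterlim_real_sequentially) auto
  then have lin': "filterlim (\<lambda>n. - (of_nat n * T)) at_bot sequentially" by (simp add: filterlim_uminus_at_top)
  have key: "(\<lambda>n. ?g (of_int (h n) * T)) \<longlonglongrightarrow> 0" if "inj h" for h :: "nat \<Rightarrow> int"
  proof -
    have "(\<lambda>m::int. (?g (of_int m * T))\<^sup>2) summable_on range h" by (rule summable_on_subset_banach[OF sum]) simp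
    then have "((\<lambda>m::int. (?g (of_int m * T))\<^sup>2) \<circ> h) summable_on UNIV" using summable_on_reindex[OF that] by blast
    then have "summable (\<lambda>n. (?g (of_int (h n) * T))\<^sup>2)" by (simp add: o_def summable_on_imp_summable)
    then have "(\<lambda>n. (?g (of_int (h n) * T))\<^sup>2) \<longlonglongrightarrow> 0" by (rule summable_LIMSEQ_zero)
    from tendsto_real_sqrt[OF this] show ?thesis by simp
  qed
  have top: "(\<lambda>n. ?g (of_nat n * T)) \<longlonglongrightarrow> 0" using key[of int] by simp
  have bot: "(\<lambda>n. ?g (- (of_nat n * T))) \<longlonglongrightarrow> 0" using key[of "\<lambda>n. - int n"] by (simp add: inj_def)
  have False if "a = 0 \<or> b = 0"
    using LIMSEQ_unique[OF bot filterlim_compose[OF norm_kern_bot_1[OF that det] lin']] by simp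
  then show "a \<noteq> 0" "b \<noteq> 0" by blast+
  have False if "c = 0 \<or> d = 0"
    using LIMSEQ_unique[OF top filterlim_compose[OF norm_kern_top_1[OF that det] lin]] by simp
  then show "c \<noteq> 0" "d \<noteq> 0" by blast+
qed

section \<open>Two geodesics and their relative position\<close>

locale geodesic_pair = A: hyperbolic_element \<Gamma> \<alpha> MA \<mu>A + B: hyperbolic_element \<Gamma> \<beta> MB \<mu>B
  for \<Gamma> \<alpha> MA \<mu>A \<beta> MB \<mu>B +
  fixes k :: nat
  assumes k: "k \<ge> 2"
begin

text \<open>The matrix whose geodesic is the axis of \<eta>^-1 \<beta> \<eta>, in the coordinate in
  which the axis of \<alpha> is the imaginary axis.\<close>

definition RR :: "real^2^2 \<Rightarrow> real^2^2" where
  "RR \<eta> = inv2 MA ** inv2 \<eta> ** MB"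

definition axis_kernel :: "real^2^2 \<Rightarrow> real \<Rightarrow> complex" where
  "axis_kernel \<eta> t = kern (RR \<eta> $ 1 $ 1) (RR \<eta> $ 1 $ 2) (RR \<eta> $ 2 $ 1) (RR \<eta> $ 2 $ 2) t"

definition axis :: "real \<Rightarrow> complex" where
  "axis t = mob MA (\<i> * of_real (exp t))"

definition axis' :: "real \<Rightarrow> complex" where
  "axis' t = \<i> * of_real (exp t) / (autf MA (\<i> * of_real (exp t)))\<^sup>2"

lemma Im_axis: "Im (axis t) > 0"
  unfolding axis_def by (rule Im_mob(2)[OF A.det_M]) simp

lemma axis_has_vector_derivative: "(axis has_vector_derivative axis' t) (at t)"
proof -
  have "((\<lambda>t. \<i> * of_real (exp t)) has_vector_derivative \<i> * of_real (exp t)) (at t)"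
    by (intro has_vector_derivative_mult_right has_vector_derivative_of_real) (auto intro!: derivative_eq_intros simp flip: has_real_derivative_iff_has_vector_derivative)
  moreover have "(mob MA has_field_derivative 1 / (autf MA (\<i> * of_real (exp t)))\<^sup>2) (at (\<i> * of_real (exp t)))"
    by (rule mob_has_field_derivative[OF A.det_M]) simp
  ultimately have "((mob MA \<circ> (\<lambda>t. \<i> * of_real (exp t))) has_vector_derivative \<i> * of_real (exp t) * (1 / (autf MA (\<i> * of_real (exp t)))\<^sup>2)) (at t)"
    by (rule field_vector_diff_chain_at)
  then show ?thesis by (simp add: axis_def[abs_def] axis'_def o_def)
qed

lemma continuous_axis: "continuous_on S axis" "continuous_on S axis'"
proof -
  show "continuous_on S axis"
    using axis_has_vector_derivative has_vector_derivative_continuous continuous_at_imp_continuous_on by blast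
  have "autf MA (\<i> * of_real (exp t)) \<noteq> 0" for t by (rule autf_ne_0[OF A.det_M]) simp
  then show "continuous_on S axis'" unfolding axis'_def autf_def by (intro continuous_intros) (auto simp: autf_def)
qed

lemma axis_translate: "mob \<alpha> (axis t) = axis (t + A.len)"
proof -
  have w: "Im (\<i> * complex_of_real (exp t)) > 0" by simp
  have e: "exp (t + A.len) = \<mu>A\<^sup>2 * exp t"
    using A.mu_ne_0 by (simp add: exp_add A.len_def exp_double ln_realpow)
  have d: "det (mat2 \<mu>A 0 0 (1 / \<mu>A)) = 1" using A.mu_ne_0 by (simp add: det_mat2)
  have "mob \<alpha> (axis t) = mob (\<alpha> ** MA) (\<i> * of_real (exp t))"
    unfolding axis_def using mob_mult(1)[OF A.det_M w] by simp
  also have "\<dots> = mob MA (mob (mat2 \<mu>A 0 0 (1 / \<mu>A)) (\<i> * of_real (exp t)))"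
    unfolding A.gamma_M using mob_mult(1)[OF d w] by simp
  also have "mob (mat2 \<mu>A 0 0 (1 / \<mu>A)) (\<i> * of_real (exp t)) = \<i> * of_real (exp (t + A.len))"
    unfolding e using A.mu_ne_0 by (simp add: mob_mat2 power2_eq_square)
  finally show ?thesis by (simp add: axis_def)
qed

lemma det_RR: "\<eta> \<in> \<Gamma> \<Longrightarrow> RR \<eta> $ 1 $ 1 * RR \<eta> $ 2 $ 2 - RR \<eta> $ 1 $ 2 * RR \<eta> $ 2 $ 1 = 1"
proof -
  assume "\<eta> \<in> \<Gamma>"
  then have "det (RR \<eta>) = 1" by (simp add: RR_def det_mul A.det_M B.det_M A.det_Gamma)
  then show ?thesis by (simp add: det_2)
qed

text \<open>Pulling back by \<open>MA\<close> identifies a term of the Poincare series along the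
  axis of \<alpha> with an elementary kernel. In particular the kernel depends on the coset of
  \<open>\<eta>\<close> only.\<close>

lemma axis_kernel_tt:
  assumes "C \<in> B.cosets" "\<eta> \<in> C"
  shows "axis_kernel \<eta> t = B.tt C (axis t) * axis' t"
proof -
  define w where "w = \<i> * complex_of_real (exp t)"
  have w: "Im w > 0" by (simp add: w_def)
  obtain a b c d where R: "RR \<eta> = mat2 a b c d" by (rule mat2_cases)
  have "B.tt C (axis t) * axis' t = thM (inv2 \<eta> ** MB) (mob MA w) * (1 / (autf MA w)\<^sup>2) * w"
    unfolding B.tt_eq[OF assms] axis_def axis'_def w_def by simp
  also have "\<dots> = thM (RR \<eta>) w * w"
    unfolding thM_pullback[OF A.det_M w] RR_def by (simp add: matrix_mul_assoc)
  also have "\<dots> = axis_kernel \<eta> t" unfolding axis_kernel_def R thM_mat2 kern_def w_def by (simp add: mult_ac)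
  finally show ?thesis ..
qed

lemma axis_kernel_rep: "C \<in> B.cosets \<Longrightarrow> \<eta> \<in> C \<Longrightarrow> axis_kernel (B.rep C) t = axis_kernel \<eta> t"
  using axis_kernel_tt B.rep_mem by simp

text \<open>The unfolding step: a factor \<alpha>^m on the right shifts the parameter by m periods,
  so the integrals over one period add up to an integral over the line.\<close>

lemma axis_kernel_pw: "axis_kernel (\<eta> ** A.pw m) t = axis_kernel \<eta> (t + of_int m * A.len)"
proof -
  define x where "x = \<mu>A powi m"
  have x: "x \<noteq> 0" using A.mu_ne_0 by (simp add: x_def)
  obtain a b c d where R: "RR \<eta> = mat2 a b c d" by (rule mat2_cases)
  have "inv2 MA ** inv2 (A.pw m) = inv2 (A.pw m ** MA)" by (simp add: inv2_mult)
  also have "\<dots> = mat2 (1 / x) 0 0 x ** inv2 MA" unfolding A.pw_M inv2_mult x_def inv2_mat2 by simp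
  finally have "RR (\<eta> ** A.pw m) = mat2 (1 / x) 0 0 x ** RR \<eta>"
    unfolding RR_def inv2_mult by (simp only: matrix_mul_assoc)
  then have "RR (\<eta> ** A.pw m) = mat2 (a / x) (b / x) (c * x) (d * x)" by (simp add: R mat2_mult mult.commute)
  then show ?thesis unfolding axis_kernel_def R using kern_shift_abs[OF x] A.ln_abs_power_mu[of m] by (simp add: x_def)
qed

definition axis_integral :: "(real^2^2) set \<Rightarrow> real" where
  "axis_integral C = integral {0..A.len} (\<lambda>t. Im (axis_kernel (B.rep C) t ^ k))"

lemma axis_kernel_bound: "\<exists>K. \<forall>C\<in>B.cosets. \<forall>t\<in>{0..A.len}. norm (axis_kernel (B.rep C) t ^ k) \<le> K * (norm (B.tt C \<i>))\<^sup>2"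
proof -
  have c: "compact (axis ` {0..A.len})" by (intro compact_continuous_image continuous_axis) simp
  obtain K1 where K1: "\<forall>z\<in>axis ` {0..A.len}. \<forall>C\<in>B.cosets. norm (B.tt C z ^ k) \<le> K1 * (norm (B.tt C \<i>))\<^sup>2"
    using B.Theta_uniform_limit(2)[OF c _ k] Im_axis by blast
  have "bounded (axis' ` {0..A.len})" by (intro compact_imp_bounded compact_continuous_image continuous_axis) simp
  then obtain K2 where K2: "\<forall>z\<in>axis' ` {0..A.len}. norm z \<le> K2" unfolding bounded_iff by blast
  have "norm (axis_kernel (B.rep C) t ^ k) \<le> (K1 * K2 ^ k) * (norm (B.tt C \<i>))\<^sup>2" if C: "C \<in> B.cosets" and t: "t \<in> {0..A.len}" for C t
  proof -
    have "norm (axis_kernel (B.rep C) t ^ k) = norm (B.tt C (axis t) ^ k) * norm (axis' t) ^ k"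
      unfolding axis_kernel_tt[OF C B.rep_mem[OF C]] by (simp add: norm_mult norm_power power_mult_distrib)
    also have "\<dots> \<le> (K1 * (norm (B.tt C \<i>))\<^sup>2) * K2 ^ k"
    proof (rule mult_mono)
      show 1: "norm (B.tt C (axis t) ^ k) \<le> K1 * (norm (B.tt C \<i>))\<^sup>2" using K1 C t by blast
      show "norm (axis' t) ^ k \<le> K2 ^ k" using K2 t by (intro power_mono) auto
      show "0 \<le> K1 * (norm (B.tt C \<i>))\<^sup>2" using 1 norm_ge_zero order_trans by blast
    qed simp
    finally show ?thesis by (simp add: mult_ac)
  qed
  then show ?thesis by blast
qed

lemma continuous_axis_kernel: "\<eta> \<in> \<Gamma> \<Longrightarrow> continuous_on S (axis_kernel \<eta>)"
  unfolding axis_kernel_def[abs_def] by (rule continuous_kern[OF det_RR])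

lemma rep_Gamma: "C \<in> B.cosets \<Longrightarrow> B.rep C \<in> \<Gamma>"
  using B.rep_mem B.coset_subset by blast

lemma axis_integral_summable: "axis_integral summable_on B.cosets"
proof -
  obtain K where K: "\<forall>C\<in>B.cosets. \<forall>t\<in>{0..A.len}. norm (axis_kernel (B.rep C) t ^ k) \<le> K * (norm (B.tt C \<i>))\<^sup>2"
    using axis_kernel_bound by blast
  have "norm (axis_integral C) \<le> (K * A.len) * (norm (B.tt C \<i>))\<^sup>2" if C: "C \<in> B.cosets" for C
  proof -
    have cont: "continuous_on {0..A.len} (\<lambda>t. Im (axis_kernel (B.rep C) t ^ k))"
      by (intro continuous_intros continuous_axis_kernel rep_Gamma C)
    have "norm (axis_integral C) \<le> (K * (norm (B.tt C \<i>))\<^sup>2) * (A.len - 0)"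
      unfolding axis_integral_def
    proof (rule integral_bound[OF _ cont])
      show "norm (Im (axis_kernel (B.rep C) t ^ k)) \<le> K * (norm (B.tt C \<i>))\<^sup>2" if "t \<in> {0..A.len}" for t
        using abs_Im_le_cmod[of "axis_kernel (B.rep C) t ^ k"] K C that by fastforce
    qed (use A.len_pos in simp)
    then show ?thesis by (simp add: mult_ac)
  qed
  then have "(\<lambda>C. norm (axis_integral C)) summable_on B.cosets"
    by (intro Infinite_Sum.abs_summable_on_comparison_test'[OF summable_on_cmult_right[OF B.summable_norm_tt_square]]) auto
  then show ?thesis by (rule abs_summable_summable)
qed

definition orb :: "real^2^2 \<Rightarrow> int \<Rightarrow> (real^2^2) set" where
  "orb \<eta> m = stab \<Gamma> \<beta> #>\<^bsub>grp \<Gamma>\<^esub> (\<eta> ** A.pw m)"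

lemma orb_coset: "\<eta> \<in> \<Gamma> \<Longrightarrow> orb \<eta> m \<in> B.cosets" "\<eta> \<in> \<Gamma> \<Longrightarrow> \<eta> ** A.pw m \<in> orb \<eta> m"
  unfolding orb_def by (rule B.coset_I B.coset_self, rule A.mult_Gamma[OF _ A.pw_Gamma], assumption)+

lemma axis_kernel_orb: "\<eta> \<in> \<Gamma> \<Longrightarrow> axis_kernel (B.rep (orb \<eta> m)) t = axis_kernel \<eta> (t + of_int m * A.len)"
  using axis_kernel_rep[OF orb_coset] axis_kernel_pw by simp

lemma axis_integral_orb: "\<eta> \<in> \<Gamma> \<Longrightarrow> axis_integral (orb \<eta> m) = integral {0..A.len} (\<lambda>t. Im (axis_kernel \<eta> (t + of_int m * A.len) ^ k))"
  unfolding axis_integral_def by (simp add: axis_kernel_orb)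

text \<open>The two geodesics coincide, up to the orientation.\<close>

definition degenerate :: "real^2^2 \<Rightarrow> bool" where
  "degenerate \<eta> \<longleftrightarrow> RR \<eta> $ 1 $ 2 = 0 \<and> RR \<eta> $ 2 $ 1 = 0 \<or> RR \<eta> $ 1 $ 1 = 0 \<and> RR \<eta> $ 2 $ 2 = 0"

lemma axis_integral_degenerate: "\<eta> \<in> \<Gamma> \<Longrightarrow> degenerate \<eta> \<Longrightarrow> axis_integral (orb \<eta> m) = 0"
  unfolding axis_integral_orb degenerate_def axis_kernel_def using kern_degenerate[OF _ det_RR] by simp

text \<open>If two powers of \<alpha> led to the same coset, the kernel would be periodic, contrary
  to \<open>kern_not_periodic\<close>.\<close>

lemma inj_orb:
  assumes \<eta>: "\<eta> \<in> \<Gamma>" "\<not> degenerate \<eta>"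
  shows "inj (orb \<eta>)"
proof (rule injI, rule ccontr)
  fix m n assume mn: "orb \<eta> m = orb \<eta> n" "m \<noteq> n"
  have nd: "\<not> (RR \<eta> $ 1 $ 2 = 0 \<and> RR \<eta> $ 2 $ 1 = 0)" "\<not> (RR \<eta> $ 1 $ 1 = 0 \<and> RR \<eta> $ 2 $ 2 = 0)"
    using \<eta>(2) unfolding degenerate_def by blast+
  have False if mn: "orb \<eta> m = orb \<eta> n" "m < n" for m n
  proof -
    have T: "of_int (n - m) * A.len > 0" using mn(2) A.len_pos by simp
    have per: "norm (axis_kernel \<eta> (t + of_int (n - m) * A.len)) = norm (axis_kernel \<eta> t)" for t
    proof -
      have "axis_kernel \<eta> ((t - of_int m * A.len) + of_int n * A.len) = axis_kernel \<eta> ((t - of_int m * A.len) + of_int m * A.len)"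
        unfolding axis_kernel_orb[OF \<eta>(1), symmetric] mn(1) ..
      moreover have "(t - of_int m * A.len) + of_int n * A.len = t + of_int (n - m) * A.len"
        unfolding of_int_diff left_diff_distrib by linarith
      ultimately show ?thesis by (metis diff_add_cancel)
    qed
    show False by (rule kern_not_periodic[OF det_RR[OF \<eta>(1)] nd T per[unfolded axis_kernel_def]])
  qed
  then show False using mn by (cases "m < n") (auto simp: not_less_iff_gr_or_eq dest: sym)
qed

lemma RR_entries_ne_0:
  assumes \<eta>: "\<eta> \<in> \<Gamma>" "\<not> degenerate \<eta>"
  shows "RR \<eta> $ 1 $ 1 \<noteq> 0" "RR \<eta> $ 1 $ 2 \<noteq> 0" "RR \<eta> $ 2 $ 1 \<noteq> 0" "RR \<eta> $ 2 $ 2 \<noteq> 0"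
proof -
  \<comment> \<open>The values of the kernel at multiples of the period are, up to one fixed factor,
    terms of the series at the single point \<open>axis 0\<close>; injectivity of
    \<open>orb \<eta>\<close> transfers the summability to the integers.\<close>
  have B: "(\<lambda>C. (norm (B.tt C (axis 0)))\<^sup>2) summable_on B.cosets"
  proof -
    obtain K where K: "\<forall>z\<in>{axis 0}. \<forall>C\<in>B.cosets. norm (B.tt C z ^ 2) \<le> K * (norm (B.tt C \<i>))\<^sup>2"
      using B.Theta_uniform_limit(2)[of "{axis 0}" 2] Im_axis by auto
    have "(\<lambda>C. norm (B.tt C (axis 0) ^ 2)) summable_on B.cosets"
      by (rule Infinite_Sum.abs_summable_on_comparison_test'[OF summable_on_cmult_right[OF B.summable_norm_tt_square]]) (use K in blast)
    then show ?thesis by (simp add: norm_power)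
  qed
  have "(\<lambda>C. (norm (B.tt C (axis 0)))\<^sup>2) summable_on range (orb \<eta>)"
    by (rule summable_on_subset_banach[OF B]) (use orb_coset \<eta> in auto)
  then have "(\<lambda>m. (norm (B.tt (orb \<eta> m) (axis 0)))\<^sup>2) summable_on UNIV"
    unfolding summable_on_reindex[OF inj_orb[OF \<eta>]] by (simp add: o_def)
  from summable_on_cmult_left[OF this, of "(norm (axis' 0))\<^sup>2"]
  have "(\<lambda>m. (norm (axis_kernel \<eta> (of_int m * A.len)))\<^sup>2) summable_on UNIV"
  proof (rule summable_on_cong[THEN iffD1, rotated])
    fix m
    have "axis_kernel \<eta> (of_int m * A.len) = B.tt (orb \<eta> m) (axis 0) * axis' 0"
      using axis_kernel_orb[OF \<eta>(1), of m 0] axis_kernel_tt[OF orb_coset(1)[OF \<eta>(1)] B.rep_mem[OF orb_coset(1)[OF \<eta>(1)]], of m 0] by simp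
    then show "(norm (B.tt (orb \<eta> m) (axis 0)))\<^sup>2 * (norm (axis' 0))\<^sup>2 = (norm (axis_kernel \<eta> (of_int m * A.len)))\<^sup>2"
      by (simp only: norm_mult power_mult_distrib)
  qed
  from kern_entries_ne_0[OF det_RR[OF \<eta>(1)] A.len_pos this[unfolded axis_kernel_def]]
  show "RR \<eta> $ 1 $ 1 \<noteq> 0" "RR \<eta> $ 1 $ 2 \<noteq> 0" "RR \<eta> $ 2 $ 1 \<noteq> 0" "RR \<eta> $ 2 $ 2 \<noteq> 0" .
qed

lemma orbit_has_sum:
  assumes \<eta>: "\<eta> \<in> \<Gamma>" "\<not> degenerate \<eta>"
  shows "((\<lambda>m. integral {0..A.len} (\<lambda>t. Im (axis_kernel \<eta> (t + of_int m * A.len) ^ k))) has_sum (\<Sum>\<^sub>\<infinity>C\<in>range (orb \<eta>). axis_integral C)) UNIV"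
proof -
  have "axis_integral summable_on range (orb \<eta>)"
    by (rule summable_on_subset_banach[OF axis_integral_summable]) (use orb_coset \<eta> in auto)
  then have "(axis_integral has_sum (\<Sum>\<^sub>\<infinity>C\<in>range (orb \<eta>). axis_integral C)) (range (orb \<eta>))" by (rule has_sum_infsum)
  then show ?thesis unfolding has_sum_reindex[OF inj_orb[OF \<eta>]] by (simp add: o_def axis_integral_orb[OF \<eta>(1)])
qed

section \<open>Double cosets\<close>

text \<open>A double coset splits into \<open>stab \<beta>\<close>-cosets as well as, after inversion, into \<open>stab \<alpha>\<close>-cosets, and so
  indexes a common subdivision of both sums.\<close>

definition double_coset :: "real^2^2 \<Rightarrow> (real^2^2) set" where
  "double_coset \<eta> = {\<tau> ** \<eta> ** \<sigma> | \<tau> \<sigma>. \<tau> \<in> stab \<Gamma> \<beta> \<and> \<sigma> \<in> stab \<Gamma> \<alpha>}"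

definition cosB :: "(real^2^2) set \<Rightarrow> (real^2^2) set set" where
  "cosB D = {C \<in> B.cosets. C \<subseteq> D}"

lemma stab_closed:
  "\<tau> \<in> stab \<Gamma> \<beta> \<Longrightarrow> \<tau>' \<in> stab \<Gamma> \<beta> \<Longrightarrow> \<tau> ** \<tau>' \<in> stab \<Gamma> \<beta>"
  "\<sigma> \<in> stab \<Gamma> \<alpha> \<Longrightarrow> \<sigma>' \<in> stab \<Gamma> \<alpha> \<Longrightarrow> \<sigma> ** \<sigma>' \<in> stab \<Gamma> \<alpha>"
  "\<tau> \<in> stab \<Gamma> \<beta> \<Longrightarrow> inv2 \<tau> \<in> stab \<Gamma> \<beta>"
  "\<sigma> \<in> stab \<Gamma> \<alpha> \<Longrightarrow> inv2 \<sigma> \<in> stab \<Gamma> \<alpha>"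
  "mat 1 \<in> stab \<Gamma> \<beta>" "mat 1 \<in> stab \<Gamma> \<alpha>"
proof -
  show "\<tau> \<in> stab \<Gamma> \<beta> \<Longrightarrow> \<tau>' \<in> stab \<Gamma> \<beta> \<Longrightarrow> \<tau> ** \<tau>' \<in> stab \<Gamma> \<beta>"
    using subgroup.m_closed[OF B.stab_subgroup, of \<tau> \<tau>'] by (simp add: SL_mult)
  show "\<sigma> \<in> stab \<Gamma> \<alpha> \<Longrightarrow> \<sigma>' \<in> stab \<Gamma> \<alpha> \<Longrightarrow> \<sigma> ** \<sigma>' \<in> stab \<Gamma> \<alpha>"
    using subgroup.m_closed[OF A.stab_subgroup, of \<sigma> \<sigma>'] by (simp add: SL_mult)
  show "inv2 \<tau> \<in> stab \<Gamma> \<beta>" if "\<tau> \<in> stab \<Gamma> \<beta>"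
    using subgroup.m_inv_closed[OF B.stab_subgroup that] A.inv_grp[OF subsetD[OF B.stab_subset that]] by simp
  show "inv2 \<sigma> \<in> stab \<Gamma> \<alpha>" if "\<sigma> \<in> stab \<Gamma> \<alpha>"
    using subgroup.m_inv_closed[OF A.stab_subgroup that] A.inv_grp[OF subsetD[OF A.stab_subset that]] by simp
  show "mat 1 \<in> stab \<Gamma> \<beta>" using subgroup.one_closed[OF B.stab_subgroup] by simp
  show "mat 1 \<in> stab \<Gamma> \<alpha>" using subgroup.one_closed[OF A.stab_subgroup] by simp
qed

lemma double_coset_eq:
  assumes "\<eta>' \<in> double_coset \<eta>"
  shows "double_coset \<eta>' = double_coset \<eta>"
proof -
  have sub: "double_coset \<eta>' \<subseteq> double_coset \<eta>" if "\<eta>' \<in> double_coset \<eta>" for \<eta> \<eta>'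
  proof
    fix x assume "x \<in> double_coset \<eta>'"
    then obtain \<tau> \<sigma> where 1: "x = \<tau> ** \<eta>' ** \<sigma>" "\<tau> \<in> stab \<Gamma> \<beta>" "\<sigma> \<in> stab \<Gamma> \<alpha>" unfolding double_coset_def by blast
    from that obtain \<tau>' \<sigma>' where 2: "\<eta>' = \<tau>' ** \<eta> ** \<sigma>'" "\<tau>' \<in> stab \<Gamma> \<beta>" "\<sigma>' \<in> stab \<Gamma> \<alpha>" unfolding double_coset_def by blast
    have "x = (\<tau> ** \<tau>') ** \<eta> ** (\<sigma>' ** \<sigma>)" unfolding 1(1) 2(1) by (simp only: matrix_mul_assoc)
    moreover have "\<tau> ** \<tau>' \<in> stab \<Gamma> \<beta>" "\<sigma>' ** \<sigma> \<in> stab \<Gamma> \<alpha>" using 1 2 stab_closed by blast+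
    ultimately show "x \<in> double_coset \<eta>" unfolding double_coset_def by blast
  qed
  from assms obtain \<tau> \<sigma> where s: "\<eta>' = \<tau> ** \<eta> ** \<sigma>" "\<tau> \<in> stab \<Gamma> \<beta>" "\<sigma> \<in> stab \<Gamma> \<alpha>" unfolding double_coset_def by blast
  have "det \<tau> = 1" "det \<sigma> = 1" using s A.stab_subset B.stab_subset A.det_Gamma by blast+
  note i = inv2_inverse[OF this(1)] inv2_inverse[OF this(2)]
  have "inv2 \<tau> ** \<eta>' ** inv2 \<sigma> = (inv2 \<tau> ** \<tau>) ** \<eta> ** (\<sigma> ** inv2 \<sigma>)" unfolding s(1) by (simp only: matrix_mul_assoc)
  then have "\<eta> = inv2 \<tau> ** \<eta>' ** inv2 \<sigma>" by (simp add: i)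
  then have "\<eta> \<in> double_coset \<eta>'" unfolding double_coset_def using stab_closed(3)[OF s(2)] stab_closed(4)[OF s(3)] by blast
  then show ?thesis using sub assms by blast
qed

lemma coset_subset_double_coset:
  assumes "C \<in> B.cosets" "\<eta> \<in> C"
  shows "C \<subseteq> double_coset \<eta>"
proof
  fix x assume "x \<in> C"
  then obtain \<tau> where "\<tau> \<in> stab \<Gamma> \<beta>" "x = \<tau> ** \<eta>" using B.coset_mem_eq[OF assms] B.coset_mem by blast
  then have "x = \<tau> ** \<eta> ** mat 1" "\<tau> \<in> stab \<Gamma> \<beta>" by simp_all
  then show "x \<in> double_coset \<eta>" unfolding double_coset_def using stab_closed(6) by blast
qed

lemma cosB_double_coset:
  assumes "\<eta> \<in> \<Gamma>"
  shows "cosB (double_coset \<eta>) = range (orb \<eta>)"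
proof (intro equalityI subsetI)
  fix C assume "C \<in> cosB (double_coset \<eta>)"
  then have C: "C \<in> B.cosets" "C \<subseteq> double_coset \<eta>" by (auto simp: cosB_def)
  have "B.rep C \<in> double_coset \<eta>" using B.rep_mem[OF C(1)] C(2) by blast
  then obtain \<tau> \<sigma> where r: "B.rep C = \<tau> ** \<eta> ** \<sigma>" "\<tau> \<in> stab \<Gamma> \<beta>" "\<sigma> \<in> stab \<Gamma> \<alpha>" unfolding double_coset_def by blast
  obtain m where m: "\<sigma> = A.pw m \<or> \<sigma> = - mat 1 ** A.pw m" using A.stab_eq_pw[OF r(3)] by blast
  have "\<exists>\<tau>'\<in>stab \<Gamma> \<beta>. B.rep C = \<tau>' ** (\<eta> ** A.pw m)"
    using m
  proof
    assume "\<sigma> = A.pw m"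
    then show ?thesis using r by (intro bexI[of _ \<tau>]) (simp_all add: matrix_mul_assoc)
  next
    assume s: "\<sigma> = - mat 1 ** A.pw m"
    \<comment> \<open>The sign is moved to the other side, as \<open>- mat 1\<close> is central and
      lies in both subgroups.\<close>
    have "\<tau> ** (- mat 1) \<in> stab \<Gamma> \<beta>" by (rule stab_closed(1)[OF r(2) B.minus_one_stab])
    moreover have "B.rep C = (\<tau> ** (- mat 1)) ** (\<eta> ** A.pw m)"
      unfolding r(1) s by (simp add: matrix_neg_left matrix_neg_right matrix_mul_assoc)
    ultimately show ?thesis by blast
  qed
  then have "B.rep C \<in> orb \<eta> m" unfolding orb_def using B.coset_mem by blast
  then have "C = orb \<eta> m"
    using B.coset_mem_eq[OF C(1) B.rep_mem[OF C(1)]] B.coset_mem_eq[OF orb_coset(1)[OF assms]] by metis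
  then show "C \<in> range (orb \<eta>)" by blast
next
  fix C assume "C \<in> range (orb \<eta>)"
  then obtain m where m: "C = orb \<eta> m" by blast
  have "\<eta> ** A.pw m = mat 1 ** \<eta> ** A.pw m" by simp
  then have "\<eta> ** A.pw m \<in> double_coset \<eta>" unfolding double_coset_def using stab_closed(5) A.pw_stab by blast
  then have "double_coset (\<eta> ** A.pw m) = double_coset \<eta>" by (rule double_coset_eq)
  then have "C \<subseteq> double_coset \<eta>" unfolding m using coset_subset_double_coset[OF orb_coset[OF assms]] by blast
  then show "C \<in> cosB (double_coset \<eta>)" unfolding cosB_def m using orb_coset(1)[OF assms] by blast
qed

lemma infsum_axis_integral_double_cosets: "(\<Sum>\<^sub>\<infinity>C\<in>B.cosets. axis_integral C) = (\<Sum>\<^sub>\<infinity>D\<in>double_coset ` \<Gamma>. \<Sum>\<^sub>\<infinity>C\<in>cosB D. axis_integral C)"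
proof -
  \<comment> \<open>Each coset lies in exactly one double coset, so the double sum is a
    rearrangement; absolute summability justifies it.\<close>
  have bij: "bij_betw snd (Sigma (double_coset ` \<Gamma>) cosB) B.cosets"
  proof (rule bij_betw_imageI)
    show "inj_on snd (Sigma (double_coset ` \<Gamma>) cosB)"
    proof (rule inj_onI)
      fix x y assume xy: "x \<in> Sigma (double_coset ` \<Gamma>) cosB" "y \<in> Sigma (double_coset ` \<Gamma>) cosB" "snd x = snd y"
      obtain D C where x: "x = (D, C)" by fastforce
      obtain D' where y: "y = (D', C)" using xy(3) x by (metis prod.collapse snd_conv)
      have C: "C \<in> B.cosets" "C \<subseteq> D" "C \<subseteq> D'" using xy x y by (auto simp: cosB_def)
      obtain \<eta> \<eta>' where D: "D = double_coset \<eta>" "D' = double_coset \<eta>'" using xy x y by auto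
      have "double_coset (B.rep C) = D" "double_coset (B.rep C) = D'" unfolding D by (rule double_coset_eq; use B.rep_mem[OF C(1)] C D in blast)+
      then show "x = y" using x y by simp
    qed
    show "snd ` Sigma (double_coset ` \<Gamma>) cosB = B.cosets"
    proof (intro equalityI subsetI)
      fix C assume C: "C \<in> B.cosets"
      have "B.rep C \<in> \<Gamma>" by (rule rep_Gamma[OF C])
      moreover have "C \<subseteq> double_coset (B.rep C)" by (rule coset_subset_double_coset[OF C B.rep_mem[OF C]])
      ultimately have "(double_coset (B.rep C), C) \<in> Sigma (double_coset ` \<Gamma>) cosB" using C by (auto simp: cosB_def)
      then show "C \<in> snd ` Sigma (double_coset ` \<Gamma>) cosB" by force
    qed (auto simp: cosB_def)
  qed
  have "(\<lambda>x. axis_integral (snd x)) summable_on Sigma (double_coset ` \<Gamma>) cosB"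
    using summable_on_reindex_bij_betw[OF bij, of axis_integral] axis_integral_summable by simp
  then have "(\<lambda>(D, C). axis_integral C) summable_on Sigma (double_coset ` \<Gamma>) cosB" by (simp add: case_prod_unfold)
  from infsum_Sigma'_banach[OF this]
  have "(\<Sum>\<^sub>\<infinity>D\<in>double_coset ` \<Gamma>. \<Sum>\<^sub>\<infinity>C\<in>cosB D. axis_integral C) = (\<Sum>\<^sub>\<infinity>x\<in>Sigma (double_coset ` \<Gamma>) cosB. axis_integral (snd x))"
    by (simp add: case_prod_unfold)
  also have "\<dots> = (\<Sum>\<^sub>\<infinity>C\<in>B.cosets. axis_integral C)" by (rule infsum_reindex_bij_betw[OF bij])
  finally show ?thesis ..
qed

text \<open>Inversion carries the double cosets of one ordered pair to those of the other and
  inverts \<open>RR\<close>, so both sums run over the same index set and can be compared term by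
  term.\<close>

theorem infsum_axis_integral_antisym:
  "(\<Sum>\<^sub>\<infinity>C\<in>A.cosets. geodesic_pair.axis_integral MB \<mu>B MA k C) = - (\<Sum>\<^sub>\<infinity>C\<in>B.cosets. axis_integral C)"
proof -
  interpret S: geodesic_pair \<Gamma> \<beta> MB \<mu>B \<alpha> MA \<mu>A k by unfold_locales (rule k)
  have inv2_Gamma: "inv2 ` \<Gamma> = \<Gamma>"
    using A.inv2_Gamma by (auto intro!: image_eqI[of _ inv2 "inv2 _"])
  have double_coset_inv: "S.double_coset (inv2 \<eta>) = inv2 ` double_coset \<eta>" for \<eta>
  proof (intro equalityI subsetI)
    fix x assume "x \<in> S.double_coset (inv2 \<eta>)"
    then obtain \<tau> \<sigma> where x: "x = \<tau> ** inv2 \<eta> ** \<sigma>" "\<tau> \<in> stab \<Gamma> \<alpha>" "\<sigma> \<in> stab \<Gamma> \<beta>" unfolding S.double_coset_def by blast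
    have "x = inv2 (inv2 \<sigma> ** \<eta> ** inv2 \<tau>)" unfolding x(1) by (simp add: inv2_mult matrix_mul_assoc)
    then show "x \<in> inv2 ` double_coset \<eta>" unfolding double_coset_def using stab_closed(3)[OF x(3)] stab_closed(4)[OF x(2)] by blast
  next
    fix x assume "x \<in> inv2 ` double_coset \<eta>"
    then obtain \<tau> \<sigma> where x: "x = inv2 (\<tau> ** \<eta> ** \<sigma>)" "\<tau> \<in> stab \<Gamma> \<beta>" "\<sigma> \<in> stab \<Gamma> \<alpha>" unfolding double_coset_def by blast
    have "x = inv2 \<sigma> ** inv2 \<eta> ** inv2 \<tau>" unfolding x(1) by (simp add: inv2_mult matrix_mul_assoc)
    then show "x \<in> S.double_coset (inv2 \<eta>)" unfolding S.double_coset_def using stab_closed(3)[OF x(2)] stab_closed(4)[OF x(3)] by blast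
  qed
  have "S.double_coset ` \<Gamma> = (\<lambda>D. inv2 ` D) ` double_coset ` \<Gamma>"
    by (subst inv2_Gamma[symmetric]) (simp only: image_image double_coset_inv)
  moreover have "inj inv2" by (rule injI) (metis inv2_inv2)
  then have "inj_on (\<lambda>D. inv2 ` D) (double_coset ` \<Gamma>)" by (metis inj_image_eq_iff inj_onI)
  ultimately have "(\<Sum>\<^sub>\<infinity>C\<in>A.cosets. S.axis_integral C) = (\<Sum>\<^sub>\<infinity>D\<in>double_coset ` \<Gamma>. \<Sum>\<^sub>\<infinity>C\<in>S.cosB (inv2 ` D). S.axis_integral C)"
    unfolding S.infsum_axis_integral_double_cosets by (simp add: infsum_reindex o_def)
  also have "\<dots> = (\<Sum>\<^sub>\<infinity>D\<in>double_coset ` \<Gamma>. - (\<Sum>\<^sub>\<infinity>C\<in>cosB D. axis_integral C))"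
  proof (rule infsum_cong)
    fix D assume "D \<in> double_coset ` \<Gamma>"
    then obtain \<eta> where \<eta>: "\<eta> \<in> \<Gamma>" "D = double_coset \<eta>" by blast
    note \<eta>' = A.inv2_Gamma[OF \<eta>(1)]
    have l: "(\<Sum>\<^sub>\<infinity>C\<in>S.cosB (inv2 ` D). S.axis_integral C) = (\<Sum>\<^sub>\<infinity>C\<in>range (S.orb (inv2 \<eta>)). S.axis_integral C)"
      unfolding \<eta>(2) double_coset_inv[symmetric] S.cosB_double_coset[OF \<eta>'] ..
    have r: "(\<Sum>\<^sub>\<infinity>C\<in>cosB D. axis_integral C) = (\<Sum>\<^sub>\<infinity>C\<in>range (orb \<eta>). axis_integral C)" unfolding \<eta>(2) cosB_double_coset[OF \<eta>(1)] ..
    have R: "S.RR (inv2 \<eta>) = inv2 (RR \<eta>)" unfolding S.RR_def RR_def by (simp add: inv2_mult matrix_mul_assoc)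
    obtain a b c d where abcd: "RR \<eta> = mat2 a b c d" by (rule mat2_cases)
    have deg: "S.degenerate (inv2 \<eta>) \<longleftrightarrow> degenerate \<eta>"
      unfolding S.degenerate_def degenerate_def R abcd inv2_mat2 by auto
    show "(\<Sum>\<^sub>\<infinity>C\<in>S.cosB (inv2 ` D). S.axis_integral C) = - (\<Sum>\<^sub>\<infinity>C\<in>cosB D. axis_integral C)"
    proof (cases "degenerate \<eta>")
      case True
      have "(\<Sum>\<^sub>\<infinity>C\<in>range (orb \<eta>). axis_integral C) = 0" by (rule infsum_0) (use axis_integral_degenerate[OF \<eta>(1) True] in blast)
      moreover have "(\<Sum>\<^sub>\<infinity>C\<in>range (S.orb (inv2 \<eta>)). S.axis_integral C) = 0"
        by (rule infsum_0) (use S.axis_integral_degenerate[OF \<eta>'] True deg in blast)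
      ultimately show ?thesis unfolding l r by simp
    next
      case False
      show ?thesis unfolding l r
      proof (rule kern_total_antisym)
        show "a * d - b * c = 1" using det_RR[OF \<eta>(1)] abcd by simp
        show "a \<noteq> 0" "b \<noteq> 0" "c \<noteq> 0" "d \<noteq> 0" using RR_entries_ne_0[OF \<eta>(1) False] abcd by simp_all
        show "k > 0" using k by simp
        show "((\<lambda>m. integral {0..A.len} (\<lambda>t. Im (kern a b c d (t + of_int m * A.len) ^ k))) has_sum (\<Sum>\<^sub>\<infinity>C\<in>range (orb \<eta>). axis_integral C)) UNIV"
          using orbit_has_sum[OF \<eta>(1) False] unfolding axis_kernel_def abcd by simp
        have "\<not> S.degenerate (inv2 \<eta>)" using False deg by simp
        from S.orbit_has_sum[OF \<eta>' this]
        show "((\<lambda>m. integral {0..B.len} (\<lambda>t. Im (kern d (-b) (-c) a (t + of_int m * B.len) ^ k))) has_sum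
            (\<Sum>\<^sub>\<infinity>C\<in>range (S.orb (inv2 \<eta>)). S.axis_integral C)) UNIV"
          unfolding S.axis_kernel_def R abcd inv2_mat2 by simp
      qed (rule A.len_pos B.len_pos)+
    qed
  qed
  also have "\<dots> = - (\<Sum>\<^sub>\<infinity>D\<in>double_coset ` \<Gamma>. \<Sum>\<^sub>\<infinity>C\<in>cosB D. axis_integral C)" by (rule infsum_uminus)
  finally show ?thesis unfolding infsum_axis_integral_double_cosets[symmetric] .
qed

end

section \<open>Periods\<close>

lemma matrix_inv_cmat_iota:
  assumes "det g = 1"
  shows "matrix_inv (cmat (iota g)) = (cmat (iota (inv2 g)) :: 'n::{finite,linorder} cmatrix)"
    "cmat (iota g) ** cmat (iota (inv2 g)) = (mat 1 :: 'n cmatrix)"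
    "cmat (iota (inv2 g)) ** cmat (iota g) = (mat 1 :: 'n cmatrix)"
    "iota g ** iota (inv2 g) = (mat 1 :: 'n rmatrix)"
    "iota (inv2 g) ** iota g = (mat 1 :: 'n rmatrix)"
proof -
  show r: "iota g ** iota (inv2 g) = (mat 1 :: 'n rmatrix)" "iota (inv2 g) ** iota g = (mat 1 :: 'n rmatrix)"
    unfolding iota_eq_sympow sympow_mult[symmetric] inv2_inverse[OF assms] by (rule sympow_one)+
  show c: "cmat (iota g) ** cmat (iota (inv2 g)) = (mat 1 :: 'n cmatrix)" "cmat (iota (inv2 g)) ** cmat (iota g) = (mat 1 :: 'n cmatrix)"
    unfolding map_matrix_of_real_mult[symmetric] r by (rule map_matrix_of_real_one)+
  show "matrix_inv (cmat (iota g)) = (cmat (iota (inv2 g)) :: 'n cmatrix)" by (rule matrix_inv_eqI[OF c])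
qed

lemma map_matrix_cnj_cmat: "map_matrix cnj (cmat A) = cmat A"
  by (simp add: vec_eq_iff map_matrix_def)

lemma convex_upper_half: "convex upper_half" and open_upper_half: "open upper_half"
  unfolding upper_half_def by (rule convex_halfspace_Im_gt, rule open_halfspace_Im_gt)

lemma upper_half_iff: "z \<in> upper_half \<longleftrightarrow> Im z > 0"
  by (simp add: upper_half_def)

lemma matrix_inv_frame: "Im z > 0 \<Longrightarrow> matrix_inv (frame z) = (frame_inv z :: 'n::{finite,linorder} cmatrix)"
  by (rule matrix_inv_eqI) (simp_all add: frame_inverse)

lemma constant_on_upper_half:
  fixes f :: "complex \<Rightarrow> 'n::{finite,linorder} cmatrix"
  assumes "\<And>z. Im z > 0 \<Longrightarrow> (f has_derivative (\<lambda>v. 0)) (at z)" "Im z > 0" "Im w > 0"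
  shows "f z = f w"
proof -
  have "\<exists>c. \<forall>z\<in>upper_half. f z = c"
    by (rule has_derivative_zero_constant[OF convex_upper_half])
      (use assms(1) in \<open>auto simp: upper_half_iff intro: has_derivative_at_withinI\<close>)
  then show ?thesis using assms(2,3) by (auto simp: upper_half_iff)
qed

context surface
begin

text \<open>The entries of q \<open>Om\<close> are holomorphic and have primitives on the half
  plane. Twice the real part of these is a primitive of the form in the flat frame, which makes the
  cocycle real. It is constant in z by equivariance and is evaluated at \<open>\<i>\<close>.\<close>

lemma periods_nonempty:
  assumes hol: "q holomorphic_on upper_half" and k: "k \<ge> 1"
    and aut: "\<And>g z. g \<in> \<Gamma> \<Longrightarrow> Im z > 0 \<Longrightarrow> q (mob g z) * (1 / (autf g z)\<^sup>2) ^ k = q z"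
  shows "periods \<Gamma> (psi0 k q :: complex \<Rightarrow> complex \<Rightarrow> 'n::{finite,linorder} cmatrix) \<noteq> {}"
proof -
  define m where "m = k - 1"
  have "\<exists>G. \<forall>z\<in>upper_half. (G has_field_derivative q z * (Om m z :: 'n cmatrix) $ i $ j) (at z)" for i j
  proof -
    have "(\<lambda>z. (Om m z :: 'n cmatrix) $ i $ j) holomorphic_on upper_half"
    proof (rule holomorphic_onI)
      fix z assume "z \<in> upper_half"
      then obtain D where "((\<lambda>z. (Om m z :: 'n cmatrix) $ i $ j) has_field_derivative D) (at z)"
        using Om_has_field_derivative[of z m i j] by (auto simp: upper_half_iff)
      then show "(\<lambda>z. (Om m z :: 'n cmatrix) $ i $ j) field_differentiable at z within upper_half"
        using field_differentiable_def field_differentiable_at_within by blast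
    qed
    then have "(\<lambda>z. q z * (Om m z :: 'n cmatrix) $ i $ j) holomorphic_on upper_half" by (intro holomorphic_intros hol)
    from holomorphic_convex_primitive'[OF convex_upper_half open_upper_half this]
    obtain G where "\<And>z. z \<in> upper_half \<Longrightarrow> (G has_field_derivative q z * (Om m z :: 'n cmatrix) $ i $ j) (at z within upper_half)" by blast
    then show ?thesis using at_within_open[OF _ open_upper_half] by metis
  qed
  then have "\<forall>ij. \<exists>G. \<forall>z\<in>upper_half. (G has_field_derivative q z * (Om m z :: 'n cmatrix) $ fst ij $ snd ij) (at z)" by blast
  from choice[OF this] obtain G0 where "\<forall>ij. \<forall>z\<in>upper_half. (G0 ij has_field_derivative q z * (Om m z :: 'n cmatrix) $ fst ij $ snd ij) (at z)" by blast
  then have G0: "(G0 (i, j) has_field_derivative q z * (Om m z :: 'n cmatrix) $ i $ j) (at z)" if "Im z > 0" for i j z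
    using that by (simp add: upper_half_iff)
  define Y where "Y z v = cscale (q z * v) (Om m z :: 'n cmatrix)" for z v
  define X where "X z v = Y z v + map_matrix cnj (Y z v)" for z v
  define W' :: "complex \<Rightarrow> 'n rmatrix" where "W' z = (\<chi> i j. 2 * Re (G0 (i, j) z))" for z
  define W where "W z = (cmat (W' z) :: 'n cmatrix)" for z
  have W: "(W has_derivative X z) (at z)" if z: "Im z > 0" for z
  proof (rule has_derivative_matrixI)
    fix i j
    have g: "(G0 (i, j) has_derivative (\<lambda>v. q z * Om m z $ i $ j * v)) (at z)"
      using G0[OF z, of i j] unfolding has_field_derivative_def .
    have "((\<lambda>z. G0 (i, j) z + cnj (G0 (i, j) z)) has_derivative
        (\<lambda>v. q z * Om m z $ i $ j * v + cnj (q z * Om m z $ i $ j * v))) (at z)"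
      by (intro has_derivative_add g bounded_linear.has_derivative[OF bounded_linear_cnj])
    moreover have "(\<lambda>z. W z $ i $ j) = (\<lambda>z. G0 (i, j) z + cnj (G0 (i, j) z))"
      by (rule ext) (simp add: W_def W'_def map_matrix_def complex_add_cnj)
    moreover have "(\<lambda>v. X z v $ i $ j) = (\<lambda>v. q z * Om m z $ i $ j * v + cnj (q z * Om m z $ i $ j * v))"
      by (rule ext) (simp add: X_def Y_def map_matrix_def mult_ac)
    ultimately show "((\<lambda>z. W z $ i $ j) has_derivative (\<lambda>v. X z v $ i $ j)) (at z)" by (simp only:)
  qed
  have psi: "matrix_inv (frame z) ** psi0 k q z v ** frame z = X z v" if "Im z > 0" for z v
    unfolding matrix_inv_frame[OF that] psi0_frame[OF that] X_def Y_def m_def ..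
  define u where "u g = W' (mob g \<i>) - iota g ** W' \<i> ** iota (inv2 g)" for g
  have per: "cmat (u g) = W (mob g z) - cmat (iota g) ** W z ** matrix_inv (cmat (iota g))" if g: "g \<in> \<Gamma>" and z: "Im z > 0" for g z
  proof -
    have d: "det g = 1" by (rule det_Gamma[OF g])
    define E where "E z = W (mob g z) - cmat (iota g) ** W z ** cmat (iota (inv2 g))" for z
    have "(E has_derivative (\<lambda>v. 0)) (at z)" if z: "Im z > 0" for z
    proof -
      have mob: "(mob g has_derivative (\<lambda>v. v / (autf g z)\<^sup>2)) (at z)"
        using mob_has_field_derivative[OF d z] unfolding has_field_derivative_def
        by (rule has_derivative_eq_rhs) (simp add: fun_eq_iff)
      have "(E has_derivative (\<lambda>v. X (mob g z) (v / (autf g z)\<^sup>2) - cmat (iota g) ** X z v ** cmat (iota (inv2 g)))) (at z)"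
        unfolding E_def
        by (intro has_derivative_diff has_derivative_compose[OF mob] W Im_mob(2) d z
            has_derivative_matrix_mult_left has_derivative_matrix_mult_right)
      moreover have "X (mob g z) (v / (autf g z)\<^sup>2) = cmat (iota g) ** X z v ** cmat (iota (inv2 g))" for v
      proof -
        \<comment> \<open>Of the k automorphy factors of \<open>q\<close>, one belongs to the
          tangent vector and the other k - 1 to \<open>Om m\<close>.\<close>
        have "q (mob g z) * (v / (autf g z)\<^sup>2) * (1 / (autf g z)\<^sup>2) ^ m = (q (mob g z) * (1 / (autf g z)\<^sup>2) ^ k) * v"
          using k by (simp add: m_def power_eq_if[of _ k])
        also have "\<dots> = q z * v" unfolding aut[OF g z] ..
        finally have "Y (mob g z) (v / (autf g z)\<^sup>2) = cmat (iota g) ** Y z v ** cmat (iota (inv2 g))"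
          unfolding Y_def Om_equivariant[OF d inv2_inverse(1)[OF d] z]
          by (simp add: cscale_mult_left cscale_mult_right vec_eq_iff flip: mult.assoc)
        then show ?thesis unfolding X_def
          by (simp add: map_matrix_cnj_mult map_matrix_cnj_cmat matrix_add_ldistrib matrix_add_rdistrib)
      qed
      ultimately show ?thesis by simp
    qed
    from constant_on_upper_half[OF this z, of \<i>] have "E z = E \<i>" by simp
    moreover have "E \<i> = cmat (u g)"
      unfolding E_def W_def u_def map_matrix_of_real_mult[symmetric]
      by (simp add: vec_eq_iff map_matrix_def)
    ultimately show ?thesis unfolding matrix_inv_cmat_iota(1)[OF d] E_def by simp
  qed
  have "u \<in> periods \<Gamma> (psi0 k q :: complex \<Rightarrow> complex \<Rightarrow> 'n cmatrix)"
    unfolding periods_def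
  proof (rule CollectI, rule exI[of _ frame], rule exI[of _ W], intro conjI ballI)
    show "flat_frame \<Gamma> (frame :: complex \<Rightarrow> 'n cmatrix)" by (rule flat_frame_frame[OF det_Gamma])
  next
    fix z assume "z \<in> upper_half"
    then have z: "Im z > 0" by (simp add: upper_half_iff)
    have "X z = (\<lambda>v. matrix_inv (frame z) ** psi0 k q z v ** frame z)" by (rule ext) (simp add: psi[OF z])
    with W[OF z] show "(W has_derivative (\<lambda>v. matrix_inv (frame z) ** psi0 k q z v ** frame z)) (at z)" by simp
    fix g assume "g \<in> \<Gamma>"
    from per[OF this z] show "cmat (u g) = W (mob g z) - cmat (iota g) ** W z ** matrix_inv (cmat (iota g))" .
  qed
  then show ?thesis by blast
qed

text \<open>Two parallel frames differ by a constant matrix on the right, and equality of their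
  monodromies makes it commute with \<open>iota\<close> on \<Gamma>. Since \<open>periods\<close>
  admits every flat frame, this reduces it to the explicit one.\<close>

lemma flat_frame_unique:
  assumes "flat_frame \<Gamma> (F :: complex \<Rightarrow> 'n::{finite,linorder} cmatrix)"
  obtains C C' where "C ** C' = mat 1" "C' ** C = mat 1" "\<And>z. Im z > 0 \<Longrightarrow> F z = frame z ** C"
    "\<And>z. Im z > 0 \<Longrightarrow> matrix_inv (F z) = C' ** frame_inv z"
    "\<And>g. g \<in> \<Gamma> \<Longrightarrow> C ** cmat (iota g) = cmat (iota g) ** C"
proof -
  have F: "invertible (F z)" "(F has_derivative (\<lambda>v. - (connD z v ** F z))) (at z)" if "Im z > 0" for z
    using assms that by (auto simp: flat_frame_def upper_half_iff)
  have Fg: "Jfac g z ** F (mob g z) ** cmat (iota g) = F z" if "g \<in> \<Gamma>" "Im z > 0" for g z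
    using assms that by (auto simp: flat_frame_def upper_half_iff)
  define C where "C = frame_inv \<i> ** F \<i>"
  define C' where "C' = matrix_inv (F \<i>) ** frame \<i>"
  have const: "frame_inv z ** F z = C" if z: "Im z > 0" for z
  proof -
    have "((\<lambda>z. frame_inv z ** F z) has_derivative (\<lambda>v. 0)) (at z)" if z: "Im z > 0" for z
    proof -
      have "((\<lambda>z. frame_inv z ** F z) has_derivative
          (\<lambda>v. frame_inv z ** (- (connD z v ** F z)) + (frame_inv z ** connD z v) ** F z)) (at z)"
        by (intro has_derivative_matrix_mult F z frame_has_derivative)
      then show ?thesis by (simp add: matrix_neg_right matrix_mul_assoc)
    qed
    from constant_on_upper_half[OF this z, of \<i>] show ?thesis by (simp add: C_def)
  qed
  have inv: "F z ** matrix_inv (F z) = mat 1" "matrix_inv (F z) ** F z = mat 1" if z: "Im z > 0" for z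
  proof -
    obtain G where "F z ** G = mat 1" "G ** F z = mat 1" using F(1)[OF z] unfolding invertible_def by blast
    then show "F z ** matrix_inv (F z) = mat 1" "matrix_inv (F z) ** F z = mat 1" using matrix_inv_eqI by metis+
  qed
  have eq: "F z = frame z ** C" if "Im z > 0" for z
    unfolding const[OF that, symmetric] by (simp add: matrix_mul_assoc frame_inverse[OF that])
  have I: "Im \<i> > 0" by simp
  have "C ** C' = frame_inv \<i> ** (F \<i> ** matrix_inv (F \<i>)) ** frame \<i>" by (simp only: C_def C'_def matrix_mul_assoc)
  then have CC: "C ** C' = mat 1" by (simp add: inv[OF I] frame_inverse[OF I])
  have C'C: "C' ** C = mat 1" using CC matrix_left_right_inverse by blast
  have inv_eq: "matrix_inv (F z) = C' ** frame_inv z" if z: "Im z > 0" for z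
  proof (rule matrix_inv_eqI)
    have "F z ** (C' ** frame_inv z) = frame z ** (C ** C') ** frame_inv z" unfolding eq[OF z] by (simp only: matrix_mul_assoc)
    then show *: "F z ** (C' ** frame_inv z) = mat 1" by (simp add: CC frame_inverse[OF z])
    show "C' ** frame_inv z ** F z = mat 1" by (rule iffD1[OF matrix_left_right_inverse *])
  qed
  have comm: "C ** cmat (iota g) = cmat (iota g) ** C" if g: "g \<in> \<Gamma>" for g
  proof -
    have d: "det g = 1" by (rule det_Gamma[OF g])
    let ?I = "cmat (iota g) :: 'n cmatrix" and ?I' = "cmat (iota (inv2 g)) :: 'n cmatrix"
    have w: "Im (mob g \<i>) > 0" by (rule Im_mob(2)[OF d I])
    have "Jfac g \<i> ** frame (mob g \<i>) ** ?I = frame \<i>" by (rule frame_equivariant[OF d I])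
    then have "Jfac g \<i> ** frame (mob g \<i>) ** (?I ** ?I') = frame \<i> ** ?I'" by (simp only: matrix_mul_assoc)
    then have f: "Jfac g \<i> ** frame (mob g \<i>) = frame \<i> ** ?I'" by (simp add: matrix_inv_cmat_iota(2)[OF d])
    have "frame \<i> ** (?I' ** C ** ?I) = Jfac g \<i> ** F (mob g \<i>) ** ?I"
      unfolding eq[OF w] matrix_mul_assoc f ..
    also have "\<dots> = frame \<i> ** C" unfolding Fg[OF g I] eq[OF I] ..
    finally have "frame_inv \<i> ** (frame \<i> ** (?I' ** C ** ?I)) = frame_inv \<i> ** (frame \<i> ** C)" by simp
    then have "?I' ** C ** ?I = C" unfolding matrix_mul_assoc by (simp add: frame_inverse[OF I] flip: matrix_mul_assoc)
    then have "?I ** (?I' ** C ** ?I) = ?I ** C" by simp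
    moreover have "?I ** (?I' ** C ** ?I) = (?I ** ?I') ** C ** ?I" by (simp only: matrix_mul_assoc)
    ultimately show ?thesis by (simp add: matrix_inv_cmat_iota(2)[OF d])
  qed
  show ?thesis using that[OF CC C'C eq inv_eq comm] .
qed

end

lemma commutes_with_distinct_diagm:
  fixes K :: "'a::field^'n^'n::finite"
  assumes "K ** diagm d = diagm d ** K" "\<And>i j. i \<noteq> j \<Longrightarrow> d i \<noteq> d j"
  shows "K = diagm (\<lambda>i. K $ i $ i)"
proof -
  have "K $ i $ j = 0" if "i \<noteq> j" for i j
  proof -
    have "(K ** diagm d) $ i $ j = (diagm d ** K) $ i $ j" using assms(1) by simp
    then have "K $ i $ j * (d j - d i) = 0" unfolding mult_diagm diagm_mult by (simp add: algebra_simps)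
    then show ?thesis using assms(2)[OF that] by simp
  qed
  then show ?thesis by (simp add: vec_eq_iff diagm_def)
qed

section \<open>Periods along the axis\<close>

context geodesic_pair
begin

text \<open>Uniform convergence along one period of the axis allows integration term by
  term.\<close>

lemma integral_Theta:
  "((\<lambda>t. Im (Theta \<Gamma> k \<beta> (axis t) * axis' t ^ k)) has_integral (\<Sum>\<^sub>\<infinity>C\<in>B.cosets. axis_integral C)) {0..A.len}"
proof -
  obtain K where K: "\<forall>C\<in>B.cosets. \<forall>t\<in>{0..A.len}. norm (axis_kernel (B.rep C) t ^ k) \<le> K * (norm (B.tt C \<i>))\<^sup>2"
    using axis_kernel_bound by blast
  \<comment> \<open>The value 0 off the cosets makes the partial sums continuous for every index set
    \<open>Y\<close>, as the exchange of limit and integral requires.\<close>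
  define f where "f C t = (if C \<in> B.cosets then axis_kernel (B.rep C) t ^ k else 0)" for C t
  have f: "continuous_on S (f C)" for S C
    by (cases "C \<in> B.cosets") (auto simp: f_def[abs_def] intro!: continuous_intros continuous_axis_kernel rep_Gamma)
  define g where "g t = (\<Sum>\<^sub>\<infinity>C\<in>B.cosets. f C t)" for t
  have lim: "uniform_limit {0..A.len} (\<lambda>Y t. \<Sum>C\<in>Y. f C t) g (finite_subsets_at_top B.cosets)"
    unfolding g_def
    by (rule Weierstrass_m_test_general[of _ _ _ "\<lambda>C. K * (norm (B.tt C \<i>))\<^sup>2"])
      (use K in \<open>auto simp: f_def intro!: summable_on_cmult_right B.summable_norm_tt_square\<close>)
  obtain I J where I: "\<And>Y. ((\<lambda>t. \<Sum>C\<in>Y. f C t) has_integral I Y) {0..A.len}"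
    and J: "(g has_integral J) {0..A.len}" "(I \<longlongrightarrow> J) (finite_subsets_at_top B.cosets)"
    by (rule uniform_limit_integral[OF lim]) (auto intro!: continuous_on_sum f)
  have "Im (I Y) = (\<Sum>C\<in>Y. axis_integral C)" if Y: "Y \<subseteq> B.cosets" for Y
  proof -
    have "((\<lambda>t. Im (f C t)) has_integral axis_integral C) {0..A.len}" if "C \<in> Y" for C
    proof -
      have "(\<lambda>t. Im (f C t)) integrable_on {0..A.len}"
        by (intro integrable_continuous_interval continuous_intros f)
      then show ?thesis using that Y by (auto simp: f_def axis_integral_def has_integral_integral)
    qed
    then have "((\<lambda>t. \<Sum>C\<in>Y. Im (f C t)) has_integral (\<Sum>C\<in>Y. axis_integral C)) {0..A.len}"
      by (cases "finite Y") (auto intro: has_integral_sum)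
    moreover have "((\<lambda>t. \<Sum>C\<in>Y. Im (f C t)) has_integral Im (I Y)) {0..A.len}"
      using has_integral_Im[OF I[of Y]] by simp
    ultimately show ?thesis by (rule has_integral_unique[symmetric])
  qed
  then have "\<forall>\<^sub>F Y in finite_subsets_at_top B.cosets. Im (I Y) = (\<Sum>C\<in>Y. axis_integral C)"
    by (auto simp: eventually_finite_subsets_at_top)
  with tendsto_Im[OF J(2)] have "(axis_integral has_sum Im J) B.cosets"
    unfolding has_sum_def by (rule Lim_transform_eventually)
  then have "Im J = (\<Sum>\<^sub>\<infinity>C\<in>B.cosets. axis_integral C)" by (rule infsumI[symmetric])
  moreover have "g t = Theta \<Gamma> k \<beta> (axis t) * axis' t ^ k" for t
  proof -
    have "Theta \<Gamma> k \<beta> (axis t) * axis' t ^ k = (\<Sum>\<^sub>\<infinity>C\<in>B.cosets. B.tt C (axis t) ^ k * axis' t ^ k)"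
      unfolding B.Theta_eq[OF Im_axis] by (rule infsum_cmult_left'[symmetric])
    also have "\<dots> = g t" unfolding g_def
    proof (rule infsum_cong)
      fix C assume C: "C \<in> B.cosets"
      show "B.tt C (axis t) ^ k * axis' t ^ k = f C t"
        unfolding f_def axis_kernel_tt[OF C B.rep_mem[OF C]] using C by (simp add: power_mult_distrib)
    qed
    finally show ?thesis ..
  qed
  ultimately show ?thesis using has_integral_Im[OF J(1)] by simp
qed

text \<open>The power of \<mu> with exponent 2 pos i - n - 1, which is an eigenvalue of
  \<open>iota \<alpha>\<close>.\<close>

definition eig :: "'n::{finite,linorder} \<Rightarrow> real" where
  "eig i = \<mu>A ^ (pos i - 1) * (1 / \<mu>A) ^ (CARD('n) - pos i)"

lemma eig_ne_0: "eig i \<noteq> 0"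
  using A.mu_ne_0 by (simp add: eig_def)

lemma eig_strict_mono:
  fixes i j :: "'n::{finite,linorder}"
  assumes "i < j"
  shows "\<bar>eig i\<bar> < \<bar>eig j\<bar>"
proof -
  let ?m = "\<bar>\<mu>A\<bar>"
  have "pos i < pos j" using assms by (simp add: pos_less_iff)
  moreover have "1 \<le> pos i" "pos j \<le> CARD('n)" by (rule pos_ge_1, rule pos_le_card)
  ultimately have l: "pos i - 1 < pos j - 1" "CARD('n) - pos j < CARD('n) - pos i" by linarith+
  have "?m ^ (pos i - 1) * (1 / ?m) ^ (CARD('n) - pos i) < ?m ^ (pos j - 1) * (1 / ?m) ^ (CARD('n) - pos j)"
    using A.mu by (intro mult_strict_mono power_strict_increasing power_strict_decreasing l) auto
  then show ?thesis by (simp add: eig_def abs_mult power_abs)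
qed

lemma eig_distinct: "i \<noteq> j \<Longrightarrow> eig i \<noteq> eig j"
  using eig_strict_mono[of i j] eig_strict_mono[of j i] by (metis less_irrefl linorder_neqE)

lemma iota_alpha: "iota \<alpha> = (iota MA ** diagm eig ** iota (inv2 MA) :: 'n::{finite,linorder} rmatrix)"
proof -
  have "iota \<alpha> ** iota MA = (iota MA ** diagm eig :: 'n rmatrix)"
    unfolding iota_eq_sympow sympow_mult[symmetric] A.gamma_M eig_def[abs_def] sympow_diag[symmetric] ..
  then have "iota \<alpha> ** (iota MA ** iota (inv2 MA)) = (iota MA ** diagm eig ** iota (inv2 MA) :: 'n rmatrix)"
    unfolding matrix_mul_assoc by simp
  then show ?thesis by (simp add: matrix_inv_cmat_iota(4)[OF A.det_M])
qed

text \<open>In the eigenbasis of \<open>iota \<alpha>\<close> the conjugation in the cocycle is by a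
  diagonal matrix, so on the diagonal the period is the increment of \<open>W\<close> from
  \<open>axis 0\<close> to \<open>axis A.len\<close>. The change of frame is diagonal in this basis,
  too, and disappears.\<close>

lemma period_diagonal:
  fixes u :: "real^2^2 \<Rightarrow> 'n::{finite,linorder} rmatrix"
  assumes u: "u \<in> periods \<Gamma> (psi0 k (\<lambda>z. \<i> * Theta \<Gamma> k \<beta> z))"
  shows "(iota (inv2 MA) ** u \<alpha> ** iota MA) $ j $ j = - 2 * Re (axis_coeff (k - 1) j) * (\<Sum>\<^sub>\<infinity>C\<in>B.cosets. axis_integral C)"
proof -
  let ?q = "\<lambda>z. \<i> * Theta \<Gamma> k \<beta> z"
  define m where "m = k - 1"
  have km: "k = Suc m" using k by (simp add: m_def)
  obtain F W where F: "flat_frame \<Gamma> (F :: complex \<Rightarrow> 'n cmatrix)"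
    and FW: "\<forall>z\<in>upper_half. (W has_derivative (\<lambda>v. matrix_inv (F z) ** psi0 k ?q z v ** F z)) (at z) \<and>
      (\<forall>g\<in>\<Gamma>. cmat (u g) = W (mob g z) - cmat (iota g) ** W z ** matrix_inv (cmat (iota g)))"
    using u unfolding periods_def by blast
  have W: "(W has_derivative (\<lambda>v. matrix_inv (F z) ** psi0 k ?q z v ** F z)) (at z)" if "Im z > 0" for z
    using FW that by (simp add: upper_half_iff)
  have per: "cmat (u \<alpha>) = W (mob \<alpha> z) - cmat (iota \<alpha>) ** W z ** matrix_inv (cmat (iota \<alpha>))" if "Im z > 0" for z
    using bspec[OF FW] A.gamma that by (simp only: upper_half_iff)
  obtain C C' where CC: "C ** C' = mat 1" "C' ** C = mat 1"
    and FC: "\<And>z. Im z > 0 \<Longrightarrow> F z = frame z ** C" "\<And>z. Im z > 0 \<Longrightarrow> matrix_inv (F z) = C' ** frame_inv z"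
    and comm: "\<And>g. g \<in> \<Gamma> \<Longrightarrow> C ** cmat (iota g) = cmat (iota g) ** C"
    by (rule A.flat_frame_unique[OF F]) blast
  define N N' where "N = (cmat (iota MA) :: 'n cmatrix)" and "N' = (cmat (iota (inv2 MA)) :: 'n cmatrix)"
  have NN: "N ** N' = mat 1" "N' ** N = mat 1"
    unfolding N_def N'_def by (rule matrix_inv_cmat_iota[OF A.det_M])+
  define D D' where "D = diagm (\<lambda>i :: 'n. complex_of_real (eig i))" and "D' = diagm (\<lambda>i :: 'n. 1 / complex_of_real (eig i))"
  have DD: "D ** D' = mat 1" "D' ** D = mat 1"
    unfolding D_def D'_def diagm_diagm by (simp_all add: diagm_const_1 eig_ne_0)
  have I: "cmat (iota \<alpha>) = N ** D ** N'"
  proof -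
    have "cmat (diagm eig) = D" by (simp add: vec_eq_iff map_matrix_def diagm_def D_def)
    then show ?thesis unfolding iota_alpha N_def N'_def by (simp add: map_matrix_of_real_mult)
  qed
  have cancel: "N' ** (N ** X) = X" "N ** (N' ** X) = X" "D ** (D' ** X) = X" "C ** (C' ** X) = X" "C' ** (C ** X) = X" for X
    by (simp_all add: matrix_mul_assoc NN DD CC)
  have I': "matrix_inv (cmat (iota \<alpha>)) = N ** D' ** N'"
    unfolding I by (rule matrix_inv_eqI) (simp_all add: cancel NN DD matrix_mul_assoc[symmetric], simp_all add: matrix_mul_assoc NN DD)
  define K K' where "K = N' ** C ** N" and "K' = N' ** C' ** N"
  have comm': "C' ** cmat (iota \<alpha>) = cmat (iota \<alpha>) ** C'"
  proof -
    have "C' ** cmat (iota \<alpha>) = C' ** (cmat (iota \<alpha>) ** C) ** C'" by (simp add: CC flip: matrix_mul_assoc)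
    also have "\<dots> = cmat (iota \<alpha>) ** C'" unfolding comm[OF A.gamma, symmetric] by (simp add: CC matrix_mul_assoc)
    finally show ?thesis .
  qed
  have diag: "N' ** Z ** N = diagm (\<lambda>i. (N' ** Z ** N) $ i $ i)" if Z: "Z ** cmat (iota \<alpha>) = cmat (iota \<alpha>) ** Z" for Z
  proof (rule commutes_with_distinct_diagm)
    have "(N' ** Z ** N) ** D = N' ** (Z ** cmat (iota \<alpha>)) ** N"
      unfolding I by (simp add: NN flip: matrix_mul_assoc)
    also have "\<dots> = D ** (N' ** Z ** N)"
      unfolding Z unfolding I by (simp add: cancel flip: matrix_mul_assoc)
    finally show "N' ** Z ** N ** diagm (\<lambda>i. of_real (eig i)) = diagm (\<lambda>i. of_real (eig i)) ** (N' ** Z ** N)"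
      unfolding D_def .
    show "complex_of_real (eig i) \<noteq> of_real (eig j)" if "i \<noteq> j" for i j :: 'n using eig_distinct[OF that] by simp
  qed
  define \<kappa> \<kappa>' where "\<kappa> = (\<lambda>i. K $ i $ i)" and "\<kappa>' = (\<lambda>i. K' $ i $ i)"
  have K: "K = diagm \<kappa>" "K' = diagm \<kappa>'"
    unfolding \<kappa>_def \<kappa>'_def K_def K'_def by (rule diag, rule comm[OF A.gamma], rule diag, rule comm')
  have "K' ** K = mat 1" unfolding K_def K'_def by (simp add: cancel NN flip: matrix_mul_assoc)
  then have "(K' ** K) $ j $ j = 1" by (simp add: mat_def)
  then have kk: "\<kappa>' j * \<kappa> j = 1" unfolding K diagm_diagm by (simp add: diagm_def)
  have conj: "(N' ** (C' ** X ** C) ** N) $ j $ j = (N' ** X ** N) $ j $ j" for X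
  proof -
    have "N' ** (C' ** X ** C) ** N = K' ** (N' ** X ** N) ** K"
      unfolding K_def K'_def by (simp add: cancel flip: matrix_mul_assoc)
    then show ?thesis unfolding K using kk by (simp add: diagm_mult mult_diagm mult_ac)
  qed
  \<comment> \<open>The given primitive \<open>W\<close> may have a complex constant of integration;
    the period is real, so the real part carries all that is needed.\<close>
  define h where "h t = Re ((N' ** W (axis t) ** N) $ j $ j)" for t
  \<comment> \<open>The factor 2 comes from adding the complex conjugate, and the sign and the
    imaginary part from Re(i x) = -Im x.\<close>
  define r where "r t = - 2 * Re (axis_coeff m j) * Im (Theta \<Gamma> k \<beta> (axis t) * axis' t ^ k)" for t
  have h: "(h has_vector_derivative r t) (at t)" for t
  proof -
    let ?z = "axis t"
    let ?X = "\<lambda>v. matrix_inv (F ?z) ** psi0 k ?q ?z v ** F ?z"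
    have ax: "(axis has_derivative (\<lambda>s. s *\<^sub>R axis' t)) (at t)"
      using axis_has_vector_derivative unfolding has_vector_derivative_def .
    have "((\<lambda>t. N' ** W (axis t) ** N) has_derivative (\<lambda>s. N' ** ?X (s *\<^sub>R axis' t) ** N)) (at t)"
      by (intro has_derivative_matrix_mult_left has_derivative_matrix_mult_right has_derivative_compose[OF ax W[OF Im_axis]])
    from bounded_linear.has_derivative[OF bounded_linear_Re has_derivative_matrix_nth[OF this]]
    have "(h has_derivative (\<lambda>s. Re ((N' ** ?X (s *\<^sub>R axis' t) ** N) $ j $ j))) (at t)" unfolding h_def .
    moreover have "Re ((N' ** ?X (s *\<^sub>R axis' t) ** N) $ j $ j) = s *\<^sub>R r t" for s
    proof -
      define Y where "Y = cscale (?q ?z * (s *\<^sub>R axis' t)) (Om m ?z :: 'n cmatrix)"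
      have "?X (s *\<^sub>R axis' t) = C' ** (frame_inv ?z ** psi0 k ?q ?z (s *\<^sub>R axis' t) ** frame ?z) ** C"
        unfolding FC(2)[OF Im_axis] unfolding FC(1)[OF Im_axis] by (simp only: matrix_mul_assoc)
      also have "frame_inv ?z ** psi0 k ?q ?z (s *\<^sub>R axis' t) ** frame ?z = Y + map_matrix cnj Y"
        unfolding psi0_frame[OF Im_axis] Y_def m_def ..
      finally have "(N' ** ?X (s *\<^sub>R axis' t) ** N) $ j $ j = (N' ** (Y + map_matrix cnj Y) ** N) $ j $ j"
        by (simp only: conj)
      also have "N' ** (Y + map_matrix cnj Y) ** N = N' ** Y ** N + map_matrix cnj (N' ** Y ** N)"
        by (simp add: map_matrix_cnj_mult map_matrix_cnj_cmat matrix_add_ldistrib matrix_add_rdistrib N_def N'_def)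
      finally have 1: "Re ((N' ** ?X (s *\<^sub>R axis' t) ** N) $ j $ j) = 2 * Re ((N' ** Y ** N) $ j $ j)"
        by (simp add: map_matrix_def)
      have w: "Im (\<i> * complex_of_real (exp t)) > 0" by simp
      \<comment> \<open>Equivariance under \<open>MA\<close> turns the eigenbasis of
        \<open>iota \<alpha>\<close> into the standard basis and the axis into the imaginary axis,
        where \<open>Om_axis\<close> applies.\<close>
      have "N' ** Om m ?z ** N = cscale ((1 / (autf MA (\<i> * of_real (exp t)))\<^sup>2) ^ m) (Om m (\<i> * of_real (exp t)))"
        unfolding axis_def Om_equivariant[OF A.det_M inv2_inverse(1)[OF A.det_M] w] N_def[symmetric] N'_def[symmetric]
        by (simp add: cscale_mult_left cscale_mult_right cancel NN flip: matrix_mul_assoc)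
      then have "(N' ** Om m ?z ** N) $ j $ j = axis_coeff m j * axis' t ^ m"
        using Om_axis[of "exp t" m j] by (simp add: axis'_def power_divide power_mult_distrib)
      then have "(N' ** Y ** N) $ j $ j = s *\<^sub>R (\<i> * (Theta \<Gamma> k \<beta> ?z * axis' t ^ k) * axis_coeff m j)"
        unfolding Y_def km by (simp add: cscale_mult_left cscale_mult_right scaleR_conv_of_real mult_ac)
      moreover have "Im (axis_coeff m j) = 0" using arg_cong[OF axis_coeff_real[of m j], of Im] by simp
      ultimately show ?thesis unfolding 1 r_def by (simp add: algebra_simps)
    qed
    ultimately show ?thesis unfolding has_vector_derivative_def by simp
  qed
  have "(r has_integral h A.len - h 0) {0..A.len}"
    by (rule fundamental_theorem_of_calculus) (use A.len_pos h in \<open>auto intro: has_vector_derivative_at_within\<close>)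
  moreover have "(r has_integral - 2 * Re (axis_coeff m j) * (\<Sum>\<^sub>\<infinity>C\<in>B.cosets. axis_integral C)) {0..A.len}"
    unfolding r_def by (rule has_integral_mult_right[OF integral_Theta])
  ultimately have eq: "h A.len - h 0 = - 2 * Re (axis_coeff m j) * (\<Sum>\<^sub>\<infinity>C\<in>B.cosets. axis_integral C)" by (rule has_integral_unique)
  have "cmat (u \<alpha>) = W (axis A.len) - N ** D ** N' ** W (axis 0) ** (N ** D' ** N')"
    using per[OF Im_axis[of 0]] unfolding axis_translate I' by (simp add: I)
  then have "N' ** cmat (u \<alpha>) ** N = N' ** W (axis A.len) ** N - D ** (N' ** W (axis 0) ** N) ** D'"
    by (simp add: matrix_diff_ldistrib matrix_diff_rdistrib cancel NN flip: matrix_mul_assoc)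
  then have "Re ((N' ** cmat (u \<alpha>) ** N) $ j $ j) = h A.len - h 0"
    unfolding D_def D'_def h_def using eig_ne_0[of j] by (simp add: diagm_mult mult_diagm)
  moreover have "N' ** cmat (u \<alpha>) ** N = cmat (iota (inv2 MA) ** u \<alpha> ** iota MA)"
    unfolding N_def N'_def map_matrix_of_real_mult ..
  ultimately show ?thesis unfolding eq m_def by (simp add: map_matrix_def)
qed

lemma has_dlog_lambda_Theta:
  fixes j :: "'n::{finite,linorder}"
  assumes p: "pos j + p = CARD('n) + 1" "1 \<le> p"
  shows "has_dlog_lambda \<Gamma> p \<alpha> (psi0 k (\<lambda>z. \<i> * Theta \<Gamma> k \<beta> z) :: complex \<Rightarrow> complex \<Rightarrow> 'n cmatrix)
    (- 2 * Re (axis_coeff (k - 1) j) * (\<Sum>\<^sub>\<infinity>C\<in>B.cosets. axis_integral C))"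
  unfolding has_dlog_lambda_def
proof (intro conjI ballI allI impI)
  let ?\<psi> = "psi0 k (\<lambda>z. \<i> * Theta \<Gamma> k \<beta> z) :: complex \<Rightarrow> complex \<Rightarrow> 'n cmatrix"
  let ?d = "- 2 * Re (axis_coeff (k - 1) j) * (\<Sum>\<^sub>\<infinity>C\<in>B.cosets. axis_integral C)"
  show "periods \<Gamma> ?\<psi> \<noteq> {}"
  proof (rule A.periods_nonempty)
    show "(\<lambda>z. \<i> * Theta \<Gamma> k \<beta> z) holomorphic_on upper_half"
      by (intro holomorphic_intros B.Theta_holomorphic k)
    show "1 \<le> k" using k by simp
    show "\<i> * Theta \<Gamma> k \<beta> (mob g z) * (1 / (autf g z)\<^sup>2) ^ k = \<i> * Theta \<Gamma> k \<beta> z" if "g \<in> \<Gamma>" "Im z > 0" for g z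
      using B.Theta_automorphic[OF that, of k] by (simp add: mult.assoc)
  qed
  define N N' where "N = (iota MA :: 'n rmatrix)" and "N' = (iota (inv2 MA) :: 'n rmatrix)"
  have NN: "N ** N' = mat 1" "N' ** N = mat 1"
    unfolding N_def N'_def by (rule matrix_inv_cmat_iota[OF A.det_M])+
  have I: "iota \<alpha> = N ** diagm eig ** N'" unfolding N_def N'_def by (rule iota_alpha)
  define L where "L E = (N' ** E ** N) $ j $ j / eig j" for E
  have D: "((\<lambda>A. ln (lambda_eig p A)) has_derivative L) (at (iota \<alpha>))"
    unfolding L_def by (rule has_derivative_ln_lambda_eig[OF NN I eig_ne_0 eig_strict_mono p])
  fix u assume u: "u \<in> periods \<Gamma> ?\<psi>"
  \<comment> \<open>The factor \<open>iota \<alpha>\<close> of the tangent vector contributes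
    \<open>eig j\<close> to the diagonal entry and cancels the denominator in
    \<open>L\<close>.\<close>
  have "N' ** (u \<alpha> ** iota \<alpha>) ** N = (N' ** u \<alpha> ** N) ** diagm eig ** (N' ** N)"
    unfolding I by (simp only: matrix_mul_assoc)
  then have "L (u \<alpha> ** iota \<alpha>) = (N' ** u \<alpha> ** N) $ j $ j"
    unfolding L_def using eig_ne_0[of j] by (simp add: NN mult_diagm)
  then have L: "L (u \<alpha> ** iota \<alpha>) = ?d" unfolding N_def N'_def by (simp only: period_diagonal[OF u])
  show "\<exists>L. ((\<lambda>A. ln (lambda_eig p A)) has_derivative L) (at (iota \<alpha>)) \<and> L (u \<alpha> ** iota \<alpha>) = ?d"
    using D L by blast
  fix c assume "tangent_curve \<Gamma> u c"
  then have c: "c 0 \<alpha> = iota \<alpha>" "((\<lambda>t. c t \<alpha>) has_derivative (\<lambda>t. t *\<^sub>R (u \<alpha> ** iota \<alpha>))) (at 0)"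
    using A.gamma by (auto simp: tangent_curve_def has_vector_derivative_def)
  have "((\<lambda>t. ln (lambda_eig p (c t \<alpha>))) has_derivative (\<lambda>t. L (t *\<^sub>R (u \<alpha> ** iota \<alpha>)))) (at 0)"
    by (rule has_derivative_compose[OF c(2)]) (simp only: c(1) D)
  moreover have "L (t *\<^sub>R (u \<alpha> ** iota \<alpha>)) = ?d * t" for t
    using linear_cmul[OF has_derivative_linear[OF D], of t "u \<alpha> ** iota \<alpha>"] unfolding L by (simp add: mult.commute)
  ultimately show "((\<lambda>t. ln (lambda_eig p (c t \<alpha>))) has_real_derivative ?d) (at 0)"
    unfolding has_field_derivative_def by (simp only:)
qed

end

section \<open>Closed geodesics in normal form and the reciprocity of derivatives\<close>

lemma simple_closed_geodesic_hyperbolic_element: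
  assumes "closed_hyperbolic_surface \<Gamma>" "simple_closed_geodesic \<Gamma> \<gamma>"
  obtains M \<mu> where "hyperbolic_element \<Gamma> \<gamma> M \<mu>"
proof -
  have s: "surface \<Gamma>" using assms(1) by (rule surface.intro)
  have g: "\<gamma> \<in> \<Gamma>" "\<bar>trace \<gamma>\<bar> > 2" using assms(2) by (simp_all add: simple_closed_geodesic_def)
  obtain M \<mu> where "det M = 1" "\<bar>\<mu>\<bar> > 1" "\<gamma> ** M = M ** mat2 \<mu> 0 0 (1 / \<mu>)" "\<And>z. theta \<gamma> z = thM M z"
    by (rule hyperbolic_normal_form[OF surface.det_Gamma[OF s g(1)] g(2)]) blast
  with s g show ?thesis by (intro that hyperbolic_element.intro hyperbolic_element_axioms.intro)
qed

theorem theorem1p0p4: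
  fixes \<Gamma> :: "(real^2^2) set" and \<alpha> \<beta> :: "real^2^2" and k p :: nat
  assumes "closed_hyperbolic_surface \<Gamma>"
    and "CARD('n::{finite,linorder}) \<ge> 2"
    and "1 \<le> p" "p \<le> CARD('n)" "2 \<le> k" "k \<le> CARD('n)"
    and "simple_closed_geodesic \<Gamma> \<alpha>" "simple_closed_geodesic \<Gamma> \<beta>"
  shows "\<exists>d. has_dlog_lambda \<Gamma> p \<alpha>
               (psi0 k (\<lambda>z. \<i> * Theta \<Gamma> k \<beta> z) :: complex \<Rightarrow> complex \<Rightarrow> 'n cmatrix) d
           \<and> has_dlog_lambda \<Gamma> p \<beta>
               (psi0 k (\<lambda>z. \<i> * Theta \<Gamma> k \<alpha> z) :: complex \<Rightarrow> complex \<Rightarrow> 'n cmatrix) (- d)"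
proof -
  obtain MA \<mu>A where A: "hyperbolic_element \<Gamma> \<alpha> MA \<mu>A"
    by (rule simple_closed_geodesic_hyperbolic_element[OF assms(1,7)])
  obtain MB \<mu>B where B: "hyperbolic_element \<Gamma> \<beta> MB \<mu>B"
    by (rule simple_closed_geodesic_hyperbolic_element[OF assms(1,8)])
  interpret AB: geodesic_pair \<Gamma> \<alpha> MA \<mu>A \<beta> MB \<mu>B k
    by (intro geodesic_pair.intro geodesic_pair_axioms.intro A B assms(5))
  interpret BA: geodesic_pair \<Gamma> \<beta> MB \<mu>B \<alpha> MA \<mu>A k
    by (intro geodesic_pair.intro geodesic_pair_axioms.intro A B assms(5))
  \<comment> \<open>\<open>p\<close> counts from the largest eigenvalue, \<open>pos\<close> from the
    smallest.\<close>
  have "1 \<le> CARD('n) + 1 - p" "CARD('n) + 1 - p \<le> CARD('n)" using assms(3,4) by linarith+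
  then obtain j :: 'n where "pos j = CARD('n) + 1 - p" using pos_surj by blast
  then have j: "pos j + p = CARD('n) + 1" using assms(4) by linarith
  let ?S = "\<Sum>\<^sub>\<infinity>C\<in>AB.B.cosets. AB.axis_integral C"
  \<comment> \<open>Both derivatives carry the same factor \<open>axis_coeff (k - 1) j\<close>, so
    the antisymmetry of the sums of integrals passes to them.\<close>
  have "- 2 * Re (axis_coeff (k - 1) j) * (\<Sum>\<^sub>\<infinity>C\<in>AB.A.cosets. BA.axis_integral C) = - (- 2 * Re (axis_coeff (k - 1) j) * ?S)"
    unfolding AB.infsum_axis_integral_antisym by simp
  with BA.has_dlog_lambda_Theta[OF j assms(3)] AB.has_dlog_lambda_Theta[OF j assms(3)]
  show ?thesis by metis
qed

end
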